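(* Let $\varphi:[0,+\infty[\to\mathbb{R}_+$ be a Borel function with $\int_0^\infty\varphi(u)\,du=1$, let $\Phi(s)=\int_0^s\varphi(u)\,du$, and let $Q_0^\varphi$ be the probability measure on $(\Omega,\mathcal{F}_\infty)$ such that $$Q_0^\varphi(\Gamma_t)=E_0\big[1_{\Gamma_t}\big((S_t-X_t)\varphi(S_t)+1-\Phi(S_t)\big)\big],\qquad t\ge0,\ \Gamma_t\in\mathcal{F}_t.$$ Then $$Q_0^\varphi(\cdot)=\int_0^\infty Q_0^{(y)}(\cdot)\,\varphi(y)\,dy.$$
   Context: $\Omega=\mathcal{C}(\mathbb{R}_+,\mathbb{R})$ is the canonical space, $(X_t)_{t\ge0}$ the coordinate process, $\mathcal{F}_t=\sigma(X_s;0\le s\le t)$, $\mathcal{F}_\infty=\sigma(X_s;s\ge0)$; $P_0$ is the Wiener measure started at $0$, with expectation $E_0$. $S_t=\sup_{0\le u\le t}X_u$, $T_y=\inf\{t\ge0;X_t=y\}$. The process $(S_t-X_t)\varphi(S_t)+1-\Phi(S_t)$ is a $P_0$-martingale equal to $1$ at $t=0$. For $y>0$, $Q_0^{(y)}$ is the probability measure on $(\Omega,\mathcal{F}_\infty)$ under which: $(X_t;t\le T_y)$ is a Brownian motion started at $0$ and considered up to its first hitting time of $y$; $(y-X_{t+T_y};t\ge0)$ is a three-dimensional Bessel process started at $0$; and these two processes are independent. *)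

theory Defs
  imports "HOL-Probability.Probability"
begin

definition path_space :: "(real \<Rightarrow> real) set" where
  "path_space = {\<omega> \<in> extensional {0..}. continuous_on {0..} \<omega>}"

definition coord_algebra :: "real set \<Rightarrow> (real \<Rightarrow> real) measure" where
  "coord_algebra I = sigma path_space
     {(\<lambda>\<omega>. \<omega> s) -` B \<inter> path_space | s B. s \<in> I \<and> B \<in> sets borel}"

abbreviation canon_filt :: "real \<Rightarrow> (real \<Rightarrow> real) measure" where
  "canon_filt t \<equiv> coord_algebra {0..t}"

abbreviation canon_inf :: "(real \<Rightarrow> real) measure" where
  "canon_inf \<equiv> coord_algebra {0..}"

text \<open>The Wiener measure started at 0; this predicate determines it uniquely.
  Independence over the infinite index set \<^term>\<open>UNIV :: nat set\<close> means independence of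
  every finite subfamily of the increments.\<close>

definition wiener_measure :: "(real \<Rightarrow> real) measure \<Rightarrow> bool" where
  "wiener_measure P \<longleftrightarrow>
     prob_space P \<and> sets P = sets canon_inf \<and>
     (AE \<omega> in P. \<omega> 0 = 0) \<and>
     (\<forall>s t. 0 \<le> s \<and> s < t \<longrightarrow>
        distributed P lborel (\<lambda>\<omega>. \<omega> t - \<omega> s) (normal_density 0 (sqrt (t - s)))) \<and>
     (\<forall>\<tau> :: nat \<Rightarrow> real. 0 \<le> \<tau> 0 \<and> incseq \<tau> \<longrightarrow>
        prob_space.indep_vars P (\<lambda>_. borel) (\<lambda>i \<omega>. \<omega> (\<tau> (Suc i)) - \<omega> (\<tau> i)) UNIV)"

definition run_sup :: "real \<Rightarrow> (real \<Rightarrow> real) \<Rightarrow> real" where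
  "run_sup t \<omega> = (SUP u\<in>{0..t}. \<omega> u)"

text \<open>The value is \<^term>\<open>\<infinity> :: ereal\<close> if the level is never reached.\<close>

definition hit_time :: "real \<Rightarrow> (real \<Rightarrow> real) \<Rightarrow> ereal" where
  "hit_time y \<omega> = (INF t\<in>{t. 0 \<le> t \<and> \<omega> t = y}. ereal t)"

definition stopped_path :: "real \<Rightarrow> (real \<Rightarrow> real) \<Rightarrow> real \<Rightarrow> real" where
  "stopped_path y \<omega> = (\<lambda>t\<in>{0..}. \<omega> (real_of_ereal (min (ereal t) (hit_time y \<omega>))))"

text \<open>On paths that never reach \<open>y\<close> the time shift is by
  \<^term>\<open>real_of_ereal \<infinity>\<close>, which is 0. Under the measures considered below
  such paths form a null set.\<close>

definition post_path :: "real \<Rightarrow> (real \<Rightarrow> real) \<Rightarrow> real \<Rightarrow> real" where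
  "post_path y \<omega> = (\<lambda>t\<in>{0..}. y - \<omega> (t + real_of_ereal (hit_time y \<omega>)))"

text \<open>The law of the three-dimensional Bessel process started at 0, that is, of the
  Euclidean norm of a three-dimensional Brownian motion started at 0; \<open>P\<close> is the Wiener measure.\<close>

definition bessel3_law :: "(real \<Rightarrow> real) measure \<Rightarrow> (real \<Rightarrow> real) measure" where
  "bessel3_law P = distr (P \<Otimes>\<^sub>M P \<Otimes>\<^sub>M P) canon_inf
     (\<lambda>(\<alpha>, \<beta>, \<gamma>). \<lambda>t\<in>{0..}. sqrt ((\<alpha> t)\<^sup>2 + (\<beta> t)\<^sup>2 + (\<gamma> t)\<^sup>2))"

text \<open>\<open>Q\<close> is the measure $Q_0^{(y)}$. Brownian motion considered up to its hitting time
  \<open>T\<close> of \<open>y\<close> is encoded by the path stopped at \<open>T\<close>, which determines \<open>T\<close>.\<close>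

definition is_Q_level ::
  "(real \<Rightarrow> real) measure \<Rightarrow> real \<Rightarrow> (real \<Rightarrow> real) measure \<Rightarrow> bool" where
  "is_Q_level P y Q \<longleftrightarrow>
     prob_space Q \<and> sets Q = sets canon_inf \<and>
     distr Q canon_inf (stopped_path y) = distr P canon_inf (stopped_path y) \<and>
     distr Q canon_inf (post_path y) = bessel3_law P \<and>
     prob_space.indep_var Q canon_inf (stopped_path y) canon_inf (post_path y)"

definition primitive_fn :: "(real \<Rightarrow> real) \<Rightarrow> real \<Rightarrow> real" where
  "primitive_fn \<phi> s = (LINT u:{0..s}|lborel. \<phi> u)"

text \<open>\<open>Q\<close> is the measure $Q_0^\varphi$.\<close>

definition is_Q_phi ::
  "(real \<Rightarrow> real) measure \<Rightarrow> (real \<Rightarrow> real) \<Rightarrow> (real \<Rightarrow> real) measure \<Rightarrow> bool" where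
  "is_Q_phi P \<phi> Q \<longleftrightarrow>
     prob_space Q \<and> sets Q = sets canon_inf \<and>
     (\<forall>t\<ge>0. \<forall>\<Gamma>\<in>sets (canon_filt t).
        measure Q \<Gamma> = (LINT \<omega>|P. indicator \<Gamma> \<omega> *
          ((run_sup t \<omega> - \<omega> t) * \<phi> (run_sup t \<omega>) + 1 - primitive_fn \<phi> (run_sup t \<omega>))))"

end

theory Submission
  imports Defs
begin

text \<open>
  Write \<open>S\<close> for the running supremum and let \<open>F\<close> be a bounded continuous functional of the path up to
  time \<open>t\<close>. By Fubini, the part \<open>E[F (1 - \<Phi>(S\<^sub>t))]\<close> of \<open>Q\<^sup>\<phi>(F)\<close> is the mixture of the
  \<open>E[F; T\<^sub>y > t] = Q\<^sup>y(F; T\<^sub>y > t)\<close>, as up to \<open>T\<^sub>y\<close> the path has the same law under \<open>Q\<^sup>y\<close> as under \<open>P\<close>.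
  What remains is that the measure \<open>E[F (S\<^sub>t - X\<^sub>t); S\<^sub>t \<in> dy]\<close> has density \<open>Q\<^sup>y(F; T\<^sub>y \<le> t)\<close>.

  No transition density is needed for this. On \<open>y \<le> S\<^sub>t < y + e\<close> apply optional stopping at \<open>T\<^sub>y\<close>: after \<open>T\<^sub>y\<close>
  the path is weighted by \<open>y + e - X\<^sub>t\<close> and killed at \<open>y + e\<close>, so by the \<open>h\<close>-transform it becomes \<open>y + e\<close> minus a
  three-dimensional Bessel process started at \<open>e\<close>, with total mass \<open>e\<close>. Dividing by \<open>e\<close>, averaging over \<open>y\<close> in an
  interval and letting \<open>e\<close> tend to 0 gives the density. The \<open>h\<close>-transform combines the reflection principle with
  the identity \<open>v E[G(\<bar>v e\<^sub>1 + W\<^sub>d\<bar>)] = E[(v + w\<^sub>d) G(\<bar>v + w\<^sub>d\<bar>)]\<close> between three-dimensional and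
  one-dimensional Brownian motion, which is explicit for \<open>G r = exp (- m r\<^sup>2)\<close> and extends by the Weierstrass
  theorem in the variable \<open>exp (- r\<^sup>2)\<close>.
\<close>

section \<open>Paths and their measurability\<close>

text \<open>The parameter e keeps the argument away from a degenerate point: weighted by y - X and
  killed at y, a path has no weight left at T_y, so the Bessel process from 0 is reached only as a
  limit of h-transforms started at e. Two obstacles shape the rest. The weight z - X is unbounded,
  while the Markov property and optional stopping are used for bounded variables; hence cylinder
  functionals are products of continuous functions of bounded support, and the empty product is
  excluded where the weight must be bounded. And the measures Q^y are given one level at a time,
  with nothing assumed on their dependence on y; measurability in y is produced from functions
  jointly measurable in level and path at e > 0, and passes to the limit. Killing is removed by
  oddness: (z - x) G \<bar>z - x\<bar> changes sign under reflection at z, so its conditional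
  expectation after the hitting time vanishes and the killed path may be replaced by the free one.
  No strong Markov property is used: stopping runs over grid times that approach the hitting time
  from the right.\<close>

lemma space_coord_algebra [simp]: "space (coord_algebra I) = path_space"
  unfolding coord_algebra_def by (rule space_measure_of) auto

lemma sets_coord_algebra:
  "sets (coord_algebra I) = sigma_sets path_space
     {(\<lambda>\<omega>. \<omega> s) -` B \<inter> path_space | s B. s \<in> I \<and> B \<in> sets borel}"
  unfolding coord_algebra_def by (rule sets_measure_of) auto

lemma measurable_coord: "s \<in> I \<Longrightarrow> (\<lambda>\<omega>. \<omega> s) \<in> borel_measurable (coord_algebra I)"
  by (rule measurableI) (auto simp: sets_coord_algebra intro!: sigma_sets.Basic)

lemma measurable_coord_algebraI:
  assumes "\<And>x. x \<in> space M \<Longrightarrow> f x \<in> path_space"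
    and "\<And>s. s \<in> I \<Longrightarrow> (\<lambda>x. f x s) \<in> borel_measurable M"
  shows "f \<in> M \<rightarrow>\<^sub>M coord_algebra I"
  unfolding coord_algebra_def
proof (rule measurable_measure_of)
  fix A assume "A \<in> {(\<lambda>\<omega>. \<omega> s) -` B \<inter> path_space | s B. s \<in> I \<and> B \<in> sets borel}"
  then obtain s B where A: "A = (\<lambda>\<omega>. \<omega> s) -` B \<inter> path_space" and s: "s \<in> I" and B: "B \<in> sets borel"
    by auto
  have "f -` A \<inter> space M = (\<lambda>x. f x s) -` B \<inter> space M"
    using assms(1) by (auto simp: A)
  then show "f -` A \<inter> space M \<in> sets M"
    using measurable_sets[OF assms(2)[OF s] B] by simp
qed (use assms(1) in auto)

lemma sets_coord_algebra_mono: "I \<subseteq> J \<Longrightarrow> sets (coord_algebra I) \<subseteq> sets (coord_algebra J)"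
  unfolding sets_coord_algebra by (rule sigma_sets_mono') auto

lemma measurable_ident_coord_algebra:
  "I \<subseteq> J \<Longrightarrow> (\<lambda>\<omega>. \<omega>) \<in> coord_algebra J \<rightarrow>\<^sub>M coord_algebra I"
  by (rule measurable_coord_algebraI) (auto intro: measurable_coord)

lemma measurable_coord_algebra_mono:
  "f \<in> coord_algebra I \<rightarrow>\<^sub>M N \<Longrightarrow> I \<subseteq> J \<Longrightarrow> f \<in> coord_algebra J \<rightarrow>\<^sub>M N"
  using measurable_compose[OF measurable_ident_coord_algebra] by blast

lemma path_continuous_on: "\<omega> \<in> path_space \<Longrightarrow> continuous_on {0..} \<omega>"
  by (simp add: path_space_def)

lemma path_tendsto:
  assumes "\<omega> \<in> path_space" "\<And>n. 0 \<le> u n" "u \<longlonglongrightarrow> x" "0 \<le> x"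
  shows "(\<lambda>n. \<omega> (u n)) \<longlonglongrightarrow> \<omega> x"
  using continuous_on_tendsto_compose[OF path_continuous_on[OF assms(1)] assms(3)] assms by auto

text \<open>By compactness, a closed condition is met on an interval iff it is met approximately
  at countably many times.\<close>

lemma sets_path_meets_closed:
  fixes f :: "real \<Rightarrow> real"
  assumes q: "0 \<le> q" "q \<le> s" and f: "continuous_on UNIV f"
  shows "{\<omega> \<in> path_space. \<exists>u\<in>{q..s}. f (\<omega> u) \<le> 0} \<in> sets (canon_filt s)"
proof -
  \<comment> \<open>An affine image of the rationals of [0, 1], so that both end points q and s
    belong to \<open>D\<close> even when they are irrational or coincide.\<close>
  define D where "D = (\<lambda>r. q + (s - q) * r) ` (\<rat> \<inter> {0..1})"
  have D: "countable D" unfolding D_def by (intro countable_image countable_Int1 countable_rat)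
  have Dsub: "D \<subseteq> {q..s}"
  proof
    fix x assume "x \<in> D"
    then obtain r where r: "0 \<le> r" "r \<le> 1" "x = q + (s - q) * r" by (auto simp: D_def)
    have "(s - q) * r \<le> (s - q) * 1" using r q by (intro mult_left_mono) auto
    with r q show "x \<in> {q..s}" by auto
  qed
  have dense: "\<exists>u\<in>D. \<bar>u - v\<bar> < d" if v: "v \<in> {q..s}" and d: "0 < d" for v d
  proof (cases "q = s")
    case True
    then have "v \<in> D" using v unfolding D_def by (auto intro!: image_eqI[of _ _ 0])
    then show ?thesis using d by force
  next
    case False
    then have qs: "q < s" using q by auto
    show ?thesis
    proof (cases "v < s")
      case True
      then have "v < min s (v + d)" using d by auto
      then have "(v - q) / (s - q) < (min s (v + d) - q) / (s - q)"
        using qs by (simp add: divide_strict_right_mono)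
      then obtain r where r: "r \<in> \<rat>" "(v - q) / (s - q) < r" "r < (min s (v + d) - q) / (s - q)"
        using Rats_dense_in_real by blast
      then have "v - q < r * (s - q)" "r * (s - q) < min s (v + d) - q"
        using qs by (simp_all add: divide_less_eq less_divide_eq)
      moreover have "0 \<le> r" using r v qs by (smt (verit) divide_nonneg_pos atLeastAtMost_iff)
      moreover have "(min s (v + d) - q) / (s - q) \<le> 1" using qs by (simp add: divide_le_eq)
      ultimately show ?thesis using r d unfolding D_def
        by (intro bexI[of _ "q + (s - q) * r"]) (auto simp: mult.commute)
    next
      case False
      then have "v = s" using v by auto
      moreover have "s \<in> D" unfolding D_def by (auto intro!: image_eqI[of _ _ 1])
      ultimately show ?thesis using d by (intro bexI[of _ s]) auto
    qed
  qed
  have eq: "{\<omega> \<in> path_space. \<exists>u\<in>{q..s}. f (\<omega> u) \<le> 0} =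
    {\<omega> \<in> space (canon_filt s). \<forall>n::nat. \<exists>u\<in>D. f (\<omega> u) < 1 / Suc n}"
    (is "?L = ?R")
  proof (intro equalityI subsetI)
    fix \<omega> assume "\<omega> \<in> ?L"
    then obtain v where w: "\<omega> \<in> path_space" and v: "v \<in> {q..s}" "f (\<omega> v) \<le> 0" by auto
    have c: "continuous_on {q..s} (\<lambda>u. f (\<omega> u))"
      by (intro continuous_on_compose2[OF f] continuous_on_subset[OF path_continuous_on[OF w]])
         (use q in auto)
    have "\<exists>u\<in>D. f (\<omega> u) < 1 / Suc n" for n
    proof -
      obtain d where d: "d > 0" "\<And>u. u \<in> {q..s} \<Longrightarrow> dist u v < d \<Longrightarrow> dist (f (\<omega> u)) (f (\<omega> v)) < 1 / Suc n"
        using c v(1) unfolding continuous_on_iff by (metis of_nat_0_less_iff zero_less_Suc zero_less_divide_1_iff)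
      obtain u where u: "u \<in> D" "\<bar>u - v\<bar> < d" using dense[OF v(1) d(1)] by auto
      have "dist (f (\<omega> u)) (f (\<omega> v)) < 1 / Suc n" using d(2) u Dsub by (auto simp: dist_real_def)
      then show ?thesis using u v(2) by (intro bexI[of _ u]) (auto simp: dist_real_def)
    qed
    then show "\<omega> \<in> ?R" using w by auto
  next
    fix \<omega> assume R: "\<omega> \<in> ?R"
    then have w: "\<omega> \<in> path_space" by auto
    have c: "continuous_on {q..s} (\<lambda>u. f (\<omega> u))"
      by (intro continuous_on_compose2[OF f] continuous_on_subset[OF path_continuous_on[OF w]])
         (use q in auto)
    obtain v where v: "v \<in> {q..s}" "\<And>u. u \<in> {q..s} \<Longrightarrow> f (\<omega> v) \<le> f (\<omega> u)"
      using continuous_attains_inf[OF compact_Icc _ c] q by (metis atLeastAtMost_iff empty_iff order_refl)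
    have "f (\<omega> v) \<le> 0"
    proof (rule ccontr)
      assume "\<not> f (\<omega> v) \<le> 0"
      then obtain n where n: "1 / Suc n < f (\<omega> v)" using nat_approx_posE[of "f (\<omega> v)"] by auto
      from R obtain u where "u \<in> D" "f (\<omega> u) < 1 / Suc n" by auto
      then show False using v(2)[of u] Dsub n by auto
    qed
    then show "\<omega> \<in> ?L" using w v by auto
  qed
  have [measurable]: "(\<lambda>\<omega>. f (\<omega> u)) \<in> borel_measurable (canon_filt s)" if "u \<in> D" for u
    by (rule measurable_compose[OF measurable_coord borel_measurable_continuous_onI[OF f]])
       (use that Dsub q in auto)
  have "?R = (\<Inter>n. \<Union>u\<in>D. {\<omega> \<in> space (canon_filt s). f (\<omega> u) < 1 / Suc n})" by auto
  also have "\<dots> \<in> sets (canon_filt s)"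
    apply (rule sets.countable_INT, safe)
    apply (rule sets.countable_UN''[OF D])
    apply measurable
    done
  finally show ?thesis unfolding eq .
qed

lemma pred_path_below:
  assumes "0 \<le> q" "q \<le> s"
  shows "Measurable.pred (canon_filt s) (\<lambda>\<omega>. \<forall>u\<in>{q..s}. \<omega> u < z)"
proof -
  have "{\<omega> \<in> path_space. \<exists>u\<in>{q..s}. z - \<omega> u \<le> 0} \<in> sets (canon_filt s)"
    by (rule sets_path_meets_closed[OF assms]) (intro continuous_intros)
  then have "Measurable.pred (canon_filt s) (\<lambda>\<omega>. \<exists>u\<in>{q..s}. z - \<omega> u \<le> 0)"
    by (simp add: pred_def)
  then have "Measurable.pred (canon_filt s) (\<lambda>\<omega>. \<not> (\<exists>u\<in>{q..s}. z - \<omega> u \<le> 0))"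
    by measurable
  then show ?thesis by (simp add: not_le)
qed

section \<open>Running supremum and hitting times\<close>

lemma run_sup_attained:
  assumes "\<omega> \<in> path_space" "0 \<le> t"
  shows "\<exists>v\<in>{0..t}. run_sup t \<omega> = \<omega> v \<and> (\<forall>u\<in>{0..t}. \<omega> u \<le> \<omega> v)"
proof -
  have c: "continuous_on {0..t} \<omega>"
    by (rule continuous_on_subset[OF path_continuous_on[OF assms(1)]]) auto
  obtain v where v: "v \<in> {0..t}" "\<And>u. u \<in> {0..t} \<Longrightarrow> \<omega> u \<le> \<omega> v"
    using continuous_attains_sup[OF compact_Icc _ c] assms by (metis atLeastAtMost_iff empty_iff order_refl)
  have "run_sup t \<omega> = \<omega> v" unfolding run_sup_def
    by (rule cSup_eq_maximum) (use v in auto)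
  then show ?thesis using v by auto
qed

lemma run_sup_less_iff:
  assumes "\<omega> \<in> path_space" "0 \<le> t"
  shows "run_sup t \<omega> < z \<longleftrightarrow> (\<forall>u\<in>{0..t}. \<omega> u < z)"
  using run_sup_attained[OF assms] by (metis le_less_trans)

lemma le_run_sup: "\<omega> \<in> path_space \<Longrightarrow> 0 \<le> u \<Longrightarrow> u \<le> t \<Longrightarrow> \<omega> u \<le> run_sup t \<omega>"
  using run_sup_attained[of \<omega> t] by force

lemma measurable_run_sup:
  assumes "0 \<le> t"
  shows "run_sup t \<in> borel_measurable (canon_filt t)"
proof (rule borel_measurableI_less)
  fix z
  have "{\<omega> \<in> space (canon_filt t). \<forall>u\<in>{0..t}. \<omega> u < z} \<in> sets (canon_filt t)"
    using pred_path_below[of 0 t z] assms by (simp add: pred_def)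
  also have "{\<omega> \<in> space (canon_filt t). \<forall>u\<in>{0..t}. \<omega> u < z} = {\<omega> \<in> space (canon_filt t). run_sup t \<omega> < z}"
    using run_sup_less_iff[OF _ assms] by auto
  finally show "{\<omega> \<in> space (canon_filt t). run_sup t \<omega> < z} \<in> sets (canon_filt t)" .
qed

lemma hit_time_nonneg: "0 \<le> hit_time y \<omega>"
  unfolding hit_time_def by (rule INF_greatest) auto

lemma hit_time_le: "0 \<le> t \<Longrightarrow> \<omega> t = y \<Longrightarrow> hit_time y \<omega> \<le> ereal t"
  unfolding hit_time_def by (rule INF_lower) auto

text \<open>The set of visits to y is closed by continuity, so its infimum, once finite, is itself a
  visit.\<close>

lemma hit_time_attained:
  assumes w: "\<omega> \<in> path_space" and fin: "hit_time y \<omega> < \<infinity>"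
  shows "\<exists>t\<ge>0. hit_time y \<omega> = ereal t \<and> \<omega> t = y"
proof -
  define T where "T = {t. 0 \<le> t \<and> \<omega> t = y}"
  have ne: "T \<noteq> {}" using fin unfolding hit_time_def T_def[symmetric] by (auto simp: top_ereal_def)
  have "closed ({0..} \<inter> \<omega> -` {y})"
    by (intro continuous_closed_preimage path_continuous_on[OF w]) auto
  then have cl: "closed T" by (rule back_subst[of closed]) (auto simp: T_def)
  have bb: "bdd_below T" unfolding T_def by (rule bdd_belowI[of _ 0]) auto
  have m: "Inf T \<in> T" by (rule closed_contains_Inf[OF ne bb cl])
  have "hit_time y \<omega> = ereal (Inf T)"
    unfolding hit_time_def T_def[symmetric]
    by (rule antisym) (use m bb in \<open>auto intro!: INF_lower INF_greatest cInf_lower\<close>)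
  then show ?thesis using m by (auto simp: T_def)
qed

lemma hit_time_le_iff:
  assumes w: "\<omega> \<in> path_space"
  shows "hit_time y \<omega> \<le> ereal s \<longleftrightarrow> (\<exists>u\<in>{0..s}. \<omega> u = y)"
proof
  assume *: "hit_time y \<omega> \<le> ereal s"
  then obtain t where "0 \<le> t" "hit_time y \<omega> = ereal t" "\<omega> t = y" using hit_time_attained[OF w] by force
  then show "\<exists>u\<in>{0..s}. \<omega> u = y" using * by auto
next
  assume "\<exists>u\<in>{0..s}. \<omega> u = y"
  then obtain u where "u \<in> {0..s}" "\<omega> u = y" by auto
  then show "hit_time y \<omega> \<le> ereal s" using hit_time_le[of u \<omega> y] order_trans by fastforce
qed

lemma measurable_hit_time: "hit_time y \<in> borel_measurable canon_inf"
proof (rule borel_measurableI_le)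
  fix a :: ereal
  have "hit_time y -` {..a} \<inter> space canon_inf \<in> sets canon_inf"
  proof (cases a)
    case (real s)
    show ?thesis
    proof (cases "0 \<le> s")
      case True
      have "hit_time y -` {..a} \<inter> space canon_inf = {\<omega> \<in> path_space. \<exists>u\<in>{0..s}. \<bar>\<omega> u - y\<bar> \<le> 0}"
        using hit_time_le_iff[of _ y s] real by (simp add: vimage_def Int_def) blast
      also have "\<dots> \<in> sets (canon_filt s)"
        by (rule sets_path_meets_closed) (use True in \<open>auto intro!: continuous_intros\<close>)
      finally show ?thesis using sets_coord_algebra_mono[of "{0..s}" "{0..}"] by auto
    next
      case False
      then have "hit_time y -` {..a} \<inter> space canon_inf = {}"
        using hit_time_le_iff real by auto
      then show ?thesis by simp
    qed
  next
    case PInf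
    then have "hit_time y -` {..a} \<inter> space canon_inf = space canon_inf" by auto
    then show ?thesis by (metis sets.top)
  next
    case MInf
    have "\<not> hit_time y \<omega> \<le> -\<infinity>" for \<omega> using hit_time_nonneg[of y \<omega>] by auto
    then have "hit_time y -` {..a} \<inter> space canon_inf = {}" unfolding MInf by auto
    then show ?thesis by simp
  qed
  then show "{\<omega> \<in> space canon_inf. hit_time y \<omega> \<le> a} \<in> sets canon_inf"
    by (simp add: vimage_def Int_def conj_commute)
qed

text \<open>Only coordinates at fixed times are measurable by construction. Rounding the random time
  up to a multiple of \<open>1 / Suc n\<close> leaves countably many times, and continuity of the
  path removes the rounding in the limit.\<close>

lemma measurable_path_eval:
  assumes f[measurable]: "f \<in> borel_measurable M" and nn: "\<And>x. x \<in> space M \<Longrightarrow> 0 \<le> f x"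
    and g[measurable]: "g \<in> M \<rightarrow>\<^sub>M canon_inf"
  shows "(\<lambda>x. g x (f x)) \<in> borel_measurable M"
proof (rule borel_measurable_LIMSEQ_real)
  fix x assume x: "x \<in> space M"
  then have p: "g x \<in> path_space" using measurable_space[OF g] by auto
  have ub: "(\<lambda>n. f x + 1 / Suc n) \<longlonglongrightarrow> f x"
    using tendsto_add[OF tendsto_const[of "f x"] LIMSEQ_Suc[OF lim_1_over_n[where 'a=real]]] by simp
  have bds: "f x \<le> of_int \<lceil>f x * Suc n\<rceil> / Suc n" "of_int \<lceil>f x * Suc n\<rceil> / Suc n \<le> f x + 1 / Suc n" for n
  proof -
    have 1: "f x * Suc n \<le> of_int \<lceil>f x * Suc n\<rceil>" "of_int \<lceil>f x * Suc n\<rceil> \<le> f x * Suc n + 1"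
      using ceiling_correct[of "f x * Suc n"] by linarith+
    have 2: "f x = (f x * Suc n) / Suc n" "f x + 1 / Suc n = (f x * Suc n + 1) / Suc n"
      by (simp_all add: add_divide_distrib)
    show "f x \<le> of_int \<lceil>f x * Suc n\<rceil> / Suc n"
      by (subst 2(1)) (rule divide_right_mono[OF 1(1)], simp)
    show "of_int \<lceil>f x * Suc n\<rceil> / Suc n \<le> f x + 1 / Suc n"
      by (subst 2(2)) (rule divide_right_mono[OF 1(2)], simp)
  qed
  have "(\<lambda>n. real_of_int \<lceil>f x * Suc n\<rceil> / Suc n) \<longlonglongrightarrow> f x"
    by (rule tendsto_sandwich[OF always_eventually always_eventually tendsto_const ub]) (use bds in blast)+
  moreover have "real (nat \<lceil>f x * Suc n\<rceil>) = of_int \<lceil>f x * Suc n\<rceil>" for n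
  proof -
    have "0 \<le> f x * Suc n" using nn[OF x] by (intro mult_nonneg_nonneg) auto
    then have "0 \<le> \<lceil>f x * Suc n\<rceil>" by linarith
    then show ?thesis by (rule of_nat_nat)
  qed
  ultimately have "(\<lambda>n. real (nat \<lceil>f x * Suc n\<rceil>) / Suc n) \<longlonglongrightarrow> f x"
    by (simp only:)
  from path_tendsto[OF p _ this nn[OF x]]
  show "(\<lambda>n. g x (real (nat \<lceil>f x * Suc n\<rceil>) / Suc n)) \<longlonglongrightarrow> g x (f x)"
    by (simp only: divide_nonneg_nonneg of_nat_0_le_iff)
next
  fix n
  show "(\<lambda>x. g x (real (nat \<lceil>f x * Suc n\<rceil>) / Suc n)) \<in> borel_measurable M"
  proof (rule measurable_compose_countable[where g="\<lambda>x. nat \<lceil>f x * Suc n\<rceil>"])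
    fix i :: nat
    show "(\<lambda>x. g x (real i / Suc n)) \<in> borel_measurable M"
      by (rule measurable_compose[OF g measurable_coord]) auto
  qed measurable
qed

section \<open>Markov property\<close>

lemma measurable_canon_filt_mono:
  "f \<in> canon_filt q \<rightarrow>\<^sub>M N \<Longrightarrow> q \<le> t \<Longrightarrow> f \<in> canon_filt t \<rightarrow>\<^sub>M N"
  by (erule measurable_coord_algebra_mono) auto

lemma measurable_canon_inf:
  "f \<in> canon_filt q \<rightarrow>\<^sub>M N \<Longrightarrow> f \<in> canon_inf \<rightarrow>\<^sub>M N"
  by (erule measurable_coord_algebra_mono) auto

lemma Int_stable_boxes:
  "Int_stable {{\<omega> \<in> path_space. \<forall>u\<in>J. \<omega> u \<in> B u} | J B. finite J \<and> J \<subseteq> I \<and> (\<forall>u. B u \<in> sets borel)}"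
proof (rule Int_stableI, safe)
  fix J J' :: "real set" and B B' :: "real \<Rightarrow> real set"
  assume *: "finite J" "J \<subseteq> I" "\<forall>u. B u \<in> sets borel" "finite J'" "J' \<subseteq> I" "\<forall>u. B' u \<in> sets borel"
  let ?B = "\<lambda>u. (if u \<in> J then B u else UNIV) \<inter> (if u \<in> J' then B' u else UNIV)"
  have "{\<omega> \<in> path_space. \<forall>u\<in>J. \<omega> u \<in> B u} \<inter> {\<omega> \<in> path_space. \<forall>u\<in>J'. \<omega> u \<in> B' u}
    = {\<omega> \<in> path_space. \<forall>u\<in>J \<union> J'. \<omega> u \<in> ?B u}" by auto
  moreover have "finite (J \<union> J')" "J \<union> J' \<subseteq> I" "\<forall>u. ?B u \<in> sets borel" using * by auto
  ultimately show "\<exists>Ja Ba. {\<omega> \<in> path_space. \<forall>u\<in>J. \<omega> u \<in> B u} \<inter> {\<omega> \<in> path_space. \<forall>u\<in>J'. \<omega> u \<in> B' u} =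
      {\<omega> \<in> path_space. \<forall>u\<in>Ja. \<omega> u \<in> Ba u} \<and> finite Ja \<and> Ja \<subseteq> I \<and> (\<forall>u. Ba u \<in> sets borel)"
    by (intro exI[of _ "J \<union> J'"] exI[of _ ?B]) simp
qed

text \<open>Unlike the one-coordinate sets of the definition, the finite-dimensional boxes are
  stable under intersection, as Dynkin arguments demand.\<close>

lemma sets_coord_algebra_boxes:
  "sets (coord_algebra I) = sigma_sets path_space
    {{\<omega> \<in> path_space. \<forall>u\<in>J. \<omega> u \<in> B u} | J B. finite J \<and> J \<subseteq> I \<and> (\<forall>u. B u \<in> sets borel)}"
  (is "_ = sigma_sets _ ?G")
proof
  show "sets (coord_algebra I) \<subseteq> sigma_sets path_space ?G"
    unfolding sets_coord_algebra
  proof (rule sigma_sets_mono', safe)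
    fix s :: real and B :: "real set" assume "s \<in> I" "B \<in> sets borel"
    then show "\<exists>J Ba. (\<lambda>\<omega>. \<omega> s) -` B \<inter> path_space = {\<omega> \<in> path_space. \<forall>u\<in>J. \<omega> u \<in> Ba u} \<and>
        finite J \<and> J \<subseteq> I \<and> (\<forall>u. Ba u \<in> sets borel)"
      by (intro exI[of _ "{s}"] exI[of _ "\<lambda>_. B"]) auto
  qed
  have "?G \<subseteq> sets (coord_algebra I)"
  proof safe
    fix J :: "real set" and B :: "real \<Rightarrow> real set"
    assume *: "finite J" "J \<subseteq> I" "\<forall>u. B u \<in> sets borel"
    have "{\<omega> \<in> space (coord_algebra I). \<forall>u\<in>J. \<omega> u \<in> B u} \<in> sets (coord_algebra I)"
    proof (rule sets.sets_Collect_finite_All[OF _ *(1)])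
      fix u assume "u \<in> J"
      then show "{\<omega> \<in> space (coord_algebra I). \<omega> u \<in> B u} \<in> sets (coord_algebra I)"
        using * measurable_sets[OF measurable_coord[of u I], of "B u"] by (auto simp: vimage_def Int_def conj_commute)
    qed
    then show "{\<omega> \<in> path_space. \<forall>u\<in>J. \<omega> u \<in> B u} \<in> sets (coord_algebra I)" by simp
  qed
  then show "sigma_sets path_space ?G \<subseteq> sets (coord_algebra I)"
    using sets.sigma_sets_subset[of ?G "coord_algebra I"] by simp
qed

section \<open>Wiener measure: independence of the past and an increment\<close>

locale wiener_space =
  fixes P :: "(real \<Rightarrow> real) measure"
  assumes wiener: "wiener_measure P"
begin

sublocale prob_space P using wiener by (simp add: wiener_measure_def)

lemma sets_P [measurable_cong]: "sets P = sets canon_inf" using wiener by (simp add: wiener_measure_def)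

lemma space_P [simp]: "space P = path_space" using sets_eq_imp_space_eq[OF sets_P] by simp

lemma AE_start: "AE \<omega> in P. \<omega> 0 = 0" using wiener by (simp add: wiener_measure_def)

lemma measurable_P: "f \<in> canon_filt q \<rightarrow>\<^sub>M N \<Longrightarrow> f \<in> P \<rightarrow>\<^sub>M N"
  unfolding measurable_cong_sets[OF sets_P refl] by (rule measurable_canon_inf)

lemma measurable_coord_P [measurable]: "0 \<le> s \<Longrightarrow> (\<lambda>\<omega>. \<omega> s) \<in> borel_measurable P"
  by (rule measurable_P[where q=s], rule measurable_coord) auto

lemma measurable_increment: "0 \<le> q \<Longrightarrow> q \<le> t \<Longrightarrow> (\<lambda>\<omega>. \<omega> t - \<omega> q) \<in> borel_measurable P"
  by (intro borel_measurable_diff measurable_coord_P) auto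

lemma measurable_id_P: "(\<lambda>\<omega>. \<omega>) \<in> P \<rightarrow>\<^sub>M canon_filt q"
  by (rule measurable_P[where q=q]) simp

text \<open>\<open>wiener_measure\<close> prescribes laws of increments only; the almost sure start
  at 0 turns the increment from 0 into the coordinate.\<close>

lemma distr_coord:
  assumes "0 < d"
  shows "distr P borel (\<lambda>\<omega>. \<omega> d) = density lborel (normal_density 0 (sqrt d))"
proof -
  have *: "distributed P lborel (\<lambda>\<omega>. \<omega> d - \<omega> 0) (normal_density 0 (sqrt (d - 0)))"
    using wiener assms unfolding wiener_measure_def by blast
  have "distr P borel (\<lambda>\<omega>. \<omega> d) = distr P borel (\<lambda>\<omega>. \<omega> d - \<omega> 0)"
    by (rule distr_cong_AE) (use AE_start assms in auto)
  also have "\<dots> = distr P lborel (\<lambda>\<omega>. \<omega> d - \<omega> 0)" by (rule distr_cong) auto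
  also have "\<dots> = density lborel (normal_density 0 (sqrt d))"
    using distributed_distr_eq_density[OF *] by simp
  finally show ?thesis .
qed

lemma distr_increment:
  assumes "0 \<le> q" "q \<le> t"
  shows "distr P borel (\<lambda>\<omega>. \<omega> t - \<omega> q) = distr P borel (\<lambda>\<omega>. \<omega> (t - q))"
proof (cases "q = t")
  case True
  then show ?thesis by (intro distr_cong_AE) (use AE_start assms in auto)
next
  case False
  then have *: "distributed P lborel (\<lambda>\<omega>. \<omega> t - \<omega> q) (normal_density 0 (sqrt (t - q)))"
    using wiener assms unfolding wiener_measure_def by auto
  have "distr P borel (\<lambda>\<omega>. \<omega> t - \<omega> q) = distr P lborel (\<lambda>\<omega>. \<omega> t - \<omega> q)"
    by (rule distr_cong) auto
  also have "\<dots> = density lborel (normal_density 0 (sqrt (t - q)))"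
    using distributed_distr_eq_density[OF *] by simp
  finally show ?thesis using distr_coord[of "t - q"] False assms by simp
qed

text \<open>Independence is postulated along a sequence of times. The sequence taken here lists 0,
  the times of \<open>J\<close> and q in increasing order and stays at t afterwards. Up to a null
  set the box depends on the increments before q, and the event for \<open>C\<close> on the single
  increment from q to t.\<close>

lemma prob_increment_box:
  assumes q: "0 \<le> q" "q < t" and J: "finite J" "J \<subseteq> {0..q}" and B: "\<And>u. B u \<in> sets borel"
    and C: "C \<in> sets borel"
  shows "prob ({\<omega> \<in> path_space. \<forall>u\<in>J. \<omega> u \<in> B u} \<inter> {\<omega> \<in> path_space. \<omega> t - \<omega> q \<in> C}) =
    prob {\<omega> \<in> path_space. \<forall>u\<in>J. \<omega> u \<in> B u} * prob {\<omega> \<in> path_space. \<omega> t - \<omega> q \<in> C}"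
proof -
  define xs where "xs = sorted_list_of_set (insert 0 (insert q J))"
  define n where "n = length xs"
  have fin: "finite (insert 0 (insert q J))" using J(1) by simp
  have set: "set xs = insert 0 (insert q J)"
    unfolding xs_def by (rule set_sorted_list_of_set[OF fin])
  have srt: "sorted xs" unfolding xs_def by (rule sorted_sorted_list_of_set)
  have n: "0 < n" using set unfolding n_def by (cases xs) auto
  have xs_range: "xs ! i \<in> {0..q}" if "i < n" for i
    using nth_mem[of i xs] that set J(2) q unfolding n_def by auto
  have xs0: "xs ! 0 = 0"
  proof -
    obtain i where "i < n" "xs ! i = 0" using set unfolding n_def by (metis in_set_conv_nth insertI1)
    then have "xs ! 0 \<le> 0" using srt sorted_nth_mono[of xs 0 i] unfolding n_def by auto
    then show ?thesis using xs_range[OF n] by auto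
  qed
  have xsl: "xs ! (n - 1) = q"
  proof -
    obtain i where "i < n" "xs ! i = q" using set unfolding n_def by (metis in_set_conv_nth insertI1 insertI2)
    then have "q \<le> xs ! (n - 1)" using srt sorted_nth_mono[of xs i "n - 1"] unfolding n_def by auto
    then show ?thesis using xs_range[of "n - 1"] n by auto
  qed
  \<comment> \<open>\<open>n - 1\<close> is the position of q, so increment number
    \<open>n - 1\<close> leads from q to t and all later ones vanish.\<close>
  define \<tau> where "\<tau> i = (if i < n then xs ! i else t)" for i
  have inc: "incseq \<tau>"
  proof (rule incseq_SucI)
    fix i
    show "\<tau> i \<le> \<tau> (Suc i)"
      using sorted_nth_mono[OF srt, of i "Suc i"] xs_range[of i] q unfolding \<tau>_def n_def
      by (simp add: order_trans[of _ q t])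
  qed
  let ?X = "\<lambda>i \<omega>. \<omega> (\<tau> (Suc i)) - \<omega> (\<tau> i) :: real"
  have \<tau>0: "\<tau> 0 = 0" using n xs0 by (simp add: \<tau>_def)
  have ind: "indep_vars (\<lambda>_. borel) ?X UNIV"
    by (rule wiener[unfolded wiener_measure_def, THEN conjunct2, THEN conjunct2, THEN conjunct2,
          THEN conjunct2, THEN spec[of _ \<tau>], THEN mp]) (simp add: inc \<tau>0)
  have ind2: "indep_var (PiM {..<n-1} (\<lambda>_. borel)) (\<lambda>\<omega>. restrict (\<lambda>i. ?X i \<omega>) {..<n-1})
      (PiM {n-1} (\<lambda>_. borel)) (\<lambda>\<omega>. restrict (\<lambda>i. ?X i \<omega>) {n-1})"
    by (rule indep_var_restrict[OF ind]) auto
  \<comment> \<open>Position of u in the list: for a path starting from 0, \<omega> u is the sum of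
    the increments before that position.\<close>
  define idx where "idx u = (SOME i. i < n \<and> xs ! i = u)" for u
  have idx: "idx u < n \<and> xs ! idx u = u" if "u \<in> J" for u
    unfolding idx_def by (rule someI_ex) (use set that in \<open>metis insertI2 in_set_conv_nth n_def\<close>)
  define A where "A = {x \<in> space (PiM {..<n-1} (\<lambda>_. borel::real measure)). \<forall>u\<in>J. (\<Sum>j<idx u. x j) \<in> B u}"
  have A: "A \<in> sets (PiM {..<n-1} (\<lambda>_. borel))"
    unfolding A_def
  proof (rule sets.sets_Collect_finite_All[OF _ J(1)])
    fix u assume u: "u \<in> J"
    have "(\<lambda>x. \<Sum>j<idx u. x j) \<in> borel_measurable (PiM {..<n-1} (\<lambda>_. borel::real measure))"
      by (intro borel_measurable_sum measurable_component_singleton) (use idx[OF u] in auto)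
    from measurable_sets[OF this B[of u]]
    show "{x \<in> space (Pi\<^sub>M {..<n - 1} (\<lambda>_. borel)). (\<Sum>j<idx u. x j) \<in> B u} \<in> sets (Pi\<^sub>M {..<n - 1} (\<lambda>_. borel))"
      by (auto simp: vimage_def Int_def conj_commute)
  qed
  define A' where "A' = {\<omega> \<in> path_space. \<forall>u\<in>J. (\<Sum>j<idx u. ?X j \<omega>) \<in> B u}"
  define C' where "C' = {x \<in> space (PiM {n-1} (\<lambda>_. borel::real measure)). x (n-1) \<in> C}"
  have C': "C' \<in> sets (PiM {n-1} (\<lambda>_. borel))"
    using measurable_sets[OF measurable_component_singleton[of "n-1" "{n-1}" "\<lambda>_. borel"] C]
    unfolding C'_def by (auto simp: vimage_def Int_def conj_commute)
  have X_last: "?X (n-1) \<omega> = \<omega> t - \<omega> q" for \<omega>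
    using n xsl by (simp add: \<tau>_def)
  have pre: "(\<lambda>\<omega>. restrict (\<lambda>i. ?X i \<omega>) {..<n-1}) -` A \<inter> space P = A'"
  proof -
    have "(\<Sum>j<idx u. restrict (\<lambda>i. ?X i \<omega>) {..<n-1} j) = (\<Sum>j<idx u. ?X j \<omega>)" if "u \<in> J" for u \<omega>
      by (rule sum.cong) (use idx[OF that] in auto)
    then show ?thesis unfolding A_def A'_def
      by (auto simp del: sum_lessThan_telescope restrict_apply simp: space_PiM)
  qed
  have pre2: "(\<lambda>\<omega>. restrict (\<lambda>i. ?X i \<omega>) {n-1}) -` C' \<inter> space P = {\<omega> \<in> path_space. \<omega> t - \<omega> q \<in> C}"
    unfolding C'_def X_last[symmetric] by (auto simp: space_PiM)
  have "prob (A' \<inter> {\<omega> \<in> path_space. \<omega> t - \<omega> q \<in> C}) = prob A' * prob {\<omega> \<in> path_space. \<omega> t - \<omega> q \<in> C}"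
  proof -
    have "(\<lambda>x. (\<lambda>i\<in>{..<n-1}. ?X i x, \<lambda>i\<in>{n-1}. ?X i x)) -` (A \<times> C') \<inter> space P =
      A' \<inter> {\<omega> \<in> path_space. \<omega> t - \<omega> q \<in> C}"
      unfolding pre[symmetric] pre2[symmetric] by blast
    then show ?thesis
      using indep_varD[OF ind2 A C'] unfolding pre pre2 by simp
  qed
  \<comment> \<open>The telescoping sum gives \<omega> u - \<omega> 0, so the event in terms of
    increments and the box agree only almost surely.\<close>
  moreover have ae: "AE \<omega> in P. (\<omega> \<in> A') = (\<omega> \<in> {\<omega> \<in> path_space. \<forall>u\<in>J. \<omega> u \<in> B u})"
    using AE_start
  proof eventually_elim
    fix \<omega> :: "real \<Rightarrow> real" assume w0: "\<omega> 0 = 0"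
    have "(\<Sum>j<idx u. ?X j \<omega>) = \<omega> u" if "u \<in> J" for u
      using idx[OF that] sum_lessThan_telescope[of "\<lambda>i. \<omega> (\<tau> i)" "idx u"] \<tau>0 w0
      by (simp add: \<tau>_def)
    then show "(\<omega> \<in> A') = (\<omega> \<in> {\<omega> \<in> path_space. \<forall>u\<in>J. \<omega> u \<in> B u})"
      unfolding A'_def by auto
  qed
  have A's: "A' \<in> events" unfolding pre[symmetric]
    by (rule measurable_sets[OF indep_var_rv1[OF ind2] A])
  have Js: "{\<omega> \<in> path_space. \<forall>u\<in>J. \<omega> u \<in> B u} \<in> events"
    unfolding sets_P sets_coord_algebra_boxes
    by (rule sigma_sets.Basic) (use J B in \<open>auto intro!: exI[of _ J] exI[of _ B]\<close>)
  have Cs: "{\<omega> \<in> path_space. \<omega> t - \<omega> q \<in> C} \<in> events"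
    unfolding pre2[symmetric] by (rule measurable_sets[OF indep_var_rv2[OF ind2] C'])
  have "prob A' = prob {\<omega> \<in> path_space. \<forall>u\<in>J. \<omega> u \<in> B u}"
    by (rule finite_measure_eq_AE[OF ae A's Js])
  moreover have "prob (A' \<inter> {\<omega> \<in> path_space. \<omega> t - \<omega> q \<in> C}) =
    prob ({\<omega> \<in> path_space. \<forall>u\<in>J. \<omega> u \<in> B u} \<inter> {\<omega> \<in> path_space. \<omega> t - \<omega> q \<in> C})"
    by (rule finite_measure_eq_AE) (use ae A's Js Cs in auto)
  ultimately show ?thesis by simp
qed

lemma indep_increment:
  assumes q: "0 \<le> q" "q < t" and A: "A \<in> sets (canon_filt q)" and C: "C \<in> sets borel"
  shows "prob (A \<inter> {\<omega> \<in> path_space. \<omega> t - \<omega> q \<in> C}) = prob A * prob {\<omega> \<in> path_space. \<omega> t - \<omega> q \<in> C}"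
proof -
  let ?D = "{\<omega> \<in> path_space. \<omega> t - \<omega> q \<in> C}"
  let ?G = "{{\<omega> \<in> path_space. \<forall>u\<in>J. \<omega> u \<in> B u} | J B. finite J \<and> J \<subseteq> {0..q} \<and> (\<forall>u. B u \<in> sets borel)}"
  have D: "?D \<in> events"
  proof -
    from measurable_sets[OF measurable_increment[of q t] C] q show ?thesis by (auto simp: vimage_def Int_def conj_commute)
  qed
  have ev: "A \<in> events" if "A \<in> sigma_sets path_space ?G" for A
    using that sets_coord_algebra_mono[of "{0..q}" "{0..}"]
    unfolding sets_coord_algebra_boxes[symmetric] sets_P by auto
  have A': "A \<in> sigma_sets path_space ?G" using A unfolding sets_coord_algebra_boxes .
  have sub: "?G \<subseteq> Pow path_space" by auto
  from sub A' show ?thesis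
  proof (induction rule: sigma_sets_induct_disjoint[OF Int_stable_boxes, consumes 2, case_names basic empty compl union])
    case (basic A) then show ?case using prob_increment_box[OF q _ _ _ C] by auto
  next
    case empty then show ?case by simp
  next
    case (compl A)
    note 4 = this
    have "prob ((path_space - A) \<inter> ?D) = prob (?D - A \<inter> ?D)"
      by (rule arg_cong[where f=prob]) auto
    also have "\<dots> = prob ?D - prob (A \<inter> ?D)"
      by (rule finite_measure_Diff) (use D ev[OF 4(1)] in auto)
    also have "\<dots> = (1 - prob A) * prob ?D" using 4 by (simp add: algebra_simps)
    finally show ?case using prob_compl[OF ev[OF 4(1)]] by simp
  next
    case (union A)
    note 5 = this
    have "range (\<lambda>i. A i \<inter> ?D) \<subseteq> events" using 5(2) D ev by (intro image_subsetI sets.Int) auto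
    moreover have "disjoint_family (\<lambda>i. A i \<inter> ?D)" by (rule disjoint_family_subset[OF 5(1)]) auto
    ultimately have s1: "(\<lambda>i. prob (A i \<inter> ?D)) sums prob (\<Union>i. A i \<inter> ?D)"
      by (rule finite_measure_UNION)
    have "range A \<subseteq> events" using 5(2) ev by auto
    then have s2: "(\<lambda>i. prob (A i) * prob ?D) sums (prob (\<Union>i. A i) * prob ?D)"
      by (intro sums_mult2 finite_measure_UNION 5(1))
    have s3: "(\<lambda>i. prob (A i \<inter> ?D)) = (\<lambda>i. prob (A i) * prob ?D)" using 5(3) by simp
    have s4: "(\<Union>i. A i) \<inter> ?D = (\<Union>i. A i \<inter> ?D)" by auto
    show ?case unfolding s4 by (rule sums_unique2[OF s1 s2[folded s3]])
  qed
qed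

text \<open>The product rule for events, rephrased as a product law so that Fubini becomes
  available. The case \<open>q = t\<close> is treated apart because increments are normal only over
  intervals of positive length; there the increment is the constant 0.\<close>

lemma distr_increment_pair:
  assumes q: "0 \<le> q" "q \<le> t"
  shows "distr P (canon_filt q \<Otimes>\<^sub>M borel) (\<lambda>\<omega>. (\<omega>, \<omega> t - \<omega> q)) =
    distr P (canon_filt q) (\<lambda>\<omega>. \<omega>) \<Otimes>\<^sub>M distr P borel (\<lambda>\<omega>. \<omega> (t - q))"
proof (cases "q = t")
  case True
  interpret D: prob_space "distr P (canon_filt q) (\<lambda>\<omega>. \<omega>)"
    by (rule prob_space_distr[OF measurable_id_P])
  interpret E: prob_space "distr P borel (\<lambda>\<omega>. \<omega> (t - q))"
    by (rule prob_space_distr) (use q in auto)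
  have ret: "distr P borel (\<lambda>\<omega>. \<omega> (t - q)) = return borel 0"
  proof -
    have "distr P borel (\<lambda>\<omega>. \<omega> (t - q)) = distr P borel (\<lambda>\<omega>. 0)"
      by (rule distr_cong_AE) (use True AE_start q in auto)
    also have "\<dots> = return borel 0" by (rule distr_const) simp
    finally show ?thesis .
  qed
  show ?thesis
  proof (rule pair_measure_eqI[symmetric])
    show "sigma_finite_measure (distr P (canon_filt q) (\<lambda>\<omega>. \<omega>))" by unfold_locales
    show "sigma_finite_measure (distr P borel (\<lambda>\<omega>. \<omega> (t - q)))" by unfold_locales
    show "sets (distr P (canon_filt q) (\<lambda>\<omega>. \<omega>) \<Otimes>\<^sub>M distr P borel (\<lambda>\<omega>. \<omega> (t - q))) =
      sets (distr P (canon_filt q \<Otimes>\<^sub>M borel) (\<lambda>\<omega>. (\<omega>, \<omega> t - \<omega> q)))"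
      by (simp cong: sets_pair_measure_cong)
    fix A B assume A: "A \<in> sets (distr P (canon_filt q) (\<lambda>\<omega>. \<omega>))"
      and B: "B \<in> sets (distr P borel (\<lambda>\<omega>. \<omega> (t - q)))"
    have [measurable]: "(\<lambda>\<omega>. \<omega>) \<in> P \<rightarrow>\<^sub>M canon_filt q" by (rule measurable_id_P)
    have m: "(\<lambda>\<omega>. (\<omega>, \<omega> t - \<omega> q)) \<in> P \<rightarrow>\<^sub>M canon_filt q \<Otimes>\<^sub>M borel"
      by (intro measurable_Pair measurable_id_P measurable_increment q)
    have AB: "A \<times> B \<in> sets (canon_filt q \<Otimes>\<^sub>M borel)" using A B by auto
    show "emeasure (distr P (canon_filt q) (\<lambda>\<omega>. \<omega>)) A * emeasure (distr P borel (\<lambda>\<omega>. \<omega> (t - q))) B =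
      emeasure (distr P (canon_filt q \<Otimes>\<^sub>M borel) (\<lambda>\<omega>. (\<omega>, \<omega> t - \<omega> q))) (A \<times> B)"
      unfolding emeasure_distr[OF m AB] ret using A B True
      by (subst emeasure_distr) (auto simp: measurable_id_P Int_def indicator_def intro!: arg_cong[where f="emeasure P"])
  qed
next
  case False
  then have q': "q < t" using q by simp
  have m1: "(\<lambda>\<omega>. \<omega>) \<in> P \<rightarrow>\<^sub>M canon_filt q" by (rule measurable_id_P)
  note [measurable] = m1
  have m2: "(\<lambda>\<omega>. \<omega> t - \<omega> q) \<in> borel_measurable P" using q by (rule measurable_increment)
  interpret D: prob_space "distr P (canon_filt q) (\<lambda>\<omega>. \<omega>)"
    by (rule prob_space_distr[OF m1])
  interpret E: prob_space "distr P borel (\<lambda>\<omega>. \<omega> (t - q))"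
    by (rule prob_space_distr) (use q in auto)
  show ?thesis
  proof (rule pair_measure_eqI[symmetric])
    show "sigma_finite_measure (distr P (canon_filt q) (\<lambda>\<omega>. \<omega>))" by unfold_locales
    show "sigma_finite_measure (distr P borel (\<lambda>\<omega>. \<omega> (t - q)))" by unfold_locales
    show "sets (distr P (canon_filt q) (\<lambda>\<omega>. \<omega>) \<Otimes>\<^sub>M distr P borel (\<lambda>\<omega>. \<omega> (t - q))) =
      sets (distr P (canon_filt q \<Otimes>\<^sub>M borel) (\<lambda>\<omega>. (\<omega>, \<omega> t - \<omega> q)))"
      by (simp cong: sets_pair_measure_cong)
    fix A B assume A: "A \<in> sets (distr P (canon_filt q) (\<lambda>\<omega>. \<omega>))"
      and B: "B \<in> sets (distr P borel (\<lambda>\<omega>. \<omega> (t - q)))"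
    have m: "(\<lambda>\<omega>. (\<omega>, \<omega> t - \<omega> q)) \<in> P \<rightarrow>\<^sub>M canon_filt q \<Otimes>\<^sub>M borel"
      by (intro measurable_Pair measurable_id_P measurable_increment q)
    have AB: "A \<times> B \<in> sets (canon_filt q \<Otimes>\<^sub>M borel)" using A B by auto
    have A': "A \<in> sets (canon_filt q)" and B': "B \<in> sets borel" using A B by auto
    have sub: "A \<subseteq> path_space" using sets.sets_into_space[OF A'] by simp
    have *: "(\<lambda>\<omega>. \<omega>) -` A \<inter> space P = A" using sub by auto
    have **: "(\<lambda>\<omega>. (\<omega>, \<omega> t - \<omega> q)) -` (A \<times> B) \<inter> space P = A \<inter> {\<omega> \<in> path_space. \<omega> t - \<omega> q \<in> B}"
      using sub by auto
    have ***: "(\<lambda>\<omega>. \<omega> t - \<omega> q) -` B \<inter> space P = {\<omega> \<in> path_space. \<omega> t - \<omega> q \<in> B}" by auto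
    show "emeasure (distr P (canon_filt q) (\<lambda>\<omega>. \<omega>)) A * emeasure (distr P borel (\<lambda>\<omega>. \<omega> (t - q))) B =
      emeasure (distr P (canon_filt q \<Otimes>\<^sub>M borel) (\<lambda>\<omega>. (\<omega>, \<omega> t - \<omega> q))) (A \<times> B)"
      unfolding distr_increment[OF q, symmetric] emeasure_distr[OF m AB] emeasure_distr[OF m1 A']
        emeasure_distr[OF m2 B'] * ** ***
      by (simp add: emeasure_eq_measure indep_increment[OF q(1) q' A' B'] ennreal_mult)
  qed
qed

text \<open>Fubini for the product law of the path up to q and the increment to t. Letting
  \<open>h\<close> depend on the path covers both a weight that is measurable at time q and the
  starting value \<omega> q.\<close>

lemma markov:
  fixes h :: "(real \<Rightarrow> real) \<Rightarrow> real \<Rightarrow> real"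
  assumes q: "0 \<le> q" "q \<le> t"
    and h[measurable]: "case_prod h \<in> borel_measurable (canon_filt q \<Otimes>\<^sub>M borel)"
    and bd: "\<And>\<omega> x. \<bar>h \<omega> x\<bar> \<le> C"
  shows "(\<integral>\<omega>. h \<omega> (\<omega> t - \<omega> q) \<partial>P) = (\<integral>\<omega>. (\<integral>w. h \<omega> (w (t - q)) \<partial>P) \<partial>P)"
proof -
  have m1: "(\<lambda>\<omega>. \<omega>) \<in> P \<rightarrow>\<^sub>M canon_filt q" by (rule measurable_id_P)
  note [measurable] = m1
  have m: "(\<lambda>\<omega>. (\<omega>, \<omega> t - \<omega> q)) \<in> P \<rightarrow>\<^sub>M canon_filt q \<Otimes>\<^sub>M borel"
      by (intro measurable_Pair measurable_id_P measurable_increment q)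
  let ?D = "distr P (canon_filt q) (\<lambda>\<omega>. \<omega>)" and ?E = "distr P borel (\<lambda>\<omega>. \<omega> (t - q))"
  interpret D: prob_space ?D by (rule prob_space_distr[OF m1])
  interpret E: prob_space ?E by (rule prob_space_distr) (use q in auto)
  interpret DE: pair_prob_space ?D ?E by unfold_locales
  have [measurable_cong]: "sets (?D \<Otimes>\<^sub>M ?E) = sets (canon_filt q \<Otimes>\<^sub>M borel)"
    by (intro sets_pair_measure_cong) auto
  have int: "integrable (?D \<Otimes>\<^sub>M ?E) (case_prod h)"
    by (rule DE.P.integrable_const_bound[where B=C]) (use bd in auto)
  have mE: "(\<lambda>\<omega>. (\<integral>x. h \<omega> x \<partial>?E)) \<in> borel_measurable (canon_filt q)"
    by (rule E.borel_measurable_lebesgue_integral) measurable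
  have "(\<integral>\<omega>. h \<omega> (\<omega> t - \<omega> q) \<partial>P) = (\<integral>z. case_prod h z \<partial>distr P (canon_filt q \<Otimes>\<^sub>M borel) (\<lambda>\<omega>. (\<omega>, \<omega> t - \<omega> q)))"
    by (subst integral_distr[OF m h]) simp
  also have "\<dots> = (\<integral>z. case_prod h z \<partial>(?D \<Otimes>\<^sub>M ?E))" unfolding distr_increment_pair[OF q] ..
  also have "\<dots> = (\<integral>\<omega>. (\<integral>x. h \<omega> x \<partial>?E) \<partial>?D)" using DE.integral_fst[OF int] by simp
  also have "\<dots> = (\<integral>\<omega>. (\<integral>x. h \<omega> x \<partial>?E) \<partial>P)" by (rule integral_distr[OF m1 mE])
  also have "\<dots> = (\<integral>\<omega>. (\<integral>w. h \<omega> (w (t - q)) \<partial>P) \<partial>P)"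
  proof (rule Bochner_Integration.integral_cong[OF refl])
    fix \<omega> assume "\<omega> \<in> space P"
    then have "h \<omega> \<in> borel_measurable borel" using measurable_Pair2[OF h, of \<omega>] by simp
    then
    show "(\<integral>x. h \<omega> x \<partial>?E) = (\<integral>w. h \<omega> (w (t - q)) \<partial>P)"
      using integral_distr[of "\<lambda>w. w (t - q)" P borel "h \<omega>"] q by simp
  qed
  finally show ?thesis .
qed

text \<open>The normal density is even. The substitution of -x for x is valid for every Bochner
  integral, a non-integrable function having integral 0 on both sides.\<close>

lemma integral_odd_coord:
  fixes f :: "real \<Rightarrow> real"
  assumes d: "0 \<le> d" and f[measurable]: "f \<in> borel_measurable borel" and odd: "\<And>x. f (- x) = - f x"
  shows "(\<integral>w. f (w d) \<partial>P) = 0"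
proof (cases "d = 0")
  case True
  have f0: "f 0 = 0" using odd[of 0] by simp
  have "(\<integral>w. f (w d) \<partial>P) = (\<integral>w. 0 \<partial>P)"
    by (rule integral_cong_AE) (use True AE_start d f0 in auto)
  then show ?thesis by simp
next
  case False
  then have d: "0 < d" using d by simp
  have nd: "normal_density 0 (sqrt d) (- x) = normal_density 0 (sqrt d) x" for x
    by (simp add: normal_density_def)
  have e: "(\<integral>w. f (w d) \<partial>P) = (\<integral>x. normal_density 0 (sqrt d) x * f x \<partial>lborel)"
    using integral_distr[of "\<lambda>w. w d" P borel f] d distr_coord[OF d]
    by (simp add: integral_density)
  also have "\<dots> = (\<integral>x. normal_density 0 (sqrt d) (-x) * f (-x) \<partial>lborel)"
    using lborel_integral_real_affine[of "-1" "\<lambda>x. normal_density 0 (sqrt d) x * f x" 0] by simp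
  also have "\<dots> = - (\<integral>x. normal_density 0 (sqrt d) x * f x \<partial>lborel)"
    by (simp add: nd odd)
  finally show ?thesis using e by simp
qed

lemma integral_coord_uminus:
  fixes f :: "real \<Rightarrow> real"
  assumes d: "0 \<le> d" and f[measurable]: "f \<in> borel_measurable borel" and bd: "\<And>x. \<bar>f x\<bar> \<le> C"
  shows "(\<integral>w. f (- w d) \<partial>P) = (\<integral>w. f (w d) \<partial>P)"
proof -
  have "(\<integral>w. f (w d) - f (- w d) \<partial>P) = 0"
    using integral_odd_coord[of d "\<lambda>x. f x - f (- x)"] d by simp
  moreover have "integrable P (\<lambda>w. f (w d))" "integrable P (\<lambda>w. f (- w d))"
    by (rule integrable_const_bound[where B=C]; use bd d in auto)+
  ultimately show ?thesis by simp
qed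

end

section \<open>Heat and Bessel semigroups\<close>

lemma gaussian_approx:
  fixes G :: "real \<Rightarrow> real"
  assumes cont: "continuous_on UNIV G" and lim: "(G \<longlongrightarrow> 0) at_top" and e: "0 < e"
  shows "\<exists>a n. \<forall>r\<ge>0. \<bar>G r - (\<Sum>i\<le>n. a i * exp (- real i * r\<^sup>2))\<bar> < e"
proof -
  \<comment> \<open>G carried to [0, 1] by \<open>x = exp (- r\<^sup>2)\<close>. The point x = 0
    stands for r at infinity, where G tends to 0, and x = 1 for r = 0.\<close>
  define H where "H x = (if x \<le> 0 then 0 else G (sqrt (- ln x)))" for x :: real
  have "continuous_on {0..1} H"
    unfolding continuous_on_def
  proof
    fix x :: real assume x: "x \<in> {0..1}"
    show "(H \<longlongrightarrow> H x) (at x within {0..1})"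
    proof (cases "x = 0")
      case True
      have "filterlim (\<lambda>x. sqrt (- ln x)) at_top (at_right (0::real))"
        by (intro filterlim_compose[OF sqrt_at_top] filterlim_compose[OF filterlim_uminus_at_top_at_bot ln_at_0])
      then have "((\<lambda>x. G (sqrt (- ln x))) \<longlongrightarrow> 0) (at_right 0)"
        by (rule filterlim_compose[OF lim])
      moreover have "eventually (\<lambda>x. G (sqrt (- ln x)) = H x) (at_right 0)"
        unfolding eventually_at_right_field H_def by (intro exI[of _ 1]) auto
      ultimately have "(H \<longlongrightarrow> 0) (at_right 0)"
        by (rule Lim_transform_eventually)
      moreover have "at 0 within {0..1} = at_right (0::real)"
        by (rule at_within_Icc_at_right) simp
      ultimately show ?thesis using True by (simp add: H_def)
    next
      case False
      then have x0: "0 < x" using x by auto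
      have "continuous_on {0<..} (\<lambda>x. G (sqrt (- ln x)))"
        by (intro continuous_on_compose2[OF cont] continuous_intros) auto
      then have "continuous_on {0<..} H"
        by (rule continuous_on_eq) (auto simp: H_def)
      then have "isCont H x" using x0 by (simp add: continuous_on_eq_continuous_at)
      then show ?thesis by (simp add: continuous_at_imp_continuous_at_within continuous_within[symmetric])
    qed
  qed
  then obtain p where p: "real_polynomial_function p" "\<And>x. x \<in> {0..1} \<Longrightarrow> \<bar>H x - p x\<bar> < e"
    using Stone_Weierstrass_real_polynomial_function[of "{0..1::real}" H e] e by auto
  then obtain a n where a: "p = (\<lambda>x. \<Sum>i\<le>n. a i * x ^ i)"
    using real_polynomial_function_iff_sum by blast
  have "\<bar>G r - (\<Sum>i\<le>n. a i * exp (- real i * r\<^sup>2))\<bar> < e" if r: "0 \<le> r" for r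
  proof -
    have "H (exp (- r\<^sup>2)) = G r" using r by (simp add: H_def not_le)
    moreover have "p (exp (- r\<^sup>2)) = (\<Sum>i\<le>n. a i * exp (- real i * r\<^sup>2))"
      unfolding a by (simp add: exp_of_nat_mult[symmetric])
    ultimately show ?thesis using p(2)[of "exp (- r\<^sup>2)"] by simp
  qed
  then show ?thesis by blast
qed

definition bdd_borel :: "(real \<Rightarrow> real) \<Rightarrow> bool" where
  "bdd_borel f \<longleftrightarrow> f \<in> borel_measurable borel \<and> (\<exists>C. \<forall>x. \<bar>f x\<bar> \<le> C)"

lemma bdd_borel_add_mult:
  assumes "bdd_borel f" "bdd_borel g"
  shows "bdd_borel (\<lambda>r. f r + c * g r)"
proof -
  obtain A B where A: "\<And>x. \<bar>f x\<bar> \<le> A" and B: "\<And>x. \<bar>g x\<bar> \<le> B" using assms unfolding bdd_borel_def by blast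
  have "\<bar>f r + c * g r\<bar> \<le> A + \<bar>c\<bar> * B" for r
    using A[of r] mult_left_mono[OF B[of r], of "\<bar>c\<bar>"] abs_triangle_ineq[of "f r" "c * g r"]
    by (simp add: abs_mult)
  then show ?thesis using assms unfolding bdd_borel_def by (auto intro!: exI[of _ "A + \<bar>c\<bar> * B"])
qed

lemma bdd_borel_gaussian: "bdd_borel (\<lambda>r. exp (- real i * r\<^sup>2))"
  unfolding bdd_borel_def by (auto intro!: exI[of _ 1])

text \<open>The bound on \<open>\<Phi>\<close> refers to the supremum over r \<ge> 0, the half-line
  on which Gaussian sums approximate G uniformly; so a functional vanishing on Gaussians vanishes on
  G. It is applied to differences of two expectations that are to be shown equal.\<close>

lemma functional_zero_if_gaussian:
  fixes \<Phi> :: "(real \<Rightarrow> real) \<Rightarrow> real"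
  assumes cont: "continuous_on UNIV G" and lim: "(G \<longlongrightarrow> 0) at_top" and G: "bdd_borel G"
    and lin: "\<And>f g c. bdd_borel f \<Longrightarrow> bdd_borel g \<Longrightarrow> \<Phi> (\<lambda>r. f r + c * g r) = \<Phi> f + c * \<Phi> g"
    and bound: "\<And>f e. bdd_borel f \<Longrightarrow> (\<And>r. 0 \<le> r \<Longrightarrow> \<bar>f r\<bar> \<le> e) \<Longrightarrow> \<bar>\<Phi> f\<bar> \<le> C * e"
    and gauss: "\<And>i::nat. \<Phi> (\<lambda>r. exp (- real i * r\<^sup>2)) = 0"
  shows "\<Phi> G = 0"
proof (rule ccontr)
  assume ne: "\<Phi> G \<noteq> 0"
  \<comment> \<open>Chosen so that \<open>C * e\<close> is below \<bar>\<Phi> G\<bar>; adding 1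
    keeps the denominator positive for C = 0.\<close>
  define e where "e = \<bar>\<Phi> G\<bar> / (2 * (\<bar>C\<bar> + 1))"
  have e: "0 < e" using ne unfolding e_def by (intro divide_pos_pos) auto
  obtain a n where a: "\<And>r. 0 \<le> r \<Longrightarrow> \<bar>G r - (\<Sum>i\<le>n. a i * exp (- real i * r\<^sup>2))\<bar> < e"
    using gaussian_approx[OF cont lim e] by blast
  \<comment> \<open>The approximating sum is removed term by term: linearity is assumed on bounded
    Borel functions, so this property is carried along.\<close>
  have "bdd_borel (\<lambda>r. G r - (\<Sum>i<n. a i * exp (- real i * r\<^sup>2))) \<and>
      \<Phi> (\<lambda>r. G r - (\<Sum>i<n. a i * exp (- real i * r\<^sup>2))) = \<Phi> G" for n
  proof (induction n)
    case 0 then show ?case using G by simp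
  next
    case (Suc n)
    have eq: "(\<lambda>r. G r - (\<Sum>i<Suc n. a i * exp (- real i * r\<^sup>2))) =
      (\<lambda>r. (G r - (\<Sum>i<n. a i * exp (- real i * r\<^sup>2))) + (- a n) * exp (- real n * r\<^sup>2))"
      by (auto simp: algebra_simps)
    from Suc have b: "bdd_borel (\<lambda>r. G r - (\<Sum>i<n. a i * exp (- real i * r\<^sup>2)))"
      and p: "\<Phi> (\<lambda>r. G r - (\<Sum>i<n. a i * exp (- real i * r\<^sup>2))) = \<Phi> G" by auto
    show ?case unfolding eq
      using bdd_borel_add_mult[OF b bdd_borel_gaussian, of "- a n" n]
        lin[OF b bdd_borel_gaussian, of "- a n" n] gauss[of n] p
      by (simp only: mult_zero_right add_0_right simp_thms)
  qed
  from this[of "Suc n"] have "bdd_borel (\<lambda>r. G r - (\<Sum>i\<le>n. a i * exp (- real i * r\<^sup>2)))"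
    "\<Phi> (\<lambda>r. G r - (\<Sum>i\<le>n. a i * exp (- real i * r\<^sup>2))) = \<Phi> G"
    by (simp_all add: lessThan_Suc_atMost)
  then have "\<bar>\<Phi> G\<bar> \<le> C * e" using bound[of "\<lambda>r. G r - (\<Sum>i\<le>n. a i * exp (- real i * r\<^sup>2))" e] a by force
  also have "\<dots> < 2 * (\<bar>C\<bar> + 1) * e" using e by (intro mult_strict_right_mono) auto
  also have "\<dots> = \<bar>\<Phi> G\<bar>" unfolding e_def by (simp add: field_simps)
  finally show False by simp
qed

text \<open>Completing the square: damping by \<open>exp (- m * x\<^sup>2)\<close> turns a normal
  density into a multiple of another one, whose mean and variance are both scaled by
  \<open>c\<^sup>2\<close>.\<close>

lemma exp_mult_normal_density:
  fixes m d v x :: real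
  assumes m: "0 \<le> m" and d: "0 < d"
  defines "c \<equiv> 1 / sqrt (1 + 2 * m * d)"
  shows "normal_density v (sqrt d) x * exp (- m * x\<^sup>2) =
    c * exp (- m * c\<^sup>2 * v\<^sup>2) * normal_density (c\<^sup>2 * v) (c * sqrt d) x"
proof -
  have D: "0 < 1 + 2 * m * d" using m d by (simp add: add_pos_nonneg)
  have c0: "0 < c" using D by (simp add: c_def)
  have c2: "c\<^sup>2 = 1 / (1 + 2 * m * d)" using D by (simp add: c_def power_divide)
  have e: "- (x - v)\<^sup>2 / (2 * d) - m * x\<^sup>2 = - m * c\<^sup>2 * v\<^sup>2 - (x - c\<^sup>2 * v)\<^sup>2 / (2 * (c\<^sup>2 * d))"
    unfolding c2 using D d by (simp add: divide_simps) (simp add: power2_eq_square algebra_simps)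
  have s1: "(sqrt d)\<^sup>2 = d" "(c * sqrt d)\<^sup>2 = c\<^sup>2 * d" using d by (simp_all add: power_mult_distrib)
  have s2: "c / sqrt (2 * pi * (c\<^sup>2 * d)) = 1 / sqrt (2 * pi * d)"
    using c0 by (simp add: real_sqrt_mult)
  have "normal_density v (sqrt d) x * exp (- m * x\<^sup>2) =
    1 / sqrt (2 * pi * d) * exp (- (x - v)\<^sup>2 / (2 * d) - m * x\<^sup>2)"
    unfolding normal_density_def s1 by (simp add: exp_diff exp_minus field_simps)
  also have "\<dots> = c / sqrt (2 * pi * (c\<^sup>2 * d)) * exp (- m * c\<^sup>2 * v\<^sup>2 - (x - c\<^sup>2 * v)\<^sup>2 / (2 * (c\<^sup>2 * d)))"
    unfolding e s2 ..
  also have "\<dots> = c * exp (- m * c\<^sup>2 * v\<^sup>2) * normal_density (c\<^sup>2 * v) (c * sqrt d) x"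
    unfolding normal_density_def s1 by (simp add: exp_diff exp_minus field_simps)
  finally show ?thesis .
qed

context wiener_space
begin

lemma integrable_coord: "0 \<le> d \<Longrightarrow> integrable P (\<lambda>w. w d)"
proof (cases "d = 0")
  case True
  have "integrable P (\<lambda>w. w 0) \<longleftrightarrow> integrable P (\<lambda>w. 0::real)"
    by (rule integrable_cong_AE) (use AE_start in auto)
  then show ?thesis using True by simp
next
  case False
  assume "0 \<le> d"
  then have d: "0 < d" using False by simp
  have "integrable (distr P borel (\<lambda>w. w d)) (\<lambda>x. x)"
    unfolding distr_coord[OF d]
    by (subst integrable_density) (use integrable_normal_moment_nz_1[of "sqrt d" 0] d in auto)
  then show ?thesis using d by (subst (asm) integrable_distr_eq) auto
qed

lemma integral_shifted_coord:
  fixes f :: "real \<Rightarrow> real"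
  assumes d: "0 < d" and f[measurable]: "f \<in> borel_measurable borel"
  shows "(\<integral>w. f (v + w d) \<partial>P) = (\<integral>x. normal_density v (sqrt d) x * f x \<partial>lborel)"
proof -
  have "(\<integral>w. f (v + w d) \<partial>P) = (\<integral>x. normal_density 0 (sqrt d) x * f (v + x) \<partial>lborel)"
    using integral_distr[of "\<lambda>w. w d" P borel "\<lambda>x. f (v + x)"] d distr_coord[OF d]
    by (simp add: integral_density)
  also have "\<dots> = (\<integral>x. normal_density v (sqrt d) x * f x \<partial>lborel)"
    using lborel_integral_real_affine[of 1 "\<lambda>x. normal_density v (sqrt d) x * f x" v, symmetric]
    by (simp add: normal_density_def)
  finally show ?thesis .
qed

text \<open>Mass and first moment of the damped normal law. The first moment has the additional
  factor \<open>c\<^sup>2 * v\<close>; two more independent coordinates started at 0 contribute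
  exactly \<open>c\<^sup>2\<close>, and this coincidence is the h-transform.\<close>

lemma integral_gaussian_coord:
  fixes m d v :: real
  assumes m: "0 \<le> m" and d: "0 \<le> d"
  defines "c \<equiv> 1 / sqrt (1 + 2 * m * d)"
  shows "(\<integral>w. exp (- m * (v + w d)\<^sup>2) \<partial>P) = c * exp (- m * c\<^sup>2 * v\<^sup>2)"
    and "(\<integral>w. (v + w d) * exp (- m * (v + w d)\<^sup>2) \<partial>P) = c ^ 3 * v * exp (- m * c\<^sup>2 * v\<^sup>2)"
proof -
  consider "d = 0" | "0 < d" using d by linarith
  then have "(\<integral>w. exp (- m * (v + w d)\<^sup>2) \<partial>P) = c * exp (- m * c\<^sup>2 * v\<^sup>2) \<and>
    (\<integral>w. (v + w d) * exp (- m * (v + w d)\<^sup>2) \<partial>P) = c ^ 3 * v * exp (- m * c\<^sup>2 * v\<^sup>2)"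
  proof cases
    case 1
    have ae: "AE w in P. w d = 0" using AE_start 1 by simp
    have "(\<integral>w. exp (- m * (v + w d)\<^sup>2) \<partial>P) = (\<integral>w. exp (- m * v\<^sup>2) \<partial>P)"
    proof (rule integral_cong_AE)
      show "AE w in P. exp (- m * (v + w d)\<^sup>2) = exp (- m * v\<^sup>2)"
        using ae by eventually_elim simp
    qed (use d in auto)
    moreover have "(\<integral>w. (v + w d) * exp (- m * (v + w d)\<^sup>2) \<partial>P) = (\<integral>w. v * exp (- m * v\<^sup>2) \<partial>P)"
    proof (rule integral_cong_AE)
      show "AE w in P. (v + w d) * exp (- m * (v + w d)\<^sup>2) = v * exp (- m * v\<^sup>2)"
        using ae by eventually_elim simp
    qed (use d in auto)
    ultimately show ?thesis using 1 prob_space by (simp add: c_def)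
  next
    case 2
    have cd: "0 < c * sqrt d" unfolding c_def using m 2
      by (intro mult_pos_pos divide_pos_pos real_sqrt_gt_zero add_pos_nonneg) auto
    note e = exp_mult_normal_density[OF m 2, folded c_def]
    have "(\<integral>w. exp (- m * (v + w d)\<^sup>2) \<partial>P) = (\<integral>x. normal_density v (sqrt d) x * exp (- m * x\<^sup>2) \<partial>lborel)"
      by (rule integral_shifted_coord[OF 2]) auto
    also have "\<dots> = c * exp (- m * c\<^sup>2 * v\<^sup>2)"
      unfolding e using cd by simp
    finally have 1: "(\<integral>w. exp (- m * (v + w d)\<^sup>2) \<partial>P) = c * exp (- m * c\<^sup>2 * v\<^sup>2)" .
    have "(\<integral>w. (v + w d) * exp (- m * (v + w d)\<^sup>2) \<partial>P) =
      (\<integral>x. normal_density v (sqrt d) x * (x * exp (- m * x\<^sup>2)) \<partial>lborel)"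
      by (rule integral_shifted_coord[OF 2]) auto
    also have "\<dots> = (\<integral>x. c * exp (- m * c\<^sup>2 * v\<^sup>2) * (normal_density (c\<^sup>2 * v) (c * sqrt d) x * x) \<partial>lborel)"
      by (rule Bochner_Integration.integral_cong[OF refl]) (use e in \<open>simp add: ac_simps\<close>)
    also have "\<dots> = c ^ 3 * v * exp (- m * c\<^sup>2 * v\<^sup>2)"
      using integral_normal_moment_nz_1[OF cd, of "c\<^sup>2 * v"] by (simp add: power3_eq_cube power2_eq_square)
    finally show ?thesis using 1 by simp
  qed
  then show "(\<integral>w. exp (- m * (v + w d)\<^sup>2) \<partial>P) = c * exp (- m * c\<^sup>2 * v\<^sup>2)"
    "(\<integral>w. (v + w d) * exp (- m * (v + w d)\<^sup>2) \<partial>P) = c ^ 3 * v * exp (- m * c\<^sup>2 * v\<^sup>2)" by auto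
qed


section \<open>The Bessel semigroup and its h-transform\<close>

sublocale PP: pair_prob_space P P by unfold_locales
sublocale PPP: pair_prob_space P "P \<Otimes>\<^sub>M P" by unfold_locales

abbreviation "P3 \<equiv> P \<Otimes>\<^sub>M P \<Otimes>\<^sub>M P"

lemma integral_P3:
  fixes f :: "(real \<Rightarrow> real) \<Rightarrow> (real \<Rightarrow> real) \<Rightarrow> (real \<Rightarrow> real) \<Rightarrow> real"
  assumes f[measurable]: "(\<lambda>(\<alpha>, \<beta>, \<gamma>). f \<alpha> \<beta> \<gamma>) \<in> borel_measurable P3"
    and bd: "\<And>\<alpha> \<beta> \<gamma>. \<bar>f \<alpha> \<beta> \<gamma>\<bar> \<le> C"
  shows "(\<integral>(\<alpha>, \<beta>, \<gamma>). f \<alpha> \<beta> \<gamma> \<partial>P3) = (\<integral>\<alpha>. (\<integral>\<beta>. (\<integral>\<gamma>. f \<alpha> \<beta> \<gamma> \<partial>P) \<partial>P) \<partial>P)"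
proof -
  have "integrable P3 (\<lambda>(\<alpha>, \<beta>, \<gamma>). f \<alpha> \<beta> \<gamma>)"
    by (rule PPP.P.integrable_const_bound[where B=C]) (use bd in auto)
  from PPP.integral_fst[OF this]
  have "(\<integral>(\<alpha>, \<beta>, \<gamma>). f \<alpha> \<beta> \<gamma> \<partial>P3) = (\<integral>\<alpha>. (\<integral>(\<beta>, \<gamma>). f \<alpha> \<beta> \<gamma> \<partial>(P \<Otimes>\<^sub>M P)) \<partial>P)" by simp
  also have "\<dots> = (\<integral>\<alpha>. (\<integral>\<beta>. (\<integral>\<gamma>. f \<alpha> \<beta> \<gamma> \<partial>P) \<partial>P) \<partial>P)"
  proof (rule Bochner_Integration.integral_cong[OF refl])
    fix \<alpha> assume "\<alpha> \<in> space P"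
    then have [measurable]: "(\<lambda>(\<beta>, \<gamma>). f \<alpha> \<beta> \<gamma>) \<in> borel_measurable (P \<Otimes>\<^sub>M P)"
      using measurable_Pair2[OF f, of \<alpha>] by simp
    have "integrable (P \<Otimes>\<^sub>M P) (\<lambda>(\<beta>, \<gamma>). f \<alpha> \<beta> \<gamma>)"
      by (rule PP.P.integrable_const_bound[where B=C]) (use bd in auto)
    from PP.integral_fst[OF this]
    show "(\<integral>(\<beta>, \<gamma>). f \<alpha> \<beta> \<gamma> \<partial>(P \<Otimes>\<^sub>M P)) = (\<integral>\<beta>. (\<integral>\<gamma>. f \<alpha> \<beta> \<gamma> \<partial>P) \<partial>P)" by simp
  qed
  finally show ?thesis .
qed

text \<open>Transition operator of the three-dimensional Bessel process over a time d: Brownian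
  motion in three dimensions starts at the point (v, 0, 0). That only the distance v of the starting
  point matters is in effect what \<open>markov_bes\<close> proves.\<close>

definition bes_op :: "real \<Rightarrow> (real \<Rightarrow> real) \<Rightarrow> real \<Rightarrow> real" where
  "bes_op d G v = (\<integral>(\<alpha>, \<beta>, \<gamma>). G (sqrt ((v + \<alpha> d)\<^sup>2 + (\<beta> d)\<^sup>2 + (\<gamma> d)\<^sup>2)) \<partial>P3)"

lemma measurable_bes_radius [measurable]:
  assumes [simp]: "0 \<le> d"
  shows "(\<lambda>(v, \<alpha>, \<beta>, \<gamma>). sqrt ((v + \<alpha> d)\<^sup>2 + (\<beta> d)\<^sup>2 + (\<gamma> d)\<^sup>2)) \<in> borel_measurable (borel \<Otimes>\<^sub>M P3)"
  by measurable

lemma measurable_bes_op [measurable]: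
  assumes d: "0 \<le> d" and G[measurable]: "G \<in> borel_measurable borel"
  shows "bes_op d G \<in> borel_measurable borel"
  unfolding bes_op_def
proof (rule PPP.P.borel_measurable_lebesgue_integral)
  have "(\<lambda>z. G ((\<lambda>(v, \<alpha>, \<beta>, \<gamma>). sqrt ((v + \<alpha> d)\<^sup>2 + (\<beta> d)\<^sup>2 + (\<gamma> d)\<^sup>2)) z)) \<in> borel_measurable (borel \<Otimes>\<^sub>M P3)"
    by (rule measurable_compose[OF measurable_bes_radius[OF d] G])
  then show "(\<lambda>(v, z). case z of (\<alpha>, \<beta>, \<gamma>) \<Rightarrow> G (sqrt ((v + \<alpha> d)\<^sup>2 + (\<beta> d)\<^sup>2 + (\<gamma> d)\<^sup>2))) \<in> borel_measurable (borel \<Otimes>\<^sub>M P3)"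
    by (simp add: case_prod_unfold)
qed

lemma measurable_bes_integrand:
  assumes d: "0 \<le> d" and G[measurable]: "G \<in> borel_measurable borel"
  shows "(\<lambda>(\<alpha>, \<beta>, \<gamma>). G (sqrt ((v + \<alpha> d)\<^sup>2 + (\<beta> d)\<^sup>2 + (\<gamma> d)\<^sup>2))) \<in> borel_measurable P3"
proof -
  note [simp] = d
  show ?thesis by measurable
qed

lemma integrable_bes:
  assumes d: "0 \<le> d" and G: "bdd_borel G"
  shows "integrable P3 (\<lambda>(\<alpha>, \<beta>, \<gamma>). G (sqrt ((v + \<alpha> d)\<^sup>2 + (\<beta> d)\<^sup>2 + (\<gamma> d)\<^sup>2)))"
proof -
  obtain C where C: "\<And>x. \<bar>G x\<bar> \<le> C" using G unfolding bdd_borel_def by auto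
  show ?thesis
    by (rule PPP.P.integrable_const_bound[where B=C])
       (use C measurable_bes_integrand[OF d] G in \<open>auto simp: bdd_borel_def\<close>)
qed

lemma abs_bes_op_le:
  assumes d: "0 \<le> d" and G: "bdd_borel G" and e: "\<And>r. 0 \<le> r \<Longrightarrow> \<bar>G r\<bar> \<le> e"
  shows "\<bar>bes_op d G v\<bar> \<le> e"
proof -
  have "\<bar>bes_op d G v\<bar> \<le> (\<integral>z. \<bar>case z of (\<alpha>, \<beta>, \<gamma>) \<Rightarrow> G (sqrt ((v + \<alpha> d)\<^sup>2 + (\<beta> d)\<^sup>2 + (\<gamma> d)\<^sup>2))\<bar> \<partial>P3)"
    unfolding bes_op_def by (rule integral_abs_bound)
  also have "\<dots> \<le> (\<integral>z. e \<partial>P3)"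
    by (rule integral_mono) (use integrable_bes[OF d G] e in auto)
  also have "\<dots> = e" using PPP.P.prob_space by simp
  finally show ?thesis .
qed

lemma bes_op_add_mult:
  assumes d: "0 \<le> d" and f: "bdd_borel f" and g: "bdd_borel g"
  shows "bes_op d (\<lambda>r. f r + c * g r) v = bes_op d f v + c * bes_op d g v"
  using integrable_bes[OF d f, of v] integrable_bes[OF d g, of v]
  unfolding bes_op_def by (simp add: case_prod_unfold)

text \<open>The exponential of the squared norm factors over the coordinates; the two that start at
  0 contribute one factor c each.\<close>

lemma bes_op_gaussian:
  fixes m d v :: real
  assumes m: "0 \<le> m" and d: "0 \<le> d"
  defines "c \<equiv> 1 / sqrt (1 + 2 * m * d)"
  shows "bes_op d (\<lambda>r. exp (- m * r\<^sup>2)) v = c ^ 3 * exp (- m * c\<^sup>2 * v\<^sup>2)"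
proof -
  have "bes_op d (\<lambda>r. exp (- m * r\<^sup>2)) v =
    (\<integral>(\<alpha>, \<beta>, \<gamma>). exp (- m * (v + \<alpha> d)\<^sup>2) * exp (- m * (0 + \<beta> d)\<^sup>2) * exp (- m * (0 + \<gamma> d)\<^sup>2) \<partial>P3)"
    unfolding bes_op_def
    by (rule Bochner_Integration.integral_cong[OF refl]) (auto simp: exp_add[symmetric] algebra_simps)
  also have "\<dots> = (\<integral>\<alpha>. (\<integral>\<beta>. (\<integral>\<gamma>. exp (- m * (v + \<alpha> d)\<^sup>2) * exp (- m * (0 + \<beta> d)\<^sup>2) * exp (- m * (0 + \<gamma> d)\<^sup>2) \<partial>P) \<partial>P) \<partial>P)"
  proof (rule integral_P3[where C=1])
    show "(\<lambda>(\<alpha>, \<beta>, \<gamma>). exp (- m * (v + \<alpha> d)\<^sup>2) * exp (- m * (0 + \<beta> d)\<^sup>2) * exp (- m * (0 + \<gamma> d)\<^sup>2)) \<in> borel_measurable P3"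
      using d by measurable
  next
    fix \<alpha> \<beta> \<gamma> :: "real \<Rightarrow> real"
    have "exp (- m * (v + \<alpha> d)\<^sup>2) * exp (- m * (0 + \<beta> d)\<^sup>2) * exp (- m * (0 + \<gamma> d)\<^sup>2) \<le> 1"
      by (intro mult_le_one) (use m in auto)
    then show "\<bar>exp (- m * (v + \<alpha> d)\<^sup>2) * exp (- m * (0 + \<beta> d)\<^sup>2) * exp (- m * (0 + \<gamma> d)\<^sup>2)\<bar> \<le> 1"
      by (simp add: abs_mult)
  qed
  also have "\<dots> = c ^ 3 * exp (- m * c\<^sup>2 * v\<^sup>2)"
    unfolding integral_mult_right_zero integral_mult_left_zero integral_gaussian_coord[OF m d, folded c_def]
    by (simp add: power3_eq_cube)
  finally show ?thesis .
qed

text \<open>For a Gaussian G both sides are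
  \<open>c ^ 3 * v * exp (- m * c\<^sup>2 * v\<^sup>2)\<close>. The difference is linear in G and
  bounded by the supremum of \<bar>G\<bar> times \<bar>v\<bar> + E \<bar>v + w d\<bar>, so uniform
  approximation does the rest although the weight v + w d is unbounded.\<close>

lemma bes_op_h_transform:
  assumes d: "0 \<le> d" and cont: "continuous_on UNIV G" and lim: "(G \<longlongrightarrow> 0) at_top" and G: "bdd_borel G"
  shows "v * bes_op d G v = (\<integral>w. (v + w d) * G \<bar>v + w d\<bar> \<partial>P)"
proof -
  let ?\<Phi> = "\<lambda>G. v * bes_op d G v - (\<integral>w. (v + w d) * G \<bar>v + w d\<bar> \<partial>P)"
  have int1: "integrable P (\<lambda>w. v + w d)" using integrable_coord[OF d] by simp
  have int: "integrable P (\<lambda>w. (v + w d) * f \<bar>v + w d\<bar>)" if f: "bdd_borel f" for f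
  proof -
    obtain C where C: "\<And>x. \<bar>f x\<bar> \<le> C" and [measurable]: "f \<in> borel_measurable borel"
      using f unfolding bdd_borel_def by auto
    have C0: "0 \<le> C" using C[of 0] by simp
    show ?thesis
    proof (rule Bochner_Integration.integrable_bound)
      show "integrable P (\<lambda>w. C * (v + w d))" using int1 by simp
      show "(\<lambda>w. (v + w d) * f \<bar>v + w d\<bar>) \<in> borel_measurable P" using d by measurable
      show "AE w in P. norm ((v + w d) * f \<bar>v + w d\<bar>) \<le> norm (C * (v + w d))"
        using C C0 by (intro always_eventually allI) (simp add: abs_mult mult.commute[of C] mult_left_mono)
    qed
  qed
  have "?\<Phi> G = 0"
  proof (rule functional_zero_if_gaussian[OF cont lim G, where C="\<bar>v\<bar> + (\<integral>w. \<bar>v + w d\<bar> \<partial>P)"])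
    fix f g :: "real \<Rightarrow> real" and c assume fg: "bdd_borel f" "bdd_borel g"
    have "(\<integral>w. (v + w d) * (f \<bar>v + w d\<bar> + c * g \<bar>v + w d\<bar>) \<partial>P) =
      (\<integral>w. (v + w d) * f \<bar>v + w d\<bar> + c * ((v + w d) * g \<bar>v + w d\<bar>) \<partial>P)"
      by (rule Bochner_Integration.integral_cong[OF refl]) (simp add: algebra_simps)
    also have "\<dots> = (\<integral>w. (v + w d) * f \<bar>v + w d\<bar> \<partial>P) + c * (\<integral>w. (v + w d) * g \<bar>v + w d\<bar> \<partial>P)"
      using int[OF fg(1)] int[OF fg(2)] by simp
    finally show "?\<Phi> (\<lambda>r. f r + c * g r) = ?\<Phi> f + c * ?\<Phi> g"
      unfolding bes_op_add_mult[OF d fg] by (simp add: algebra_simps)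
  next
    fix f :: "real \<Rightarrow> real" and e assume f: "bdd_borel f" and e: "\<And>r. 0 \<le> r \<Longrightarrow> \<bar>f r\<bar> \<le> e"
    have "\<bar>\<integral>w. (v + w d) * f \<bar>v + w d\<bar> \<partial>P\<bar> \<le> (\<integral>w. \<bar>(v + w d) * f \<bar>v + w d\<bar>\<bar> \<partial>P)"
      by (rule integral_abs_bound)
    also have "\<dots> \<le> (\<integral>w. \<bar>v + w d\<bar> * e \<partial>P)"
    proof (rule integral_mono)
      show "integrable P (\<lambda>w. \<bar>(v + w d) * f \<bar>v + w d\<bar>\<bar>)" by (rule integrable_abs[OF int[OF f]])
      show "integrable P (\<lambda>w. \<bar>v + w d\<bar> * e)" using int1 by simp
    qed (use e in \<open>auto simp: abs_mult intro!: mult_left_mono\<close>)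
    finally have "\<bar>\<integral>w. (v + w d) * f \<bar>v + w d\<bar> \<partial>P\<bar> \<le> (\<integral>w. \<bar>v + w d\<bar> \<partial>P) * e" by simp
    moreover have "\<bar>v * bes_op d f v\<bar> \<le> \<bar>v\<bar> * e"
      unfolding abs_mult by (intro mult_left_mono abs_bes_op_le[OF d f e]) auto
    ultimately show "\<bar>?\<Phi> f\<bar> \<le> (\<bar>v\<bar> + (\<integral>w. \<bar>v + w d\<bar> \<partial>P)) * e"
      by (simp add: algebra_simps)
  next
    fix i :: nat
    show "?\<Phi> (\<lambda>r. exp (- real i * r\<^sup>2)) = 0"
      using bes_op_gaussian[of "real i" d v] integral_gaussian_coord(2)[of "real i" d v] d by simp
  qed
  then show ?thesis by simp
qed

lemma markov_gaussian:
  assumes q: "0 \<le> q" "q \<le> t" and m: "0 \<le> m"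
    and Z[measurable]: "Z \<in> borel_measurable (canon_filt q)" and bd: "\<And>\<omega>. \<bar>Z \<omega>\<bar> \<le> C"
  defines "c \<equiv> 1 / sqrt (1 + 2 * m * (t - q))"
  shows "(\<integral>\<omega>. Z \<omega> * exp (- m * (\<omega> t)\<^sup>2) \<partial>P) = (\<integral>\<omega>. Z \<omega> * (c * exp (- m * c\<^sup>2 * (\<omega> q)\<^sup>2)) \<partial>P)"
proof -
  have [measurable]: "(\<lambda>\<omega>. \<omega> q) \<in> borel_measurable (canon_filt q)"
    by (rule measurable_coord) (use q in auto)
  have "(\<integral>\<omega>. Z \<omega> * exp (- m * (\<omega> q + (\<omega> t - \<omega> q))\<^sup>2) \<partial>P) =
    (\<integral>\<omega>. (\<integral>w. Z \<omega> * exp (- m * (\<omega> q + w (t - q))\<^sup>2) \<partial>P) \<partial>P)"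
  proof (rule markov[OF q, where C=C])
    fix \<omega> x
    have "\<bar>Z \<omega>\<bar> * exp (- m * (\<omega> q + x)\<^sup>2) \<le> C * 1"
      by (rule mult_mono) (use bd[of \<omega>] m in auto)
    then show "\<bar>Z \<omega> * exp (- m * (\<omega> q + x)\<^sup>2)\<bar> \<le> C" by (simp add: abs_mult)
  qed measurable
  then show ?thesis
    using integral_gaussian_coord(1)[OF m, of "t - q"] q by (simp add: c_def)
qed

text \<open>The radius is Markov by itself: for Gaussian G the conditional expectation is a product
  over the coordinates, and the three results combine into a function of the radius at time q. The
  weight \<open>Y\<close> of all three paths lets earlier factors be absorbed when the lemma is
  iterated.\<close>

lemma markov_bes:
  assumes q: "0 \<le> q" "q \<le> t"
    and Y[measurable]: "(\<lambda>(\<alpha>, \<beta>, \<gamma>). Y \<alpha> \<beta> \<gamma>) \<in> borel_measurable (canon_filt q \<Otimes>\<^sub>M canon_filt q \<Otimes>\<^sub>M canon_filt q)"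
    and bd: "\<And>\<alpha> \<beta> \<gamma>. \<bar>Y \<alpha> \<beta> \<gamma>\<bar> \<le> C"
    and cont: "continuous_on UNIV G" and lim: "(G \<longlongrightarrow> 0) at_top" and G: "bdd_borel G"
  shows "(\<integral>(\<alpha>, \<beta>, \<gamma>). Y \<alpha> \<beta> \<gamma> * G (sqrt ((\<alpha> t)\<^sup>2 + (\<beta> t)\<^sup>2 + (\<gamma> t)\<^sup>2)) \<partial>P3) =
    (\<integral>(\<alpha>, \<beta>, \<gamma>). Y \<alpha> \<beta> \<gamma> * bes_op (t - q) G (sqrt ((\<alpha> q)\<^sup>2 + (\<beta> q)\<^sup>2 + (\<gamma> q)\<^sup>2)) \<partial>P3)"
    (is "?L G = ?R G")
proof -
  have t: "0 \<le> t" and tq: "0 \<le> t - q" using q by auto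
  have C0: "0 \<le> C" using bd[of undefined undefined undefined] by linarith
  note [measurable] = measurable_id_P[of q]
  have YP[measurable]: "(\<lambda>(\<alpha>, \<beta>, \<gamma>). Y \<alpha> \<beta> \<gamma>) \<in> borel_measurable P3"
  proof -
    have "(\<lambda>z. (fst z, fst (snd z), snd (snd z))) \<in> P3 \<rightarrow>\<^sub>M canon_filt q \<Otimes>\<^sub>M canon_filt q \<Otimes>\<^sub>M canon_filt q"
      by measurable
    from measurable_compose[OF this Y] show ?thesis by (simp add: case_prod_unfold)
  qed
  have mL: "(\<lambda>(\<alpha>, \<beta>, \<gamma>). Y \<alpha> \<beta> \<gamma> * f (sqrt ((\<alpha> s)\<^sup>2 + (\<beta> s)\<^sup>2 + (\<gamma> s)\<^sup>2))) \<in> borel_measurable P3"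
    if "0 \<le> s" "f \<in> borel_measurable borel" for f s
  proof -
    have [measurable]: "(\<lambda>(\<alpha>, \<beta>, \<gamma>). f (sqrt ((\<alpha> s)\<^sup>2 + (\<beta> s)\<^sup>2 + (\<gamma> s)\<^sup>2))) \<in> borel_measurable P3"
      using measurable_bes_integrand[OF that, of 0] by simp
    have "(\<lambda>z. (case z of (\<alpha>, \<beta>, \<gamma>) \<Rightarrow> Y \<alpha> \<beta> \<gamma>) * (case z of (\<alpha>, \<beta>, \<gamma>) \<Rightarrow> f (sqrt ((\<alpha> s)\<^sup>2 + (\<beta> s)\<^sup>2 + (\<gamma> s)\<^sup>2)))) \<in> borel_measurable P3"
      by (intro borel_measurable_times) fact+
    then show ?thesis by (simp add: case_prod_unfold)
  qed
  have bdL: "\<bar>Y \<alpha> \<beta> \<gamma> * x\<bar> \<le> C * e" if "\<bar>x\<bar> \<le> e" for \<alpha> \<beta> \<gamma> x e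
    unfolding abs_mult by (rule mult_mono) (use bd that C0 in auto)
  have int: "integrable P3 (\<lambda>(\<alpha>, \<beta>, \<gamma>). Y \<alpha> \<beta> \<gamma> * f (sqrt ((\<alpha> s)\<^sup>2 + (\<beta> s)\<^sup>2 + (\<gamma> s)\<^sup>2)))"
    if s: "0 \<le> s" and f: "f \<in> borel_measurable borel" and e: "\<And>r. 0 \<le> r \<Longrightarrow> \<bar>f r\<bar> \<le> e" for f s e
    by (rule PPP.P.integrable_const_bound[where B="C * e"]) (use mL[OF s f] bdL e in auto)
  have le: "\<bar>\<integral>(\<alpha>, \<beta>, \<gamma>). Y \<alpha> \<beta> \<gamma> * f (sqrt ((\<alpha> s)\<^sup>2 + (\<beta> s)\<^sup>2 + (\<gamma> s)\<^sup>2)) \<partial>P3\<bar> \<le> C * e"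
    if s: "0 \<le> s" and f: "f \<in> borel_measurable borel" and e: "\<And>r. 0 \<le> r \<Longrightarrow> \<bar>f r\<bar> \<le> e" for f s e
  proof -
    have "\<bar>\<integral>(\<alpha>, \<beta>, \<gamma>). Y \<alpha> \<beta> \<gamma> * f (sqrt ((\<alpha> s)\<^sup>2 + (\<beta> s)\<^sup>2 + (\<gamma> s)\<^sup>2)) \<partial>P3\<bar> \<le>
      (\<integral>z. \<bar>case z of (\<alpha>, \<beta>, \<gamma>) \<Rightarrow> Y \<alpha> \<beta> \<gamma> * f (sqrt ((\<alpha> s)\<^sup>2 + (\<beta> s)\<^sup>2 + (\<gamma> s)\<^sup>2))\<bar> \<partial>P3)"
      by (rule integral_abs_bound)
    also have "\<dots> \<le> (\<integral>z. C * e \<partial>P3)"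
      by (rule integral_mono) (use int[OF s f e] bdL e in auto)
    finally show ?thesis using PPP.P.prob_space by simp
  qed
  have "?L G - ?R G = 0"
  proof (rule functional_zero_if_gaussian[OF cont lim G, where C="2 * C" and \<Phi>="\<lambda>G. ?L G - ?R G"])
    fix f g :: "real \<Rightarrow> real" and c assume fg: "bdd_borel f" "bdd_borel g"
    obtain A B where A: "\<And>x. \<bar>f x\<bar> \<le> A" "f \<in> borel_measurable borel" and B: "\<And>x. \<bar>g x\<bar> \<le> B" "g \<in> borel_measurable borel"
      using fg unfolding bdd_borel_def by blast
    have 1: "?L (\<lambda>r. f r + c * g r) = ?L f + c * ?L g"
      using int[OF t A(2,1)] int[OF t B(2,1)] by (simp add: case_prod_unfold algebra_simps)
    have "?R (\<lambda>r. f r + c * g r) = ?R f + c * ?R g"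
      unfolding bes_op_add_mult[OF tq fg]
      using int[OF q(1) measurable_bes_op[OF tq A(2)] abs_bes_op_le[OF tq fg(1)], of A]
        int[OF q(1) measurable_bes_op[OF tq B(2)] abs_bes_op_le[OF tq fg(2)], of B] A B
      by (simp add: case_prod_unfold algebra_simps)
    then show "?L (\<lambda>r. f r + c * g r) - ?R (\<lambda>r. f r + c * g r) = ?L f - ?R f + c * (?L g - ?R g)"
      using 1 by (simp add: algebra_simps)
  next
    fix f :: "real \<Rightarrow> real" and e assume f: "bdd_borel f" and e: "\<And>r. 0 \<le> r \<Longrightarrow> \<bar>f r\<bar> \<le> e"
    have fm: "f \<in> borel_measurable borel" using f by (simp add: bdd_borel_def)
    show "\<bar>?L f - ?R f\<bar> \<le> 2 * C * e"
      using le[OF t fm e] le[OF q(1) measurable_bes_op[OF tq fm] abs_bes_op_le[OF tq f e]]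
      by linarith
  next
    fix i :: nat
    define m where "m = real i"
    have m: "0 \<le> m" by (simp add: m_def)
    define c where "c = 1 / sqrt (1 + 2 * m * (t - q))"
    have "1 \<le> sqrt (1 + 2 * m * (t - q))" using m tq by simp
    then have c01: "0 \<le> c" "c \<le> 1" unfolding c_def by (auto simp: divide_le_eq)
    define E where "E \<omega> = exp (- m * (\<omega> t)\<^sup>2)" for \<omega> :: "real \<Rightarrow> real"
    define E' where "E' \<omega> = c * exp (- m * c\<^sup>2 * (\<omega> q)\<^sup>2)" for \<omega> :: "real \<Rightarrow> real"
    have [measurable]: "(\<lambda>\<omega>. \<omega> q) \<in> borel_measurable (canon_filt q)"
      by (rule measurable_coord) (use q in auto)
    have E'm[measurable]: "E' \<in> borel_measurable (canon_filt q)" unfolding E'_def by measurable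
    have E'P[measurable]: "E' \<in> borel_measurable P" by (rule measurable_P[OF E'm])
    have EP[measurable]: "E \<in> borel_measurable P" unfolding E_def using t by measurable
    have Eb: "\<bar>E \<omega>\<bar> \<le> 1" for \<omega> using m by (simp add: E_def)
    have E'b: "\<bar>E' \<omega>\<bar> \<le> 1" for \<omega> using m c01 unfolding E'_def abs_mult by (intro mult_le_one) auto
    have step: "(\<integral>\<omega>. Z \<omega> * E \<omega> \<partial>P) = (\<integral>\<omega>. Z \<omega> * E' \<omega> \<partial>P)"
      if "Z \<in> borel_measurable (canon_filt q)" "\<And>\<omega>. \<bar>Z \<omega>\<bar> \<le> C" for Z
      using markov_gaussian[OF q m that] unfolding E_def E'_def c_def .
    have b3: "\<bar>y * a * b * d\<bar> \<le> C" if "\<bar>y\<bar> \<le> C" "\<bar>a\<bar> \<le> 1" "\<bar>b\<bar> \<le> 1" "\<bar>d\<bar> \<le> 1" for y a b d :: real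
    proof -
      have "\<bar>y\<bar> * (\<bar>a\<bar> * \<bar>b\<bar> * \<bar>d\<bar>) \<le> C * 1"
        using that C0 by (intro mult_mono mult_le_one) auto
      then show ?thesis by (simp add: abs_mult ac_simps)
    qed
    have b1: "\<bar>y * a\<bar> \<le> C" if "\<bar>y\<bar> \<le> C" "\<bar>a\<bar> \<le> 1" for y a :: real
      using b3[of y a 1 1] that by simp
    \<comment> \<open>If f is not integrable, its integral is 0 and the bound holds all the
      same.\<close>
    have ib: "\<bar>\<integral>\<omega>. f \<omega> \<partial>P\<bar> \<le> C" if "\<And>\<omega>. \<bar>f \<omega>\<bar> \<le> C" for f :: "(real \<Rightarrow> real) \<Rightarrow> real"
    proof (cases "integrable P f")
      case True
      have "\<bar>\<integral>\<omega>. f \<omega> \<partial>P\<bar> \<le> (\<integral>\<omega>. \<bar>f \<omega>\<bar> \<partial>P)" by (rule integral_abs_bound)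
      also have "\<dots> \<le> (\<integral>\<omega>. C \<partial>P)" by (rule integral_mono) (use True that in auto)
      finally show ?thesis using prob_space by simp
    qed (use C0 in \<open>simp add: not_integrable_integral_eq\<close>)
    have YY: "(\<lambda>\<gamma>. Y \<alpha> \<beta> \<gamma>) \<in> borel_measurable (canon_filt q)" if "\<alpha> \<in> path_space" "\<beta> \<in> path_space" for \<alpha> \<beta>
      using measurable_Pair2[OF measurable_Pair2[OF Y, of \<alpha>], of \<beta>] that by simp
    have YE: "(\<lambda>\<beta>. \<integral>\<gamma>. Y \<alpha> \<beta> \<gamma> * E' \<gamma> \<partial>P) \<in> borel_measurable (canon_filt q)" if \<alpha>: "\<alpha> \<in> path_space" for \<alpha>
    proof (rule borel_measurable_lebesgue_integral)
      have a: "\<alpha> \<in> space (canon_filt q)" using \<alpha> by simp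
      have "(\<lambda>z. (\<alpha>, fst z, snd z)) \<in> canon_filt q \<Otimes>\<^sub>M P \<rightarrow>\<^sub>M canon_filt q \<Otimes>\<^sub>M canon_filt q \<Otimes>\<^sub>M canon_filt q"
        using a by measurable
      from measurable_compose[OF this Y]
      have [measurable]: "(\<lambda>z. Y \<alpha> (fst z) (snd z)) \<in> borel_measurable (canon_filt q \<Otimes>\<^sub>M P)" by simp
      show "(\<lambda>(\<beta>, \<gamma>). Y \<alpha> \<beta> \<gamma> * E' \<gamma>) \<in> borel_measurable (canon_filt q \<Otimes>\<^sub>M P)"
        unfolding case_prod_unfold by measurable
    qed
    have YEE: "(\<lambda>\<alpha>. \<integral>\<beta>. (\<integral>\<gamma>. Y \<alpha> \<beta> \<gamma> * E' \<gamma> \<partial>P) * E' \<beta> \<partial>P) \<in> borel_measurable (canon_filt q)"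
    proof (rule borel_measurable_lebesgue_integral)
      have "(\<lambda>(z, \<gamma>). Y (fst z) (snd z) \<gamma> * E' \<gamma>) \<in> borel_measurable ((canon_filt q \<Otimes>\<^sub>M P) \<Otimes>\<^sub>M P)"
      proof -
        have "(\<lambda>z. (fst (fst z), snd (fst z), snd z)) \<in> (canon_filt q \<Otimes>\<^sub>M P) \<Otimes>\<^sub>M P \<rightarrow>\<^sub>M canon_filt q \<Otimes>\<^sub>M canon_filt q \<Otimes>\<^sub>M canon_filt q"
          by measurable
        from measurable_compose[OF this Y]
        have [measurable]: "(\<lambda>z. Y (fst (fst z)) (snd (fst z)) (snd z)) \<in> borel_measurable ((canon_filt q \<Otimes>\<^sub>M P) \<Otimes>\<^sub>M P)"
          by simp
        show ?thesis unfolding case_prod_unfold by measurable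
      qed
      then have [measurable]: "(\<lambda>z. \<integral>\<gamma>. Y (fst z) (snd z) \<gamma> * E' \<gamma> \<partial>P) \<in> borel_measurable (canon_filt q \<Otimes>\<^sub>M P)"
        by (rule borel_measurable_lebesgue_integral)
      show "(\<lambda>(\<alpha>, \<beta>). (\<integral>\<gamma>. Y \<alpha> \<beta> \<gamma> * E' \<gamma> \<partial>P) * E' \<beta>) \<in> borel_measurable (canon_filt q \<Otimes>\<^sub>M P)"
        unfolding case_prod_unfold by measurable
    qed
    have m3: "(\<lambda>(\<alpha>, \<beta>, \<gamma>). Y \<alpha> \<beta> \<gamma> * f \<alpha> * f \<beta> * f \<gamma>) \<in> borel_measurable P3"
      if [measurable]: "f \<in> borel_measurable P" for f
    proof -
      have [measurable]: "(\<lambda>z. Y (fst z) (fst (snd z)) (snd (snd z))) \<in> borel_measurable P3"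
        using YP by (simp add: case_prod_unfold)
      show ?thesis unfolding case_prod_unfold by measurable
    qed
    \<comment> \<open>The coordinates are moved from time t to time q one after the other, starting
      with \<gamma>. At each stage the inner integrals form a weight that is measurable at time
      q.\<close>
    have "?L (\<lambda>r. exp (- m * r\<^sup>2)) = (\<integral>(\<alpha>, \<beta>, \<gamma>). Y \<alpha> \<beta> \<gamma> * E \<alpha> * E \<beta> * E \<gamma> \<partial>P3)"
      by (rule Bochner_Integration.integral_cong[OF refl])
         (auto simp: E_def exp_add[symmetric] algebra_simps)
    also have "\<dots> = (\<integral>\<alpha>. (\<integral>\<beta>. (\<integral>\<gamma>. Y \<alpha> \<beta> \<gamma> * E \<alpha> * E \<beta> * E \<gamma> \<partial>P) \<partial>P) \<partial>P)"
      by (rule integral_P3[where C=C, OF m3[OF EP] b3]) (use bd Eb in auto)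
    also have "\<dots> = (\<integral>\<alpha>. (\<integral>\<beta>. (\<integral>\<gamma>. Y \<alpha> \<beta> \<gamma> * E \<gamma> \<partial>P) * E \<beta> \<partial>P) * E \<alpha> \<partial>P)"
      by (simp add: ac_simps flip: integral_mult_right_zero integral_mult_left_zero)
    also have "\<dots> = (\<integral>\<alpha>. (\<integral>\<beta>. (\<integral>\<gamma>. Y \<alpha> \<beta> \<gamma> * E' \<gamma> \<partial>P) * E \<beta> \<partial>P) * E \<alpha> \<partial>P)"
      by (intro Bochner_Integration.integral_cong refl arg_cong2[where f="(*)"] step) (use YY bd in auto)
    also have "\<dots> = (\<integral>\<alpha>. (\<integral>\<beta>. (\<integral>\<gamma>. Y \<alpha> \<beta> \<gamma> * E' \<gamma> \<partial>P) * E' \<beta> \<partial>P) * E \<alpha> \<partial>P)"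
      by (intro Bochner_Integration.integral_cong refl arg_cong2[where f="(*)"] step YE ib b1) (use bd E'b in auto)
    also have "\<dots> = (\<integral>\<alpha>. (\<integral>\<beta>. (\<integral>\<gamma>. Y \<alpha> \<beta> \<gamma> * E' \<gamma> \<partial>P) * E' \<beta> \<partial>P) * E' \<alpha> \<partial>P)"
      by (intro step YEE ib b1 bd E'b)
    also have "\<dots> = (\<integral>\<alpha>. (\<integral>\<beta>. (\<integral>\<gamma>. Y \<alpha> \<beta> \<gamma> * E' \<alpha> * E' \<beta> * E' \<gamma> \<partial>P) \<partial>P) \<partial>P)"
      by (simp add: ac_simps flip: integral_mult_right_zero integral_mult_left_zero)
    also have "\<dots> = (\<integral>(\<alpha>, \<beta>, \<gamma>). Y \<alpha> \<beta> \<gamma> * E' \<alpha> * E' \<beta> * E' \<gamma> \<partial>P3)"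
      by (rule integral_P3[where C=C, OF m3[OF E'P] b3, symmetric]) (use bd E'b in auto)
    also have "\<dots> = ?R (\<lambda>r. exp (- m * r\<^sup>2))"
      unfolding bes_op_gaussian[OF m tq, folded c_def]
      by (rule Bochner_Integration.integral_cong[OF refl])
         (auto simp: E'_def exp_add[symmetric] algebra_simps power3_eq_cube)
    finally show "?L (\<lambda>r. exp (- real i * r\<^sup>2)) - ?R (\<lambda>r. exp (- real i * r\<^sup>2)) = 0"
      by (simp add: m_def)
  qed
  then show ?thesis by simp
qed

end

section \<open>Optional stopping and reflection\<close>

text \<open>The set of times at or above z is closed, hence has a first element; the intermediate
  value theorem excludes that the path exceeds z there.\<close>

lemma first_passage:
  assumes w: "\<omega> \<in> path_space" and q: "0 \<le> q" and start: "\<omega> q < z" and hit: "\<not> (\<forall>u\<in>{q..t}. \<omega> u < z)"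
  obtains T where "q < T" "T \<le> t" "\<omega> T = z" "\<And>v. q \<le> v \<Longrightarrow> v < T \<Longrightarrow> \<omega> v < z"
proof -
  have c: "continuous_on {q..t} \<omega>"
    by (rule continuous_on_subset[OF path_continuous_on[OF w]]) (use q in auto)
  define A where "A = {q..t} \<inter> \<omega> -` {z..}"
  have cl: "closed A" unfolding A_def by (intro continuous_closed_preimage c) auto
  have ne: "A \<noteq> {}" using hit by (auto simp: A_def not_less)
  have bb: "bdd_below A" unfolding A_def by (rule bdd_belowI[of _ q]) auto
  define T where "T = Inf A"
  have TA: "T \<in> A" unfolding T_def by (rule closed_contains_Inf[OF ne bb cl])
  have T: "q \<le> T" "T \<le> t" "z \<le> \<omega> T" using TA by (auto simp: A_def)
  have before: "\<omega> v < z" if "q \<le> v" "v < T" for v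
  proof (rule ccontr)
    assume "\<not> \<omega> v < z"
    then have "v \<in> A" using that T by (auto simp: A_def)
    then show False using cInf_lower[OF _ bb, of v] that unfolding T_def[symmetric] by simp
  qed
  have "\<omega> T \<le> z"
  proof -
    obtain x where x: "q \<le> x" "x \<le> T" "\<omega> x = z"
      using IVT'[of \<omega> q z T] start T continuous_on_subset[OF c, of "{q..T}"] by auto
    then have "x = T" using before[of x] by force
    then show ?thesis using x by simp
  qed
  moreover have "q < T" using T start by (cases "q = T") auto
  ultimately show ?thesis using that[of T] T before by force
qed

context wiener_space
begin

text \<open>\<open>U s\<close> plays the role of the conditional expectation of
  \<open>\<zeta>\<close> at time s, and \<open>V\<close> that of its value at the first passage
  through z. Only limits along times to the right of the passage are demanded, since the proof stops
  at the first grid time at or after it and refines the grid.\<close>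

lemma optional_stopping:
  fixes U :: "real \<Rightarrow> (real \<Rightarrow> real) \<Rightarrow> real"
  assumes q: "0 \<le> q" "q \<le> t"
    and Y[measurable]: "Y \<in> borel_measurable (canon_filt q)" and Y1: "\<And>\<omega>. \<bar>Y \<omega>\<bar> \<le> 1"
    and Y0: "\<And>\<omega>. Y \<omega> \<noteq> 0 \<Longrightarrow> \<omega> q < z"
    and \<zeta>[measurable]: "\<zeta> \<in> borel_measurable P" and \<zeta>b: "\<And>\<omega>. \<bar>\<zeta> \<omega>\<bar> \<le> C"
    and U[measurable]: "\<And>s. q \<le> s \<Longrightarrow> s \<le> t \<Longrightarrow> U s \<in> borel_measurable P"
    and Ub: "\<And>s \<omega>. q \<le> s \<Longrightarrow> s \<le> t \<Longrightarrow> \<omega> \<in> path_space \<Longrightarrow> \<bar>U s \<omega>\<bar> \<le> C"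
    and mart: "\<And>s Z. q \<le> s \<Longrightarrow> s \<le> t \<Longrightarrow> Z \<in> borel_measurable (canon_filt s) \<Longrightarrow> (\<And>\<omega>. \<bar>Z \<omega>\<bar> \<le> 1) \<Longrightarrow>
      (\<integral>\<omega>. Z \<omega> * \<zeta> \<omega> \<partial>P) = (\<integral>\<omega>. Z \<omega> * U s \<omega> \<partial>P)"
    and lim: "\<And>\<omega> u T. \<omega> \<in> path_space \<Longrightarrow> q < T \<Longrightarrow> T \<le> t \<Longrightarrow> \<omega> T = z \<Longrightarrow>
      (\<And>v. q \<le> v \<Longrightarrow> v < T \<Longrightarrow> \<omega> v < z) \<Longrightarrow> (\<And>n. T \<le> u n \<and> u n \<le> t) \<Longrightarrow> u \<longlonglongrightarrow> T \<Longrightarrow>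
      (\<lambda>n. U (u n) \<omega>) \<longlonglongrightarrow> V \<omega>"
  shows "(\<lambda>\<omega>. if \<forall>u\<in>{q..t}. \<omega> u < z then 0 else Y \<omega> * V \<omega>) \<in> borel_measurable P"
    and "(\<integral>\<omega>. (if \<forall>u\<in>{q..t}. \<omega> u < z then 0 else Y \<omega> * \<zeta> \<omega>) \<partial>P) =
      (\<integral>\<omega>. (if \<forall>u\<in>{q..t}. \<omega> u < z then 0 else Y \<omega> * V \<omega>) \<partial>P)"
proof -
  define b where "b s \<omega> = (if \<forall>u\<in>{q..s}. \<omega> u < z then 1 else 0 :: real)" for s \<omega>
  define g where "g N k = q + (t - q) * (real k / real (Suc N))" for N k
  \<comment> \<open>The difference of the two survival indicators marks a first passage between
    consecutive grid times. It is known only at the later of them, hence \<open>U\<close> is taken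
    there.\<close>
  define \<Theta> where "\<Theta> N \<omega> = (\<Sum>k<Suc N. Y \<omega> * (b (g N k) \<omega> - b (g N (Suc k)) \<omega>) * U (g N (Suc k)) \<omega>)" for N \<omega>
  have C0: "0 \<le> C" using \<zeta>b[of undefined] by linarith
  have g: "q \<le> g N k" "g N k \<le> t" if "k \<le> Suc N" for N k
  proof -
    have "(t - q) * (real k / real (Suc N)) \<le> (t - q) * 1"
      using that q by (intro mult_left_mono) (auto simp: divide_le_eq)
    then show "q \<le> g N k" "g N k \<le> t" using q unfolding g_def by auto
  qed
  have g_mono: "g N k \<le> g N j" if "k \<le> j" for N k j
    using that q unfolding g_def by (intro add_left_mono mult_left_mono divide_right_mono) auto
  have g0: "g N 0 = q" and gN: "g N (Suc N) = t" for N unfolding g_def by simp_all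
  have b01: "b s \<omega> = 0 \<or> b s \<omega> = 1" for s \<omega> unfolding b_def by simp
  have bm: "b s \<in> borel_measurable (canon_filt r)" if "q \<le> s" "s \<le> r" for s r
  proof -
    have "Measurable.pred (canon_filt s) (\<lambda>\<omega>. \<forall>u\<in>{q..s}. \<omega> u < z)"
      by (rule pred_path_below) (use q that in auto)
    then have "Measurable.pred (canon_filt r) (\<lambda>\<omega>. \<forall>u\<in>{q..s}. \<omega> u < z)"
      by (rule measurable_canon_filt_mono) (use that in simp)
    then show ?thesis unfolding b_def by measurable
  qed
  have YP[measurable]: "Y \<in> borel_measurable P" by (rule measurable_P[OF Y])
  have bP[measurable]: "b s \<in> borel_measurable P" if "q \<le> s" for s
    by (rule measurable_P[OF bm[OF that order_refl]])
  have Zm: "(\<lambda>\<omega>. Y \<omega> * (b (g N k) \<omega> - b (g N (Suc k)) \<omega>)) \<in> borel_measurable (canon_filt (g N (Suc k)))"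
    if "k < Suc N" for N k
    by (intro borel_measurable_times borel_measurable_diff bm measurable_canon_filt_mono[OF Y])
       (use g that g_mono in auto)
  have Zb: "\<bar>Y \<omega> * (b s \<omega> - b s' \<omega>)\<bar> \<le> 1" for \<omega> s s'
    unfolding abs_mult using Y1[of \<omega>] b01[of s \<omega>] b01[of s' \<omega>] by (intro mult_le_one) auto
  have \<Theta>m: "\<Theta> N \<in> borel_measurable P" for N
    unfolding \<Theta>_def using g by (intro borel_measurable_sum borel_measurable_times borel_measurable_diff bP YP U) auto
  have int1: "integrable P (\<lambda>\<omega>. Y \<omega> * (b s \<omega> - b s' \<omega>) * f \<omega>)"
    if [measurable]: "f \<in> borel_measurable P" and "\<And>\<omega>. \<omega> \<in> path_space \<Longrightarrow> \<bar>f \<omega>\<bar> \<le> C" "q \<le> s" "q \<le> s'" for f s s'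
  proof (rule integrable_const_bound[where B=C])
    show "AE \<omega> in P. norm (Y \<omega> * (b s \<omega> - b s' \<omega>) * f \<omega>) \<le> C"
    proof (rule AE_I2)
      fix \<omega> assume "\<omega> \<in> space P"
      then have "\<bar>Y \<omega> * (b s \<omega> - b s' \<omega>)\<bar> * \<bar>f \<omega>\<bar> \<le> 1 * C"
        using Zb that(2) by (intro mult_mono) auto
      then show "norm (Y \<omega> * (b s \<omega> - b s' \<omega>) * f \<omega>) \<le> C" by (simp add: abs_mult)
    qed
  qed (use that in measurable)
  \<comment> \<open>The sum telescopes to \<open>b q - b t\<close>. Wherever \<open>Y\<close> is not
    0 the path starts below z, so \<open>b q\<close> is 1 there.\<close>
  have tel: "(\<Sum>k<Suc N. Y \<omega> * (b (g N k) \<omega> - b (g N (Suc k)) \<omega>) * \<zeta> \<omega>) =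
      (if \<forall>u\<in>{q..t}. \<omega> u < z then 0 else Y \<omega> * \<zeta> \<omega>)" for N \<omega>
  proof -
    have "(\<Sum>k<Suc N. Y \<omega> * (b (g N k) \<omega> - b (g N (Suc k)) \<omega>) * \<zeta> \<omega>) = Y \<omega> * (b q \<omega> - b t \<omega>) * \<zeta> \<omega>"
      unfolding sum_distrib_right[symmetric] sum_distrib_left[symmetric]
      using sum_lessThan_telescope'[of "\<lambda>k. b (g N k) \<omega>" "Suc N"] by (simp only: g0 gN)
    also have "\<dots> = (if \<forall>u\<in>{q..t}. \<omega> u < z then 0 else Y \<omega> * \<zeta> \<omega>)"
      using Y0[of \<omega>] q unfolding b_def by auto
    finally show ?thesis .
  qed
  have eq: "(\<integral>\<omega>. (if \<forall>u\<in>{q..t}. \<omega> u < z then 0 else Y \<omega> * \<zeta> \<omega>) \<partial>P) = (\<integral>\<omega>. \<Theta> N \<omega> \<partial>P)" for N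
  proof -
    have "(\<integral>\<omega>. (if \<forall>u\<in>{q..t}. \<omega> u < z then 0 else Y \<omega> * \<zeta> \<omega>) \<partial>P) =
      (\<Sum>k<Suc N. \<integral>\<omega>. Y \<omega> * (b (g N k) \<omega> - b (g N (Suc k)) \<omega>) * \<zeta> \<omega> \<partial>P)"
      unfolding tel[of _ N, symmetric]
      by (rule Bochner_Integration.integral_sum) (use g \<zeta>b in \<open>auto intro!: int1\<close>)
    also have "\<dots> = (\<Sum>k<Suc N. \<integral>\<omega>. Y \<omega> * (b (g N k) \<omega> - b (g N (Suc k)) \<omega>) * U (g N (Suc k)) \<omega> \<partial>P)"
      by (intro sum.cong refl mart Zm Zb) (use g in auto)
    also have "\<dots> = (\<integral>\<omega>. \<Theta> N \<omega> \<partial>P)"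
      unfolding \<Theta>_def
      by (rule Bochner_Integration.integral_sum[symmetric]) (use g Ub in \<open>auto intro!: int1\<close>)
    finally show ?thesis .
  qed
  \<comment> \<open>On each path at most one summand survives, so \<open>\<Theta>\<close> is
    \<open>Y\<close> times one value of \<open>U\<close>. This yields both the bound for dominated
    convergence and the limit. Without a passage from below the time \<open>m\<close> is a
    dummy.\<close>
  have cases: "\<exists>m. (\<forall>N. q \<le> m N \<and> m N \<le> t \<and> \<Theta> N \<omega> = (if \<forall>u\<in>{q..t}. \<omega> u < z then 0 else Y \<omega> * U (m N) \<omega>)) \<and>
      (\<omega> q < z \<longrightarrow> \<not> (\<forall>u\<in>{q..t}. \<omega> u < z) \<longrightarrow> (\<lambda>N. U (m N) \<omega>) \<longlonglongrightarrow> V \<omega>)"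
    if w: "\<omega> \<in> path_space" for \<omega>
  proof -
    consider "\<forall>u\<in>{q..t}. \<omega> u < z" | "\<not> (\<forall>u\<in>{q..t}. \<omega> u < z)" "Y \<omega> = 0" "\<not> \<omega> q < z"
      | "\<not> (\<forall>u\<in>{q..t}. \<omega> u < z)" "\<omega> q < z"
      using Y0[of \<omega>] by blast
    then show ?thesis
    proof cases
      case 1
      have b1: "b (g N k) \<omega> = 1" if "k \<le> Suc N" for N k
        using 1 g[OF that] unfolding b_def by auto
      have "\<Theta> N \<omega> = 0" for N unfolding \<Theta>_def by (rule sum.neutral) (simp add: b1)
      then show ?thesis using 1 q by (intro exI[of _ "\<lambda>_. q"]) auto
    next
      case 2
      then have "\<Theta> N \<omega> = 0" for N unfolding \<Theta>_def by simp
      then show ?thesis using 2 q by (intro exI[of _ "\<lambda>_. q"]) auto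
    next
      case 3
      obtain T where T: "q < T" "T \<le> t" "\<omega> T = z" "\<And>v. q \<le> v \<Longrightarrow> v < T \<Longrightarrow> \<omega> v < z"
        using first_passage[OF w q(1) 3(2,1)] by blast
      have bT: "b s \<omega> = (if s < T then 1 else 0)" for s
        using T unfolding b_def by (auto simp: not_less)
      \<comment> \<open>Index of the first grid time at or after T. That time exceeds T by at most
        one mesh, and the index is positive because the grid starts at q < T.\<close>
      define m where "m N = (LEAST j. T \<le> g N j)" for N
      have m1: "T \<le> g N (m N)" for N
        unfolding m_def by (rule LeastI[of _ "Suc N"]) (use T gN in simp)
      have m2: "m N \<le> Suc N" for N
        unfolding m_def by (rule Least_le) (use T gN in simp)
      have m3: "g N j < T" if "j < m N" for N j
        using not_less_Least[of j "\<lambda>j. T \<le> g N j"] that unfolding m_def by simp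
      have m0: "0 < m N" for N
      proof (rule ccontr)
        assume "\<not> 0 < m N"
        then show False using m1[of N] g0[of N] T by simp
      qed
      have less_iff: "g N j < T \<longleftrightarrow> j < m N" for N j
        using m3[of j N] m1[of N] g_mono[of "m N" j N] by (meson not_less order_trans)
      have \<Theta>: "\<Theta> N \<omega> = Y \<omega> * U (g N (m N)) \<omega>" for N
      proof -
        have "\<Theta> N \<omega> = (\<Sum>k<Suc N. if k = m N - 1 then Y \<omega> * U (g N (m N)) \<omega> else 0)"
          unfolding \<Theta>_def bT less_iff
          by (rule sum.cong[OF refl]) (use m0[of N] in auto)
        also have "\<dots> = Y \<omega> * U (g N (m N)) \<omega>" using m2[of N] m0[of N] by auto
        finally show ?thesis .
      qed
      have up: "g N (m N) \<le> T + (t - q) / real (Suc N)" for N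
      proof -
        have "g N (m N) = g N (m N - 1) + (t - q) / real (Suc N)"
        proof -
          have "real (m N) = real (m N - 1) + 1" using m0[of N] by linarith
          then have "real (m N) / real (Suc N) = real (m N - 1) / real (Suc N) + 1 / real (Suc N)"
            by (simp only: add_divide_distrib)
          then show ?thesis unfolding g_def by (simp only: distrib_left) simp
        qed
        then show ?thesis using m3[of "m N - 1" N] m0[of N] by simp
      qed
      have "(\<lambda>N. T + (t - q) / real (Suc N)) \<longlonglongrightarrow> T"
        using tendsto_add[OF tendsto_const[of T] LIMSEQ_Suc[OF lim_const_over_n[of "t - q"]]] by simp
      note ub = this
      have "(\<lambda>N. g N (m N)) \<longlonglongrightarrow> T"
        by (rule tendsto_sandwich[OF always_eventually always_eventually tendsto_const ub]) (use m1 up in blast)+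
      then have "(\<lambda>N. U (g N (m N)) \<omega>) \<longlonglongrightarrow> V \<omega>"
        by (intro lim[OF w T]) (use m1 m2 g in auto)
      then show ?thesis using 3 \<Theta> g m2 by (intro exI[of _ "\<lambda>N. g N (m N)"]) auto
    qed
  qed
  have lim\<Theta>: "(\<lambda>N. \<Theta> N \<omega>) \<longlonglongrightarrow> (if \<forall>u\<in>{q..t}. \<omega> u < z then 0 else Y \<omega> * V \<omega>)" if w: "\<omega> \<in> path_space" for \<omega>
  proof -
    obtain m where m: "\<And>N. \<Theta> N \<omega> = (if \<forall>u\<in>{q..t}. \<omega> u < z then 0 else Y \<omega> * U (m N) \<omega>)"
      "\<omega> q < z \<longrightarrow> \<not> (\<forall>u\<in>{q..t}. \<omega> u < z) \<longrightarrow> (\<lambda>N. U (m N) \<omega>) \<longlonglongrightarrow> V \<omega>"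
      using cases[OF w] by blast
    show ?thesis
    proof (cases "(\<forall>u\<in>{q..t}. \<omega> u < z) \<or> Y \<omega> = 0")
      case True
      then have "(\<lambda>N. \<Theta> N \<omega>) = (\<lambda>N. 0)" and "(if \<forall>u\<in>{q..t}. \<omega> u < z then 0 else Y \<omega> * V \<omega>) = 0"
        unfolding m(1) by auto
      then show ?thesis by simp
    next
      case False
      then have nb: "\<not> (\<forall>u\<in>{q..t}. \<omega> u < z)" by blast
      have "(\<lambda>N. \<Theta> N \<omega>) = (\<lambda>N. Y \<omega> * U (m N) \<omega>)" unfolding m(1) if_not_P[OF nb] ..
      moreover have "(\<lambda>N. Y \<omega> * U (m N) \<omega>) \<longlonglongrightarrow> Y \<omega> * V \<omega>"
        using m(2) False Y0[of \<omega>] by (intro tendsto_mult_left) blast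
      ultimately show ?thesis unfolding if_not_P[OF nb] by simp
    qed
  qed
  show m: "(\<lambda>\<omega>. if \<forall>u\<in>{q..t}. \<omega> u < z then 0 else Y \<omega> * V \<omega>) \<in> borel_measurable P"
    by (rule borel_measurable_LIMSEQ_real[OF lim\<Theta> \<Theta>m]) simp
  have "(\<lambda>N. \<integral>\<omega>. \<Theta> N \<omega> \<partial>P) \<longlonglongrightarrow> (\<integral>\<omega>. (if \<forall>u\<in>{q..t}. \<omega> u < z then 0 else Y \<omega> * V \<omega>) \<partial>P)"
  proof (rule integral_dominated_convergence[where w="\<lambda>_. C"])
    show "AE \<omega> in P. norm (\<Theta> N \<omega>) \<le> C" for N
    proof (rule AE_I2)
      fix \<omega> assume "\<omega> \<in> space P"
      then obtain m where "q \<le> m" "m \<le> t" "\<omega> \<in> path_space"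
        "\<Theta> N \<omega> = (if \<forall>u\<in>{q..t}. \<omega> u < z then 0 else Y \<omega> * U m \<omega>)"
        using cases[of \<omega>] by auto
      moreover from this have "\<bar>Y \<omega>\<bar> * \<bar>U m \<omega>\<bar> \<le> 1 * C" using Y1 Ub by (intro mult_mono) auto
      ultimately show "norm (\<Theta> N \<omega>) \<le> C" using C0 by (auto simp: abs_mult)
    qed
    show "AE \<omega> in P. (\<lambda>N. \<Theta> N \<omega>) \<longlonglongrightarrow> (if \<forall>u\<in>{q..t}. \<omega> u < z then 0 else Y \<omega> * V \<omega>)"
      by (rule AE_I2, rule lim\<Theta>) simp
    show "integrable P (\<lambda>_. C)" by simp
  qed (rule m \<Theta>m)+
  then show "(\<integral>\<omega>. (if \<forall>u\<in>{q..t}. \<omega> u < z then 0 else Y \<omega> * \<zeta> \<omega>) \<partial>P) =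
      (\<integral>\<omega>. (if \<forall>u\<in>{q..t}. \<omega> u < z then 0 else Y \<omega> * V \<omega>) \<partial>P)"
    unfolding eq[symmetric] by (simp add: LIMSEQ_const_iff)
qed

lemma markov_coord:
  fixes H :: "real \<Rightarrow> real"
  assumes q: "0 \<le> q" "q \<le> t"
    and Z[measurable]: "Z \<in> borel_measurable (canon_filt q)" and Z1: "\<And>\<omega>. \<bar>Z \<omega>\<bar> \<le> 1"
    and H[measurable]: "H \<in> borel_measurable borel" and Hb: "\<And>x. \<bar>H x\<bar> \<le> C"
  shows "(\<integral>\<omega>. Z \<omega> * H (\<omega> t) \<partial>P) = (\<integral>\<omega>. Z \<omega> * (\<integral>w. H (\<omega> q + w (t - q)) \<partial>P) \<partial>P)"
proof -
  have [measurable]: "(\<lambda>\<omega>. \<omega> q) \<in> borel_measurable (canon_filt q)"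
    by (rule measurable_coord) (use q in auto)
  have "(\<integral>\<omega>. Z \<omega> * H (\<omega> q + (\<omega> t - \<omega> q)) \<partial>P) = (\<integral>\<omega>. (\<integral>w. Z \<omega> * H (\<omega> q + w (t - q)) \<partial>P) \<partial>P)"
  proof (rule markov[OF q, where C=C])
    fix \<omega> x
    have "\<bar>Z \<omega>\<bar> * \<bar>H (\<omega> q + x)\<bar> \<le> 1 * C" by (rule mult_mono) (use Z1 Hb in auto)
    then show "\<bar>Z \<omega> * H (\<omega> q + x)\<bar> \<le> C" by (simp add: abs_mult)
  qed measurable
  then show ?thesis by simp
qed

lemma measurable_heat:
  fixes H :: "real \<Rightarrow> real"
  assumes "0 \<le> d" and [measurable]: "H \<in> borel_measurable borel"
  shows "(\<lambda>x. \<integral>w. H (x + w d) \<partial>P) \<in> borel_measurable borel"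
proof -
  have "(\<lambda>(x, w). H (x + w d)) \<in> borel_measurable (borel \<Otimes>\<^sub>M P)"
    unfolding case_prod_unfold
    by (intro measurable_compose[OF _ assms(2)] borel_measurable_add measurable_fst
        measurable_compose[OF measurable_snd measurable_coord_P[OF assms(1)]])
  from borel_measurable_lebesgue_integral[OF this] show ?thesis by simp
qed

lemma abs_heat_le:
  fixes H :: "real \<Rightarrow> real"
  assumes d: "0 \<le> d" and [measurable]: "H \<in> borel_measurable borel" and Hb: "\<And>x. \<bar>H x\<bar> \<le> C"
  shows "\<bar>\<integral>w. H (x + w d) \<partial>P\<bar> \<le> C"
proof -
  have i: "integrable P (\<lambda>w. H (x + w d))"
    by (rule integrable_const_bound[where B=C]) (use Hb d in auto)
  have "\<bar>\<integral>w. H (x + w d) \<partial>P\<bar> \<le> (\<integral>w. \<bar>H (x + w d)\<bar> \<partial>P)" by (rule integral_abs_bound)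
  also have "\<dots> \<le> (\<integral>w. C \<partial>P)" by (rule integral_mono) (use i Hb in auto)
  finally show ?thesis using prob_space by simp
qed

text \<open>Once z is hit, the conditional expectation of H (\<omega> t) is 0, because H is odd
  about z and the increment is symmetric. So killing at z leaves the expectation unchanged and the
  free semigroup remains.\<close>

lemma reflection_principle:
  fixes H :: "real \<Rightarrow> real"
  assumes q: "0 \<le> q" "q \<le> t"
    and Y[measurable]: "Y \<in> borel_measurable (canon_filt q)" and Y1: "\<And>\<omega>. \<bar>Y \<omega>\<bar> \<le> 1"
    and H: "continuous_on UNIV H" and Hb: "\<And>x. \<bar>H x\<bar> \<le> C" and odd: "\<And>x. H (2 * z - x) = - H x"
  shows "(\<integral>\<omega>. (if \<forall>u\<in>{q..t}. \<omega> u < z then Y \<omega> * H (\<omega> t) else 0) \<partial>P) =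
    (\<integral>\<omega>. (if \<omega> q < z then Y \<omega> * (\<integral>w. H (\<omega> q + w (t - q)) \<partial>P) else 0) \<partial>P)"
proof -
  have Hm[measurable]: "H \<in> borel_measurable borel" by (rule borel_measurable_continuous_onI[OF H])
  have [measurable]: "(\<lambda>\<omega>. \<omega> q) \<in> borel_measurable (canon_filt q)"
    by (rule measurable_coord) (use q in auto)
  have tP[measurable]: "(\<lambda>\<omega>. \<omega> t) \<in> borel_measurable P" using q by simp
  \<comment> \<open>Optional stopping wants a weight carried by the paths that start below
    z.\<close>
  define Y0 where "Y0 \<omega> = (if \<omega> q < z then Y \<omega> else 0)" for \<omega>
  have Y0m[measurable]: "Y0 \<in> borel_measurable (canon_filt q)" unfolding Y0_def by measurable
  have Y0b: "\<bar>Y0 \<omega>\<bar> \<le> 1" for \<omega> using Y1 by (simp add: Y0_def)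
  have Y0P[measurable]: "Y0 \<in> borel_measurable P" by (rule measurable_P[OF Y0m])
  have below[measurable]: "Measurable.pred P (\<lambda>\<omega>. \<forall>u\<in>{q..t}. \<omega> u < z)"
    by (rule measurable_P[OF pred_path_below[OF q]])
  define U where "U s \<omega> = (\<integral>w. H (\<omega> s + w (t - s)) \<partial>P)" for s and \<omega> :: "real \<Rightarrow> real"
  have "(\<integral>\<omega>. (if \<forall>u\<in>{q..t}. \<omega> u < z then 0 else Y0 \<omega> * H (\<omega> t)) \<partial>P) =
    (\<integral>\<omega>. (if \<forall>u\<in>{q..t}. \<omega> u < z then 0 else Y0 \<omega> * 0) \<partial>P)"
  proof (rule optional_stopping(2)[where U=U and C=C, OF q Y0m Y0b])
    show "\<omega> q < z" if "Y0 \<omega> \<noteq> 0" for \<omega> using that by (auto simp: Y0_def split: if_splits)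
    show "U s \<in> borel_measurable P" if "q \<le> s" "s \<le> t" for s
      unfolding U_def by (rule measurable_compose[OF _ measurable_heat]) (use that q in auto)
    show "\<bar>U s \<omega>\<bar> \<le> C" if "q \<le> s" "s \<le> t" for s \<omega>
      unfolding U_def by (rule abs_heat_le) (use that Hb in auto)
    show "(\<integral>\<omega>. Z \<omega> * H (\<omega> t) \<partial>P) = (\<integral>\<omega>. Z \<omega> * U s \<omega> \<partial>P)"
      if "q \<le> s" "s \<le> t" "Z \<in> borel_measurable (canon_filt s)" "\<And>\<omega>. \<bar>Z \<omega>\<bar> \<le> 1" for s Z
      unfolding U_def by (rule markov_coord) (use that q Hb in auto)
  next
    fix \<omega> u T
    assume w: "\<omega> \<in> path_space" and T: "q < T" "T \<le> t" "\<omega> T = z"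
      and u: "\<And>n. T \<le> u n \<and> u n \<le> t" "u \<longlonglongrightarrow> T"
    have u0: "0 \<le> u n" for n using u(1)[of n] T q by linarith
    have "(\<lambda>n. U (u n) \<omega>) \<longlonglongrightarrow> (\<integral>w. H (z + w (t - T)) \<partial>P)"
      unfolding U_def
    proof (rule integral_dominated_convergence[where w="\<lambda>_. C"])
      show "AE w in P. (\<lambda>n. H (\<omega> (u n) + w (t - u n))) \<longlonglongrightarrow> H (z + w (t - T))"
      proof (rule AE_I2)
        fix w assume "w \<in> space P"
        then have "w \<in> path_space" by simp
        then have "(\<lambda>n. w (t - u n)) \<longlonglongrightarrow> w (t - T)"
          by (rule path_tendsto[OF _ _ tendsto_diff[OF tendsto_const u(2)]]) (use u T in auto)
        moreover have "(\<lambda>n. \<omega> (u n)) \<longlonglongrightarrow> \<omega> T"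
          by (rule path_tendsto[OF w u0 u(2)]) (use T q in auto)
        ultimately show "(\<lambda>n. H (\<omega> (u n) + w (t - u n))) \<longlonglongrightarrow> H (z + w (t - T))"
          using T(3) by (intro continuous_on_tendsto_compose[OF H] tendsto_add) auto
      qed
      show "(\<lambda>w. H (z + w (t - T))) \<in> borel_measurable P"
        by (intro measurable_compose[OF _ Hm] borel_measurable_add measurable_const measurable_coord_P) (use T in auto)
      show "(\<lambda>w. H (\<omega> (u n) + w (t - u n))) \<in> borel_measurable P" for n
        by (intro measurable_compose[OF _ Hm] borel_measurable_add measurable_const measurable_coord_P) (use u(1)[of n] in auto)
    qed (use Hb in auto)
    also have "(\<integral>w. H (z + w (t - T)) \<partial>P) = 0"
    proof (rule integral_odd_coord[where f="\<lambda>x. H (z + x)"])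
      show "H (z + - x) = - H (z + x)" for x using odd[of "z + x"] by (simp add: algebra_simps)
    qed (use T in auto)
    finally show "(\<lambda>n. U (u n) \<omega>) \<longlonglongrightarrow> 0" .
  qed (use Hb in auto)
  then have z: "(\<integral>\<omega>. (if \<forall>u\<in>{q..t}. \<omega> u < z then 0 else Y0 \<omega> * H (\<omega> t)) \<partial>P) = 0"
    by (simp cong: if_cong)
  have bd: "\<bar>Y0 \<omega> * H (\<omega> t)\<bar> \<le> C" for \<omega>
  proof -
    have "\<bar>Y0 \<omega>\<bar> * \<bar>H (\<omega> t)\<bar> \<le> 1 * C" by (rule mult_mono) (use Y0b Hb in auto)
    then show ?thesis by (simp add: abs_mult)
  qed
  have C0: "0 \<le> C" using Hb[of 0] by linarith
  have i1: "integrable P (\<lambda>\<omega>. if \<forall>u\<in>{q..t}. \<omega> u < z then 0 else Y0 \<omega> * H (\<omega> t))"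
    by (rule integrable_const_bound[where B=C]) (use bd C0 in auto)
  have i2: "integrable P (\<lambda>\<omega>. if \<forall>u\<in>{q..t}. \<omega> u < z then Y0 \<omega> * H (\<omega> t) else 0)"
    by (rule integrable_const_bound[where B=C]) (use bd C0 in auto)
  have "(\<integral>\<omega>. (if \<forall>u\<in>{q..t}. \<omega> u < z then Y \<omega> * H (\<omega> t) else 0) \<partial>P) =
    (\<integral>\<omega>. (if \<forall>u\<in>{q..t}. \<omega> u < z then Y0 \<omega> * H (\<omega> t) else 0) \<partial>P)"
    by (rule Bochner_Integration.integral_cong[OF refl]) (use q in \<open>auto simp: Y0_def\<close>)
  also have "\<dots> = (\<integral>\<omega>. (if \<forall>u\<in>{q..t}. \<omega> u < z then Y0 \<omega> * H (\<omega> t) else 0) +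
      (if \<forall>u\<in>{q..t}. \<omega> u < z then 0 else Y0 \<omega> * H (\<omega> t)) \<partial>P)"
    using Bochner_Integration.integral_add[OF i2 i1] z by simp
  also have "\<dots> = (\<integral>\<omega>. Y0 \<omega> * H (\<omega> t) \<partial>P)"
    by (rule Bochner_Integration.integral_cong[OF refl]) auto
  also have "\<dots> = (\<integral>\<omega>. Y0 \<omega> * (\<integral>w. H (\<omega> q + w (t - q)) \<partial>P) \<partial>P)"
    by (rule markov_coord[OF q Y0m Y0b Hm Hb])
  also have "\<dots> = (\<integral>\<omega>. (if \<omega> q < z then Y \<omega> * (\<integral>w. H (\<omega> q + w (t - q)) \<partial>P) else 0) \<partial>P)"
    by (rule Bochner_Integration.integral_cong[OF refl]) (auto simp: Y0_def)
  finally show ?thesis .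
qed

end

section \<open>Cylinder functionals and killed Brownian motion\<close>

type_synonym cyl = "(real \<times> (real \<Rightarrow> real)) list"

text \<open>Bounded support makes \<open>(z - x) * g x\<close> bounded and lets the functions fed to
  the Bessel semigroup vanish at infinity; values in [0, 1] keep all products bounded by 1.\<close>

definition test_fn :: "(real \<Rightarrow> real) \<Rightarrow> bool" where
  "test_fn g \<longleftrightarrow> continuous_on UNIV g \<and> (\<forall>x. 0 \<le> g x \<and> g x \<le> 1) \<and> (\<exists>M. \<forall>x. M < \<bar>x\<bar> \<longrightarrow> g x = 0)"

lemma test_fnD:
  assumes "test_fn g"
  shows "continuous_on UNIV g" "0 \<le> g x" "g x \<le> 1" "g \<in> borel_measurable borel"
  using assms by (auto simp: test_fn_def intro: borel_measurable_continuous_onI)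

text \<open>A list \<open>[(t\<^sub>1, g\<^sub>1), \<dots>, (t\<^sub>n, g\<^sub>n)]\<close> with \<open>q \<le> t\<^sub>1 \<le> \<dots> \<le> t\<^sub>n\<close> stands for the functional
  \<open>g\<^sub>1 (\<omega> t\<^sub>1) \<dots> g\<^sub>n (\<omega> t\<^sub>n)\<close>.\<close>

primrec cyl_from :: "real \<Rightarrow> cyl \<Rightarrow> bool" where
  "cyl_from q [] \<longleftrightarrow> True"
| "cyl_from q (p # l) \<longleftrightarrow> q \<le> fst p \<and> test_fn (snd p) \<and> cyl_from (fst p) l"

primrec last_time :: "real \<Rightarrow> cyl \<Rightarrow> real" where
  "last_time q [] = q"
| "last_time q (p # l) = last_time (fst p) l"

definition cyl_fn :: "cyl \<Rightarrow> (real \<Rightarrow> real) \<Rightarrow> real" where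
  "cyl_fn l \<omega> = (\<Prod>p\<leftarrow>l. snd p (\<omega> (fst p)))"

lemma cyl_fn_simps [simp]:
  "cyl_fn [] \<omega> = 1" "cyl_fn (p # l) \<omega> = snd p (\<omega> (fst p)) * cyl_fn l \<omega>"
  by (simp_all add: cyl_fn_def)

lemma last_time_ge: "cyl_from q l \<Longrightarrow> q \<le> last_time q l"
  by (induction l arbitrary: q) force+

lemma cyl_fn_bounds: "cyl_from q l \<Longrightarrow> 0 \<le> cyl_fn l \<omega> \<and> cyl_fn l \<omega> \<le> 1"
proof (induction l arbitrary: q)
  case (Cons p l)
  then have "0 \<le> snd p (\<omega> (fst p))" "snd p (\<omega> (fst p)) \<le> 1" "0 \<le> cyl_fn l \<omega>" "cyl_fn l \<omega> \<le> 1"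
    by (auto dest: test_fnD)
  then show ?case by (auto intro: mult_le_one)
qed simp

lemma measurable_cyl_fn:
  "0 \<le> q \<Longrightarrow> cyl_from q l \<Longrightarrow> cyl_fn l \<in> borel_measurable (canon_filt (last_time q l))"
proof (induction l arbitrary: q)
  case Nil
  then show ?case by (simp add: cyl_fn_def[abs_def])
next
  case (Cons p l)
  have "(\<lambda>\<omega>. \<omega> (fst p)) \<in> borel_measurable (canon_filt (last_time (fst p) l))"
    by (rule measurable_coord) (use Cons.prems last_time_ge[of "fst p" l] in auto)
  moreover have "snd p \<in> borel_measurable borel" using Cons.prems test_fnD by auto
  ultimately have [measurable]: "(\<lambda>\<omega>. snd p (\<omega> (fst p))) \<in> borel_measurable (canon_filt (last_time (fst p) l))"
    by (rule measurable_compose)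
  have [measurable]: "cyl_fn l \<in> borel_measurable (canon_filt (last_time (fst p) l))"
    using Cons by auto
  show ?case by simp
qed

context wiener_space
begin

text \<open>Expectation of the cylinder functional of \<open>l\<close> along z - R, where R is a
  Bessel process with value a at time q, built from the last factor backwards through the
  semigroup.\<close>

primrec bes_ker :: "real \<Rightarrow> cyl \<Rightarrow> real \<Rightarrow> real \<Rightarrow> real" where
  "bes_ker z [] q a = 1"
| "bes_ker z (p # l) q a = bes_op (fst p - q) (\<lambda>r. snd p (z - r) * bes_ker z l (fst p) r) a"

lemma bes_op_nonneg: "(\<And>r. 0 \<le> G r) \<Longrightarrow> 0 \<le> bes_op d G v"
  unfolding bes_op_def by (rule Bochner_Integration.integral_nonneg) auto

lemma bes_ker_basic:
  "cyl_from q l \<Longrightarrow> bes_ker z l q \<in> borel_measurable borel \<and> (\<forall>a. 0 \<le> bes_ker z l q a \<and> bes_ker z l q a \<le> 1)"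
proof (induction l arbitrary: q)
  case Nil
  have "bes_ker z [] q = (\<lambda>a. 1)" by auto
  then show ?case by simp
next
  case (Cons p l)
  let ?G = "\<lambda>r. snd p (z - r) * bes_ker z l (fst p) r"
  have d: "0 \<le> fst p - q" and t: "test_fn (snd p)" and IH: "bes_ker z l (fst p) \<in> borel_measurable borel"
    "\<And>a. 0 \<le> bes_ker z l (fst p) a" "\<And>a. bes_ker z l (fst p) a \<le> 1"
    using Cons by auto
  note [measurable] = test_fnD(4)[OF t] IH(1)
  have G01: "0 \<le> ?G r" "?G r \<le> 1" for r using IH test_fnD[OF t] by (auto intro: mult_le_one)
  have G: "bdd_borel ?G" unfolding bdd_borel_def using G01 by (auto intro!: exI[of _ 1])
  have eq: "bes_ker z (p # l) q = bes_op (fst p - q) ?G" by auto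
  show ?case unfolding eq
    using measurable_bes_op[OF d, of ?G] bes_op_nonneg[OF G01(1), of "fst p - q"] abs_bes_op_le[OF d G, of 1] G01
    by (auto simp: abs_le_iff)
qed

text \<open>Level, starting time and starting radius must be allowed to move together: times and
  positions vary in optional stopping, level y + e and radius e in the final limit. Dominated
  convergence along continuous Brownian paths handles all three at once.\<close>

lemma bes_ker_tendsto:
  assumes "cyl_from q l" "\<And>n. cyl_from (qn n) l" "qn \<longlonglongrightarrow> q" "zn \<longlonglongrightarrow> z" "an \<longlonglongrightarrow> a"
  shows "(\<lambda>n. bes_ker (zn n) l (qn n) (an n)) \<longlonglongrightarrow> bes_ker z l q a"
  using assms
proof (induction l arbitrary: q qn a an)
  case (Cons p l)
  let ?s = "fst p"
  let ?G = "\<lambda>z r. snd p (z - r) * bes_ker z l ?s r"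
  have q: "q \<le> ?s" and qn: "qn n \<le> ?s" for n using Cons.prems by auto
  have t: "test_fn (snd p)" and cl: "cyl_from ?s l" using Cons.prems by auto
  have Gm: "?G z \<in> borel_measurable borel" for z
  proof -
    have [measurable]: "bes_ker z l ?s \<in> borel_measurable borel" "snd p \<in> borel_measurable borel"
      using bes_ker_basic[OF cl, of z] test_fnD(4)[OF t] by auto
    show ?thesis by measurable
  qed
  have G01: "\<bar>?G z r\<bar> \<le> 1" for z r
    using bes_ker_basic[OF cl, of z] test_fnD[OF t] by (auto intro!: mult_le_one simp: abs_mult)
  have "(\<lambda>n. bes_op (?s - qn n) (?G (zn n)) (an n)) \<longlonglongrightarrow> bes_op (?s - q) (?G z) a"
    unfolding bes_op_def
  proof (rule integral_dominated_convergence[where w="\<lambda>_. 1"])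
    show "AE x in P3. (\<lambda>n. case x of (\<alpha>, \<beta>, \<gamma>) \<Rightarrow>
        ?G (zn n) (sqrt ((an n + \<alpha> (?s - qn n))\<^sup>2 + (\<beta> (?s - qn n))\<^sup>2 + (\<gamma> (?s - qn n))\<^sup>2))) \<longlonglongrightarrow>
      (case x of (\<alpha>, \<beta>, \<gamma>) \<Rightarrow> ?G z (sqrt ((a + \<alpha> (?s - q))\<^sup>2 + (\<beta> (?s - q))\<^sup>2 + (\<gamma> (?s - q))\<^sup>2)))"
    proof (rule AE_I2, clarify)
      fix \<alpha> \<beta> \<gamma> assume "(\<alpha>, \<beta>, \<gamma>) \<in> space P3"
      then have sp: "\<alpha> \<in> path_space" "\<beta> \<in> path_space" "\<gamma> \<in> path_space" by (auto simp: space_pair_measure)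
      have lw: "(\<lambda>n. w (?s - qn n)) \<longlonglongrightarrow> w (?s - q)" if "w \<in> path_space" for w
        by (rule path_tendsto[OF that _ tendsto_diff[OF tendsto_const Cons.prems(3)]]) (use q qn in auto)
      let ?r = "\<lambda>n. sqrt ((an n + \<alpha> (?s - qn n))\<^sup>2 + (\<beta> (?s - qn n))\<^sup>2 + (\<gamma> (?s - qn n))\<^sup>2)"
      have r: "?r \<longlonglongrightarrow> sqrt ((a + \<alpha> (?s - q))\<^sup>2 + (\<beta> (?s - q))\<^sup>2 + (\<gamma> (?s - q))\<^sup>2)" (is "_ \<longlonglongrightarrow> ?x")
        by (intro tendsto_real_sqrt tendsto_add tendsto_power Cons.prems lw sp)
      have "(\<lambda>n. bes_ker (zn n) l ?s (?r n)) \<longlonglongrightarrow> bes_ker z l ?s ?x"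
        by (rule Cons.IH[OF cl cl tendsto_const Cons.prems(4) r])
      moreover have "(\<lambda>n. snd p (zn n - ?r n)) \<longlonglongrightarrow> snd p (z - ?x)"
        by (rule continuous_on_tendsto_compose[OF test_fnD(1)[OF t] tendsto_diff[OF Cons.prems(4) r]]) auto
      ultimately show "(\<lambda>n. ?G (zn n) (?r n)) \<longlonglongrightarrow> ?G z ?x"
        by (rule tendsto_mult[rotated])
    qed
    show "(\<lambda>(\<alpha>, \<beta>, \<gamma>). ?G z (sqrt ((a + \<alpha> (?s - q))\<^sup>2 + (\<beta> (?s - q))\<^sup>2 + (\<gamma> (?s - q))\<^sup>2))) \<in> borel_measurable P3"
      by (rule measurable_bes_integrand[OF _ Gm]) (use q in simp)
    show "(\<lambda>(\<alpha>, \<beta>, \<gamma>). ?G (zn n) (sqrt ((an n + \<alpha> (?s - qn n))\<^sup>2 + (\<beta> (?s - qn n))\<^sup>2 + (\<gamma> (?s - qn n))\<^sup>2))) \<in> borel_measurable P3" for n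
      by (rule measurable_bes_integrand[OF _ Gm]) (use qn[of n] in simp)
    show "AE x in P3. norm (case x of (\<alpha>, \<beta>, \<gamma>) \<Rightarrow>
        ?G (zn n) (sqrt ((an n + \<alpha> (?s - qn n))\<^sup>2 + (\<beta> (?s - qn n))\<^sup>2 + (\<gamma> (?s - qn n))\<^sup>2))) \<le> 1" for n
      using G01 by (intro AE_I2) (simp add: case_prod_unfold)
  qed simp
  then show ?case by simp
qed simp

text \<open>Since g has bounded support, so has \<open>G\<close>; this makes it admissible for the
  approximation by Gaussians and bounds \<open>r * G r\<close>.\<close>

lemma bes_ker_step:
  fixes g :: "real \<Rightarrow> real" and z :: real
  assumes t: "test_fn g" and cl: "cyl_from s l"
  defines "G \<equiv> \<lambda>r. g (z - r) * bes_ker z l s r"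
  shows "continuous_on UNIV G" "(G \<longlongrightarrow> 0) at_top" "bdd_borel G" "\<exists>C. \<forall>r. \<bar>r * G r\<bar> \<le> C" "\<bar>G r\<bar> \<le> 1"
proof -
  have "continuous_on UNIV (bes_ker z l s)"
    unfolding continuous_on_sequentially comp_def
    by (intro allI impI ballI, rule bes_ker_tendsto[OF cl _ tendsto_const tendsto_const]) (use cl in auto)
  then show c: "continuous_on UNIV G" unfolding G_def
    by (intro continuous_intros continuous_on_compose2[OF test_fnD(1)[OF t]]) auto
  obtain M where M: "\<And>x. M < \<bar>x\<bar> \<Longrightarrow> g x = 0" using t unfolding test_fn_def by blast
  have G0: "G r = 0" if "\<bar>z\<bar> + \<bar>M\<bar> < \<bar>r\<bar>" for r using M[of "z - r"] that unfolding G_def by simp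
  show G1: "\<bar>G r\<bar> \<le> 1" for r
    using bes_ker_basic[OF cl, of z] test_fnD[OF t] unfolding G_def by (auto intro!: mult_le_one simp: abs_mult)
  have "eventually (\<lambda>r. G r = 0) at_top"
    using eventually_gt_at_top[of "\<bar>z\<bar> + \<bar>M\<bar>"] by eventually_elim (rule G0, simp)
  then show "(G \<longlongrightarrow> 0) at_top" by (rule tendsto_eventually)
  show "bdd_borel G" unfolding bdd_borel_def
    using G1 borel_measurable_continuous_onI[OF c] by blast
  have "\<bar>r * G r\<bar> \<le> \<bar>z\<bar> + \<bar>M\<bar>" for r
  proof (cases "\<bar>z\<bar> + \<bar>M\<bar> < \<bar>r\<bar>")
    case False
    then have "\<bar>r\<bar> * \<bar>G r\<bar> \<le> (\<bar>z\<bar> + \<bar>M\<bar>) * 1" using G1 by (intro mult_mono) auto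
    then show ?thesis by (simp add: abs_mult)
  qed (simp add: G0)
  then show "\<exists>C. \<forall>r. \<bar>r * G r\<bar> \<le> C" by blast
qed

text \<open>Brownian motion weighted by its distance to \<open>z\<close> and killed at \<open>z\<close> is the \<open>h\<close>-transform that
  turns \<open>z - X\<close> into a Bessel process.\<close>

lemma killed_h_transform:
  assumes "0 \<le> q" "cyl_from q l" "Y \<in> borel_measurable (canon_filt q)" "\<And>\<omega>. \<bar>Y \<omega>\<bar> \<le> 1"
  shows "(\<integral>\<omega>. (if \<forall>u\<in>{q..last_time q l}. \<omega> u < z then Y \<omega> * (cyl_fn l \<omega> * (z - \<omega> (last_time q l))) else 0) \<partial>P) =
    (\<integral>\<omega>. (if \<omega> q < z then Y \<omega> * ((z - \<omega> q) * bes_ker z l q (z - \<omega> q)) else 0) \<partial>P)"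
  using assms
proof (induction l arbitrary: q Y)
  case Nil
  show ?case by (rule Bochner_Integration.integral_cong[OF refl]) auto
next
  case (Cons p l)
  let ?s = "fst p"
  define G where "G r = snd p (z - r) * bes_ker z l ?s r" for r
  \<comment> \<open>Odd about z, and equal to \<open>(z - x) * G (z - x)\<close> below z; the
    absolute value is what makes the reflection principle applicable.\<close>
  define H where "H x = (z - x) * G \<bar>z - x\<bar>" for x
  have q: "0 \<le> q" "q \<le> ?s" and t: "test_fn (snd p)" and cl: "cyl_from ?s l" using Cons.prems by auto
  note Y = Cons.prems(3,4)
  note G = bes_ker_step[OF t cl, of z, folded G_def]
  obtain C where C: "\<And>r. \<bar>r * G r\<bar> \<le> C" using G(4) by blast
  have Gm: "G \<in> borel_measurable borel" using G(3) by (simp add: bdd_borel_def)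
  have Hc: "continuous_on UNIV H" unfolding H_def
    by (intro continuous_intros continuous_on_compose2[OF G(1)]) auto
  have Hb: "\<bar>H x\<bar> \<le> C" for x using C[of "\<bar>z - x\<bar>"] by (simp add: H_def abs_mult)
  have Ho: "H (2 * z - x) = - H x" for x
  proof -
    have "z - (2 * z - x) = - (z - x)" by simp
    then show ?thesis unfolding H_def by (simp only: abs_minus_cancel mult_minus_left)
  qed
  \<comment> \<open>The first factor and the survival up to its time become part of the weight. The
    induction hypothesis then treats the times after \<open>fst p\<close>, and the reflection
    principle the stretch before.\<close>
  define Y' where "Y' \<omega> = (if \<forall>u\<in>{q..?s}. \<omega> u < z then Y \<omega> * snd p (\<omega> ?s) else 0)" for \<omega>
  have Y'm: "Y' \<in> borel_measurable (canon_filt ?s)"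
  proof -
    have [measurable]: "Y \<in> borel_measurable (canon_filt ?s)" "(\<lambda>\<omega>. \<omega> ?s) \<in> borel_measurable (canon_filt ?s)"
      "snd p \<in> borel_measurable borel" "Measurable.pred (canon_filt ?s) (\<lambda>\<omega>. \<forall>u\<in>{q..?s}. \<omega> u < z)"
      using measurable_canon_filt_mono[OF Y(1)] q measurable_coord test_fnD(4)[OF t] pred_path_below[OF q] by auto
    show ?thesis unfolding Y'_def by measurable
  qed
  have Y'b: "\<bar>Y' \<omega>\<bar> \<le> 1" for \<omega>
    unfolding Y'_def using Y(2)[of \<omega>] test_fnD(2,3)[OF t, of "\<omega> ?s"] by (auto simp: abs_mult intro!: mult_le_one)
  let ?t = "last_time ?s l"
  have st: "?s \<le> ?t" by (rule last_time_ge[OF cl])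
  have "(\<integral>\<omega>. (if \<forall>u\<in>{q..last_time q (p # l)}. \<omega> u < z then Y \<omega> * (cyl_fn (p # l) \<omega> * (z - \<omega> (last_time q (p # l)))) else 0) \<partial>P) =
    (\<integral>\<omega>. (if \<forall>u\<in>{?s..?t}. \<omega> u < z then Y' \<omega> * (cyl_fn l \<omega> * (z - \<omega> ?t)) else 0) \<partial>P)"
  proof (rule Bochner_Integration.integral_cong[OF refl])
    fix \<omega> :: "real \<Rightarrow> real"
    have "(\<forall>u\<in>{q..?t}. \<omega> u < z) \<longleftrightarrow> (\<forall>u\<in>{q..?s}. \<omega> u < z) \<and> (\<forall>u\<in>{?s..?t}. \<omega> u < z)"
      using q st by force
    then show "(if \<forall>u\<in>{q..last_time q (p # l)}. \<omega> u < z then Y \<omega> * (cyl_fn (p # l) \<omega> * (z - \<omega> (last_time q (p # l)))) else 0) =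
      (if \<forall>u\<in>{?s..?t}. \<omega> u < z then Y' \<omega> * (cyl_fn l \<omega> * (z - \<omega> ?t)) else 0)"
      by (simp add: Y'_def ac_simps)
  qed
  also have "\<dots> = (\<integral>\<omega>. (if \<omega> ?s < z then Y' \<omega> * ((z - \<omega> ?s) * bes_ker z l ?s (z - \<omega> ?s)) else 0) \<partial>P)"
    by (rule Cons.IH[OF _ cl Y'm Y'b]) (use q in simp)
  also have "\<dots> = (\<integral>\<omega>. (if \<forall>u\<in>{q..?s}. \<omega> u < z then Y \<omega> * H (\<omega> ?s) else 0) \<partial>P)"
    by (rule Bochner_Integration.integral_cong[OF refl]) (use q in \<open>auto simp: Y'_def H_def G_def ac_simps\<close>)
  also have "\<dots> = (\<integral>\<omega>. (if \<omega> q < z then Y \<omega> * (\<integral>w. H (\<omega> q + w (?s - q)) \<partial>P) else 0) \<partial>P)"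
    by (rule reflection_principle[OF q Y Hc Hb Ho])
  also have "\<dots> = (\<integral>\<omega>. (if \<omega> q < z then Y \<omega> * ((z - \<omega> q) * bes_ker z (p # l) q (z - \<omega> q)) else 0) \<partial>P)"
  proof (rule Bochner_Integration.integral_cong[OF refl])
    fix \<omega> :: "real \<Rightarrow> real"
    have d: "0 \<le> ?s - q" using q by simp
    define v where "v = z - \<omega> q"
    have "(\<integral>w. H (\<omega> q + w (?s - q)) \<partial>P) = (\<integral>w. (v + - w (?s - q)) * G \<bar>v + - w (?s - q)\<bar> \<partial>P)"
      by (simp add: H_def v_def algebra_simps)
    \<comment> \<open>z - X moves against the increment of X; symmetry of the normal law restores
      the sign.\<close>
    also have "\<dots> = (\<integral>w. (v + w (?s - q)) * G \<bar>v + w (?s - q)\<bar> \<partial>P)"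
    proof (rule integral_coord_uminus[OF d, where f="\<lambda>x. (v + x) * G \<bar>v + x\<bar>" and C=C])
      show "(\<lambda>x. (v + x) * G \<bar>v + x\<bar>) \<in> borel_measurable borel" using Gm by measurable
      show "\<bar>(v + x) * G \<bar>v + x\<bar>\<bar> \<le> C" for x using C[of "\<bar>v + x\<bar>"] by (simp add: abs_mult)
    qed
    also have "\<dots> = v * bes_op (?s - q) G v"
      by (rule bes_op_h_transform[OF d G(1-3), symmetric])
    also have "\<dots> = (z - \<omega> q) * bes_ker z (p # l) q (z - \<omega> q)"
      by (simp add: v_def G_def[abs_def])
    finally show "(if \<omega> q < z then Y \<omega> * (\<integral>w. H (\<omega> q + w (?s - q)) \<partial>P) else 0) =
      (if \<omega> q < z then Y \<omega> * ((z - \<omega> q) * bes_ker z (p # l) q (z - \<omega> q)) else 0)" by simp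
  qed
  finally show ?case .
qed

text \<open>Iterates \<open>markov_bes\<close>, each factor passing into the weight
  \<open>Y\<close>. Times are shifted by T because the Bessel path will be attached at the hitting
  time T.\<close>

lemma bes_fdd:
  assumes "0 \<le> T" "T \<le> q" "cyl_from q l"
    "(\<lambda>(\<alpha>, \<beta>, \<gamma>). Y \<alpha> \<beta> \<gamma>) \<in> borel_measurable (canon_filt (q - T) \<Otimes>\<^sub>M canon_filt (q - T) \<Otimes>\<^sub>M canon_filt (q - T))"
    "\<And>\<alpha> \<beta> \<gamma>. \<bar>Y \<alpha> \<beta> \<gamma>\<bar> \<le> 1"
  shows "(\<integral>(\<alpha>, \<beta>, \<gamma>). Y \<alpha> \<beta> \<gamma> * cyl_fn l (\<lambda>t. z - sqrt ((\<alpha> (t - T))\<^sup>2 + (\<beta> (t - T))\<^sup>2 + (\<gamma> (t - T))\<^sup>2)) \<partial>P3) =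
    (\<integral>(\<alpha>, \<beta>, \<gamma>). Y \<alpha> \<beta> \<gamma> * bes_ker z l q (sqrt ((\<alpha> (q - T))\<^sup>2 + (\<beta> (q - T))\<^sup>2 + (\<gamma> (q - T))\<^sup>2)) \<partial>P3)"
  using assms
proof (induction l arbitrary: q Y)
  case Nil
  then show ?case by simp
next
  case (Cons p l)
  let ?s = "fst p"
  define G where "G r = snd p (z - r) * bes_ker z l ?s r" for r
  have q: "T \<le> q" "q \<le> ?s" and t: "test_fn (snd p)" and cl: "cyl_from ?s l" using Cons.prems by auto
  note Y = Cons.prems(4,5)
  note G = bes_ker_step[OF t cl, of z, folded G_def]
  let ?R = "\<lambda>u (\<alpha>::real \<Rightarrow> real) (\<beta>::real \<Rightarrow> real) (\<gamma>::real \<Rightarrow> real). sqrt ((\<alpha> (u - T))\<^sup>2 + (\<beta> (u - T))\<^sup>2 + (\<gamma> (u - T))\<^sup>2)"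
  define Y' where "Y' \<alpha> \<beta> \<gamma> = Y \<alpha> \<beta> \<gamma> * snd p (z - ?R ?s \<alpha> \<beta> \<gamma>)" for \<alpha> \<beta> \<gamma>
  have Y'm: "(\<lambda>(\<alpha>, \<beta>, \<gamma>). Y' \<alpha> \<beta> \<gamma>) \<in> borel_measurable (canon_filt (?s - T) \<Otimes>\<^sub>M canon_filt (?s - T) \<Otimes>\<^sub>M canon_filt (?s - T))"
  proof -
    have [measurable]: "(\<lambda>\<omega>. \<omega>) \<in> canon_filt (?s - T) \<rightarrow>\<^sub>M canon_filt (q - T)"
      by (rule measurable_ident_coord_algebra) (use q in auto)
    have [measurable]: "(\<lambda>\<omega>. \<omega> (?s - T)) \<in> borel_measurable (canon_filt (?s - T))"
      by (rule measurable_coord) (use q in auto)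
    have [measurable]: "snd p \<in> borel_measurable borel" by (rule test_fnD(4)[OF t])
    have "(\<lambda>z. (fst z, fst (snd z), snd (snd z))) \<in> canon_filt (?s - T) \<Otimes>\<^sub>M canon_filt (?s - T) \<Otimes>\<^sub>M canon_filt (?s - T) \<rightarrow>\<^sub>M canon_filt (q - T) \<Otimes>\<^sub>M canon_filt (q - T) \<Otimes>\<^sub>M canon_filt (q - T)"
      by measurable
    from measurable_compose[OF this Y(1)]
    have [measurable]: "(\<lambda>z. Y (fst z) (fst (snd z)) (snd (snd z))) \<in> borel_measurable (canon_filt (?s - T) \<Otimes>\<^sub>M canon_filt (?s - T) \<Otimes>\<^sub>M canon_filt (?s - T))"
      by (simp add: case_prod_unfold)
    show ?thesis unfolding Y'_def case_prod_unfold by measurable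
  qed
  have Y'b: "\<bar>Y' \<alpha> \<beta> \<gamma>\<bar> \<le> 1" for \<alpha> \<beta> \<gamma>
    unfolding Y'_def abs_mult using Y(2) test_fnD(2,3)[OF t] by (intro mult_le_one) auto
  have "(\<integral>(\<alpha>, \<beta>, \<gamma>). Y \<alpha> \<beta> \<gamma> * cyl_fn (p # l) (\<lambda>t. z - ?R t \<alpha> \<beta> \<gamma>) \<partial>P3) =
    (\<integral>(\<alpha>, \<beta>, \<gamma>). Y' \<alpha> \<beta> \<gamma> * cyl_fn l (\<lambda>t. z - ?R t \<alpha> \<beta> \<gamma>) \<partial>P3)"
    by (simp add: Y'_def ac_simps)
  also have "\<dots> = (\<integral>(\<alpha>, \<beta>, \<gamma>). Y' \<alpha> \<beta> \<gamma> * bes_ker z l ?s (?R ?s \<alpha> \<beta> \<gamma>) \<partial>P3)"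
    by (rule Cons.IH[OF _ _ cl Y'm Y'b]) (use Cons.prems q in auto)
  also have "\<dots> = (\<integral>(\<alpha>, \<beta>, \<gamma>). Y \<alpha> \<beta> \<gamma> * G (?R ?s \<alpha> \<beta> \<gamma>) \<partial>P3)"
    by (simp add: Y'_def G_def ac_simps)
  also have "\<dots> = (\<integral>(\<alpha>, \<beta>, \<gamma>). Y \<alpha> \<beta> \<gamma> * bes_op (?s - T - (q - T)) G (?R q \<alpha> \<beta> \<gamma>) \<partial>P3)"
    by (rule markov_bes[OF _ _ Y G(1-3)]) (use q in auto)
  also have "\<dots> = (\<integral>(\<alpha>, \<beta>, \<gamma>). Y \<alpha> \<beta> \<gamma> * bes_ker z (p # l) q (?R q \<alpha> \<beta> \<gamma>) \<partial>P3)"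
    by (simp add: G_def[abs_def])
  finally show ?case .
qed

text \<open>Each coordinate starts at 0 almost surely, so the radius at time T is 0. This is the
  entrance from 0, at which the h-transform by the radius degenerates.\<close>

lemma bes_fdd_start:
  assumes T: "0 \<le> T" and l: "cyl_from T l"
  shows "(\<integral>(\<alpha>, \<beta>, \<gamma>). cyl_fn l (\<lambda>t. z - sqrt ((\<alpha> (t - T))\<^sup>2 + (\<beta> (t - T))\<^sup>2 + (\<gamma> (t - T))\<^sup>2)) \<partial>P3) = bes_ker z l T 0"
proof -
  have K[measurable]: "bes_ker z l T \<in> borel_measurable borel" using bes_ker_basic[OF l] by blast
  have start: "(\<integral>\<gamma>. f (\<gamma> 0) \<partial>P) = f 0" if [measurable]: "f \<in> borel_measurable borel" for f :: "real \<Rightarrow> real"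
  proof -
    have "(\<integral>\<gamma>. f (\<gamma> 0) \<partial>P) = (\<integral>\<gamma>. f 0 \<partial>P)"
    proof (rule integral_cong_AE)
      show "AE \<gamma> in P. f (\<gamma> 0) = f 0" using AE_start by eventually_elim simp
    qed auto
    then show ?thesis using prob_space by simp
  qed
  have "(\<integral>(\<alpha>, \<beta>, \<gamma>). cyl_fn l (\<lambda>t. z - sqrt ((\<alpha> (t - T))\<^sup>2 + (\<beta> (t - T))\<^sup>2 + (\<gamma> (t - T))\<^sup>2)) \<partial>P3) =
    (\<integral>(\<alpha>, \<beta>, \<gamma>). bes_ker z l T (sqrt ((\<alpha> 0)\<^sup>2 + (\<beta> 0)\<^sup>2 + (\<gamma> 0)\<^sup>2)) \<partial>P3)"
    using bes_fdd[OF T order_refl l, of "\<lambda>_ _ _. 1" z] by simp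
  also have "\<dots> = (\<integral>\<alpha>. (\<integral>\<beta>. (\<integral>\<gamma>. bes_ker z l T (sqrt ((\<alpha> 0)\<^sup>2 + (\<beta> 0)\<^sup>2 + (\<gamma> 0)\<^sup>2)) \<partial>P) \<partial>P) \<partial>P)"
  proof (rule integral_P3[where C=1])
    show "(\<lambda>(\<alpha>, \<beta>, \<gamma>). bes_ker z l T (sqrt ((\<alpha> 0)\<^sup>2 + (\<beta> 0)\<^sup>2 + (\<gamma> 0)\<^sup>2))) \<in> borel_measurable P3"
      using measurable_bes_integrand[of 0 "bes_ker z l T" 0] bes_ker_basic[OF l, of z] by simp
  qed (use bes_ker_basic[OF l, of z] in auto)
  also have "\<dots> = (\<integral>\<alpha>. (\<integral>\<beta>. bes_ker z l T (sqrt ((\<alpha> 0)\<^sup>2 + (\<beta> 0)\<^sup>2 + 0\<^sup>2)) \<partial>P) \<partial>P)"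
    by (subst start) simp_all
  also have "\<dots> = (\<integral>\<alpha>. bes_ker z l T (sqrt ((\<alpha> 0)\<^sup>2 + 0\<^sup>2 + 0\<^sup>2)) \<partial>P)"
    by (subst start) simp_all
  also have "\<dots> = bes_ker z l T (sqrt (0\<^sup>2 + 0\<^sup>2 + 0\<^sup>2))"
    by (subst start) simp_all
  finally show ?thesis by simp
qed

end

section \<open>Crossing a level\<close>

lemma test_fn_weight_bounded:
  assumes "test_fn g"
  shows "\<exists>C. \<forall>x. \<bar>(z - x) * g x\<bar> \<le> C"
proof -
  obtain M where M: "\<And>x. M < \<bar>x\<bar> \<Longrightarrow> g x = 0" using assms unfolding test_fn_def by blast
  have "\<bar>(z - x) * g x\<bar> \<le> \<bar>z\<bar> + \<bar>M\<bar>" for x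
  proof (cases "M < \<bar>x\<bar>")
    case False
    then have "\<bar>z - x\<bar> * \<bar>g x\<bar> \<le> (\<bar>z\<bar> + \<bar>M\<bar>) * 1"
      using test_fnD(2,3)[OF assms, of x] by (intro mult_mono) auto
    then show ?thesis by (simp add: abs_mult)
  qed (simp add: M)
  then show ?thesis by blast
qed

text \<open>The weight is taken at the time of the last factor, whose bounded support tames it; the
  empty list offers no such factor.\<close>

lemma cyl_weight_bounded:
  "cyl_from q l \<Longrightarrow> l \<noteq> [] \<Longrightarrow> \<exists>C. \<forall>\<omega>. \<bar>cyl_fn l \<omega> * (z - \<omega> (last_time q l))\<bar> \<le> C"
proof (induction l arbitrary: q)
  case (Cons p l)
  then have t: "test_fn (snd p)" and cl: "cyl_from (fst p) l" by auto
  show ?case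
  proof (cases "l = []")
    case True
    obtain C where "\<And>x. \<bar>(z - x) * snd p x\<bar> \<le> C" using test_fn_weight_bounded[OF t, of z] by blast
    then show ?thesis using True by (intro exI[of _ C]) (simp add: mult.commute)
  next
    case False
    obtain C where C: "\<And>\<omega>. \<bar>cyl_fn l \<omega> * (z - \<omega> (last_time (fst p) l))\<bar> \<le> C"
      using Cons.IH[OF cl False] by blast
    have "\<bar>snd p (\<omega> (fst p))\<bar> * \<bar>cyl_fn l \<omega> * (z - \<omega> (last_time (fst p) l))\<bar> \<le> 1 * C" for \<omega>
      using C test_fnD(2,3)[OF t] by (intro mult_mono) auto
    then show ?thesis by (intro exI[of _ C]) (simp add: abs_mult mult.assoc)
  qed
qed simp

lemma hit_time_eq_first:
  assumes w: "\<omega> \<in> path_space" and T: "0 \<le> T" "\<omega> T = y" "\<And>v. 0 \<le> v \<Longrightarrow> v < T \<Longrightarrow> \<omega> v < y"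
  shows "hit_time y \<omega> = ereal T"
proof (rule antisym)
  show "hit_time y \<omega> \<le> ereal T" by (rule hit_time_le[of T \<omega> y, OF T(1,2)])
  then obtain s where s: "0 \<le> s" "hit_time y \<omega> = ereal s" "\<omega> s = y"
    using hit_time_attained[OF w, of y] by force
  have "T \<le> s" using T(3)[of s] s by force
  then show "ereal T \<le> hit_time y \<omega>" using s by simp
qed

context wiener_space
begin

text \<open>Reads the factors at times up to \<open>s\<close> from the path, and averages the later ones over a
  process that at time \<open>s\<close> continues as \<open>z\<close> minus a Bessel process started at \<open>a\<close>.\<close>

primrec glue :: "real \<Rightarrow> cyl \<Rightarrow> real \<Rightarrow> (real \<Rightarrow> real) \<Rightarrow> real \<Rightarrow> real" where
  "glue z [] s \<omega> a = 1"
| "glue z (p # l) s \<omega> a =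
    (if fst p \<le> s then snd p (\<omega> (fst p)) * glue z l s \<omega> a else bes_ker z (p # l) s a)"

lemma glue_bounds: "cyl_from q l \<Longrightarrow> 0 \<le> glue z l s \<omega> a \<and> glue z l s \<omega> a \<le> 1"
proof (induction l arbitrary: q)
  case (Cons p l)
  then have t: "test_fn (snd p)" and cl: "cyl_from (fst p) l" by auto
  show ?case
  proof (cases "fst p \<le> s")
    case True
    then show ?thesis using Cons.IH[OF cl] test_fnD(2,3)[OF t] by (simp add: mult_le_one)
  next
    case False
    then have "cyl_from s (p # l)" using t cl by simp
    then show ?thesis using bes_ker_basic[of s "p # l" z] False by (simp del: bes_ker.simps)
  qed
qed simp

text \<open>Convergence is from the right only: a factor at time s is read from the path by
  \<open>glue\<close> at s and at later times, but averaged by \<open>glue\<close> at earlier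
  ones.\<close>

lemma glue_tendsto:
  assumes "cyl_from q l" "\<And>n. s \<le> sn n" "sn \<longlonglongrightarrow> s" "zn \<longlonglongrightarrow> z" "an \<longlonglongrightarrow> a"
  shows "(\<lambda>n. glue (zn n) l (sn n) \<omega> (an n)) \<longlonglongrightarrow> glue z l s \<omega> a"
  using assms
proof (induction l arbitrary: q)
  case (Cons p l)
  then have t: "test_fn (snd p)" and cl: "cyl_from (fst p) l" by auto
  show ?case
  proof (cases "fst p \<le> s")
    case True
    then have "fst p \<le> sn n" for n using Cons.prems(2)[of n] by simp
    then show ?thesis using True Cons.IH[OF cl Cons.prems(2-)] by (simp add: tendsto_mult_left)
  next
    case False
    \<comment> \<open>Capping at \<open>fst p\<close> keeps every starting time admissible; the cap
      is eventually inactive because the limit s lies strictly before \<open>fst p\<close>.\<close>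
    have m: "(\<lambda>n. min (sn n) (fst p)) \<longlonglongrightarrow> min s (fst p)"
      by (intro tendsto_min Cons.prems tendsto_const)
    have "(\<lambda>n. bes_ker (zn n) (p # l) (min (sn n) (fst p)) (an n)) \<longlonglongrightarrow> bes_ker z (p # l) (min s (fst p)) a"
      by (rule bes_ker_tendsto[OF _ _ m Cons.prems(4,5)]) (use t cl in auto)
    moreover have "\<forall>\<^sub>F n in sequentially. sn n < fst p"
      by (rule order_tendstoD(2)[OF Cons.prems(3)]) (use False in simp)
    then have "\<forall>\<^sub>F n in sequentially. bes_ker (zn n) (p # l) (min (sn n) (fst p)) (an n) = glue (zn n) (p # l) (sn n) \<omega> (an n)"
      by eventually_elim (simp add: min_def)
    ultimately have "(\<lambda>n. glue (zn n) (p # l) (sn n) \<omega> (an n)) \<longlonglongrightarrow> bes_ker z (p # l) (min s (fst p)) a"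
      by (rule Lim_transform_eventually)
    then show ?thesis using False by (simp add: min_def)
  qed
qed simp

lemma measurable_glue:
  assumes "0 \<le> q" "cyl_from q l" "f \<in> borel_measurable P"
  shows "(\<lambda>\<omega>. glue z l s \<omega> (f \<omega>)) \<in> borel_measurable P"
  using assms
proof (induction l arbitrary: q)
  case (Cons p l)
  then have t: "test_fn (snd p)" and cl: "cyl_from (fst p) l" and p: "0 \<le> fst p" by auto
  show ?case
  proof (cases "fst p \<le> s")
    case True
    have "(\<lambda>\<omega>. snd p (\<omega> (fst p))) \<in> borel_measurable P"
      by (rule measurable_compose[OF measurable_coord_P[OF p] test_fnD(4)[OF t]])
    then show ?thesis using True Cons.IH[OF p cl Cons.prems(3)] by simp
  next
    case False
    then have "cyl_from s (p # l)" using t cl by simp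
    then have "bes_ker z (p # l) s \<in> borel_measurable borel" using bes_ker_basic by blast
    from measurable_compose[OF Cons.prems(3) this] show ?thesis using False by simp
  qed
qed simp

text \<open>By the h-transform, r times the kernel is a one-dimensional expectation of x G
  \<bar>x\<bar>, a bounded function. The bound does not depend on the starting time.\<close>

lemma bes_ker_weight_bounded:
  assumes t: "test_fn (snd p)" and cl: "cyl_from (fst p) l"
  shows "\<exists>C. \<forall>q r. q \<le> fst p \<longrightarrow> \<bar>r * bes_ker z (p # l) q r\<bar> \<le> C"
proof -
  define G where "G r = snd p (z - r) * bes_ker z l (fst p) r" for r
  note G = bes_ker_step[OF t cl, of z, folded G_def]
  obtain C where C: "\<And>r. \<bar>r * G r\<bar> \<le> C" using G(4) by blast
  have [measurable]: "G \<in> borel_measurable borel" using G(3) by (simp add: bdd_borel_def)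
  have "\<bar>r * bes_ker z (p # l) q r\<bar> \<le> C" if q: "q \<le> fst p" for q r
  proof -
    have "r * bes_ker z (p # l) q r = (\<integral>w. (r + w (fst p - q)) * G \<bar>r + w (fst p - q)\<bar> \<partial>P)"
      using bes_op_h_transform[OF _ G(1-3), of "fst p - q" r] q by (simp add: G_def[abs_def])
    moreover have "\<bar>\<integral>w. (r + w (fst p - q)) * G \<bar>r + w (fst p - q)\<bar> \<partial>P\<bar> \<le> C"
    proof (rule abs_heat_le[where H="\<lambda>x. x * G \<bar>x\<bar>"])
      show "\<bar>x * G \<bar>x\<bar>\<bar> \<le> C" for x using C[of "\<bar>x\<bar>"] by (simp add: abs_mult)
    qed (use q in auto)
    ultimately show ?thesis by simp
  qed
  then show ?thesis by blast
qed

text \<open>Bounds, uniformly in time, the process that is stopped in \<open>level_crossing\<close>.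
  Before the first factor the kernel estimate applies; from its time on, a later factor or its own
  bounded support does.\<close>

lemma glue_weight_bounded:
  "cyl_from q l \<Longrightarrow> l \<noteq> [] \<Longrightarrow>
    \<exists>C. \<forall>s \<omega>. s \<le> last_time q l \<longrightarrow> \<bar>(z - \<omega> s) * glue z l s \<omega> (z - \<omega> s)\<bar> \<le> C"
proof (induction l arbitrary: q)
  case (Cons p l)
  then have t: "test_fn (snd p)" and cl: "cyl_from (fst p) l" by auto
  obtain C1 where C1: "\<And>q r. q \<le> fst p \<Longrightarrow> \<bar>r * bes_ker z (p # l) q r\<bar> \<le> C1"
    using bes_ker_weight_bounded[OF t cl] by blast
  have "\<exists>C. \<forall>s \<omega>. fst p \<le> s \<longrightarrow> s \<le> last_time (fst p) l \<longrightarrow>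
      \<bar>(z - \<omega> s) * (snd p (\<omega> (fst p)) * glue z l s \<omega> (z - \<omega> s))\<bar> \<le> C"
  proof (cases "l = []")
    case True
    obtain C where "\<And>x. \<bar>(z - x) * snd p x\<bar> \<le> C" using test_fn_weight_bounded[OF t, of z] by blast
    then show ?thesis using True by (intro exI[of _ C]) auto
  next
    case False
    obtain C where C: "\<And>s \<omega>. s \<le> last_time (fst p) l \<Longrightarrow> \<bar>(z - \<omega> s) * glue z l s \<omega> (z - \<omega> s)\<bar> \<le> C"
      using Cons.IH[OF cl False] by blast
    have "\<bar>snd p (\<omega> (fst p))\<bar> * \<bar>(z - \<omega> s) * glue z l s \<omega> (z - \<omega> s)\<bar> \<le> 1 * C" if "s \<le> last_time (fst p) l" for s \<omega>
      using C that test_fnD(2,3)[OF t] by (intro mult_mono) auto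
    then show ?thesis by (intro exI[of _ C]) (simp add: abs_mult ac_simps)
  qed
  then obtain C2 where C2: "\<And>s \<omega>. fst p \<le> s \<Longrightarrow> s \<le> last_time (fst p) l \<Longrightarrow>
      \<bar>(z - \<omega> s) * (snd p (\<omega> (fst p)) * glue z l s \<omega> (z - \<omega> s))\<bar> \<le> C2" by blast
  show ?case
  proof (intro exI[of _ "max C1 C2"] allI impI)
    fix s and \<omega> :: "real \<Rightarrow> real" assume "s \<le> last_time q (p # l)"
    then show "\<bar>(z - \<omega> s) * glue z (p # l) s \<omega> (z - \<omega> s)\<bar> \<le> max C1 C2"
      using C1[of s "z - \<omega> s"] C2[of s \<omega>] by (cases "fst p \<le> s") (auto simp del: bes_ker.simps)
  qed
qed simp

text \<open>Conditional expectation at an intermediate time s: factors up to s join the weight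
  \<open>Z\<close>, and from s on \<open>killed_h_transform\<close> applies. This supplies the
  martingale for the optional stopping at a level.\<close>

lemma killed_glue:
  assumes "0 \<le> q" "q \<le> s" "s \<le> last_time q l" "cyl_from q l" "Z \<in> borel_measurable (canon_filt s)" "\<And>\<omega>. \<bar>Z \<omega>\<bar> \<le> 1"
  shows "(\<integral>\<omega>. (if \<forall>u\<in>{s..last_time q l}. \<omega> u < z then Z \<omega> * (cyl_fn l \<omega> * (z - \<omega> (last_time q l))) else 0) \<partial>P) =
    (\<integral>\<omega>. (if \<omega> s < z then Z \<omega> * ((z - \<omega> s) * glue z l s \<omega> (z - \<omega> s)) else 0) \<partial>P)"
  using assms
proof (induction l arbitrary: q Z)
  case Nil
  then have "s = q" by simp
  then show ?case by (intro Bochner_Integration.integral_cong) auto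
next
  case (Cons p l)
  then have t: "test_fn (snd p)" and cl: "cyl_from (fst p) l" and p: "0 \<le> fst p" by auto
  show ?case
  proof (cases "fst p \<le> s")
    case True
    have "(\<lambda>\<omega>. snd p (\<omega> (fst p))) \<in> borel_measurable (canon_filt s)"
      by (rule measurable_compose[OF measurable_coord test_fnD(4)[OF t]]) (use True p in auto)
    then have m: "(\<lambda>\<omega>. Z \<omega> * snd p (\<omega> (fst p))) \<in> borel_measurable (canon_filt s)"
      using Cons.prems by auto
    have b: "\<bar>Z \<omega> * snd p (\<omega> (fst p))\<bar> \<le> 1" for \<omega>
      unfolding abs_mult using Cons.prems(6) test_fnD(2,3)[OF t] by (intro mult_le_one) auto
    show ?thesis
      using Cons.IH[OF p True _ cl m b] Cons.prems True by (simp add: ac_simps cong: if_cong)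
  next
    case False
    then have c: "cyl_from s (p # l)" using t cl by simp
    show ?thesis
      using killed_h_transform[OF _ c Cons.prems(5,6), of z] Cons.prems(1,2) False
      by (simp del: bes_ker.simps cyl_fn_simps cong: if_cong)
  qed
qed

text \<open>Read off at T_y, the conditional expectation of the weighted killed path is e times this
  quantity: there the distance to y + e is e, which is also the radius at which the Bessel process
  starts. For e = 0 it describes the path continued as under Q^y. The condition on \<omega> 0
  ensures that y is reached from below.\<close>

definition hit_weight :: "real \<Rightarrow> cyl \<Rightarrow> real \<Rightarrow> (real \<Rightarrow> real) \<Rightarrow> real" where
  "hit_weight y l e \<omega> = (if \<omega> 0 < y \<and> \<not> (\<forall>u\<in>{0..last_time 0 l}. \<omega> u < y)
    then glue (y + e) l (real_of_ereal (hit_time y \<omega>)) \<omega> e else 0)"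

lemma hit_weight_bounds: "cyl_from 0 l \<Longrightarrow> 0 \<le> hit_weight y l e \<omega> \<and> hit_weight y l e \<omega> \<le> 1"
  unfolding hit_weight_def using glue_bounds by auto

lemma hit_weight_tendsto:
  assumes l: "cyl_from 0 l" and e: "en \<longlonglongrightarrow> 0"
  shows "(\<lambda>n. hit_weight y l (en n) \<omega>) \<longlonglongrightarrow> hit_weight y l 0 \<omega>"
proof -
  have "(\<lambda>n. glue (y + en n) l s \<omega> (en n)) \<longlonglongrightarrow> glue (y + 0) l s \<omega> 0" for s
    by (rule glue_tendsto[OF l _ _ tendsto_add[OF tendsto_const e] e]) auto
  then show ?thesis unfolding hit_weight_def by auto
qed

text \<open>Optional stopping at y for paths killed at the higher level y + e; the factor e is the
  distance between the two levels. Measurability of \<open>hit_weight\<close>, which evaluates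
  \<open>glue\<close> at a random time, comes out of the same limit.\<close>

lemma level_crossing:
  assumes l: "cyl_from 0 l" "l \<noteq> []" and y: "0 < y" and e: "0 < e"
  defines "t \<equiv> last_time 0 l"
  shows "hit_weight y l e \<in> borel_measurable P"
    and "(\<integral>\<omega>. (if y \<le> run_sup t \<omega> \<and> run_sup t \<omega> < y + e then cyl_fn l \<omega> * (y + e - \<omega> t) else 0) \<partial>P) =
      e * (\<integral>\<omega>. hit_weight y l e \<omega> \<partial>P)"
proof -
  define z where "z = y + e"
  have t: "0 \<le> t" unfolding t_def by (rule last_time_ge[OF l(1)])
  obtain C1 where C1: "\<And>\<omega>. \<bar>cyl_fn l \<omega> * (z - \<omega> t)\<bar> \<le> C1"
    using cyl_weight_bounded[OF l] unfolding t_def by blast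
  obtain C2 where C2: "\<And>s \<omega>. s \<le> t \<Longrightarrow> \<bar>(z - \<omega> s) * glue z l s \<omega> (z - \<omega> s)\<bar> \<le> C2"
    using glue_weight_bounded[OF l] unfolding t_def by blast
  define C where "C = max 0 (max C1 C2)"
  \<comment> \<open>Almost surely 1, but optional stopping asks for a start below y on every path
    that has weight.\<close>
  define Y where "Y \<omega> = (if \<omega> 0 < y then 1 else 0 :: real)" for \<omega> :: "real \<Rightarrow> real"
  define \<zeta> where "\<zeta> \<omega> = (if \<forall>u\<in>{0..t}. \<omega> u < z then cyl_fn l \<omega> * (z - \<omega> t) else 0)" for \<omega>
  \<comment> \<open>Candidate for the conditional expectation of \<open>\<zeta>\<close> at time s:
    survival below z so far, times the distance to z, times the factors, read up to s and averaged
    after s.\<close>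
  define U where "U s \<omega> = (if \<forall>u\<in>{0..s}. \<omega> u < z then (z - \<omega> s) * glue z l s \<omega> (z - \<omega> s) else 0)" for s \<omega>
  define V where "V \<omega> = e * glue z l (real_of_ereal (hit_time y \<omega>)) \<omega> e" for \<omega>
  have [measurable]: "Measurable.pred P (\<lambda>\<omega>. \<forall>u\<in>{0..s}. \<omega> u < x)" if "0 \<le> s" for s x
    by (rule measurable_P[OF pred_path_below[OF order_refl that]])
  have Ym: "Y \<in> borel_measurable (canon_filt 0)"
  proof -
    have [measurable]: "(\<lambda>\<omega>. \<omega> 0) \<in> borel_measurable (canon_filt 0)" by (rule measurable_coord) simp
    show ?thesis unfolding Y_def by measurable
  qed
  have Fm[measurable]: "cyl_fn l \<in> borel_measurable P"
    using measurable_P[OF measurable_cyl_fn[OF order_refl l(1)]] .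
  have \<zeta>m: "\<zeta> \<in> borel_measurable P" unfolding \<zeta>_def using t by measurable
  have \<zeta>b: "\<bar>\<zeta> \<omega>\<bar> \<le> C" for \<omega> unfolding \<zeta>_def C_def using C1[of \<omega>] by auto
  have os: "(\<lambda>\<omega>. if \<forall>u\<in>{0..t}. \<omega> u < y then 0 else Y \<omega> * V \<omega>) \<in> borel_measurable P \<and>
    (\<integral>\<omega>. (if \<forall>u\<in>{0..t}. \<omega> u < y then 0 else Y \<omega> * \<zeta> \<omega>) \<partial>P) =
      (\<integral>\<omega>. (if \<forall>u\<in>{0..t}. \<omega> u < y then 0 else Y \<omega> * V \<omega>) \<partial>P)"
  proof (rule conjI; rule optional_stopping[where U=U and C=C, OF order_refl t Ym _ _ \<zeta>m \<zeta>b])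
    show "\<bar>Y \<omega>\<bar> \<le> 1" for \<omega> by (simp add: Y_def)
    show "\<bar>Y \<omega>\<bar> \<le> 1" for \<omega> by (simp add: Y_def)
    show "\<omega> 0 < y" if "Y \<omega> \<noteq> 0" for \<omega> using that by (simp add: Y_def split: if_splits)
    show "\<omega> 0 < y" if "Y \<omega> \<noteq> 0" for \<omega> using that by (simp add: Y_def split: if_splits)
    have Um: "U s \<in> borel_measurable P" if s: "0 \<le> s" for s
    proof -
      have [measurable]: "(\<lambda>\<omega>. glue z l s \<omega> (z - \<omega> s)) \<in> borel_measurable P"
        by (rule measurable_glue[OF order_refl l(1)]) (use s in auto)
      show ?thesis unfolding U_def using s by measurable
    qed
    then show "U s \<in> borel_measurable P" "U s \<in> borel_measurable P" if "0 \<le> s" "s \<le> t" for s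
      using that by auto
    have Ub: "\<bar>U s \<omega>\<bar> \<le> C" if "s \<le> t" for s \<omega>
      unfolding U_def C_def using C2[OF that, of \<omega>] by auto
    then show "\<bar>U s \<omega>\<bar> \<le> C" "\<bar>U s \<omega>\<bar> \<le> C" if "0 \<le> s" "s \<le> t" for s \<omega> using that by auto
    have mart: "(\<integral>\<omega>. Z \<omega> * \<zeta> \<omega> \<partial>P) = (\<integral>\<omega>. Z \<omega> * U s \<omega> \<partial>P)"
      if s: "0 \<le> s" "s \<le> t" and Z[measurable]: "Z \<in> borel_measurable (canon_filt s)" and Zb: "\<And>\<omega>. \<bar>Z \<omega>\<bar> \<le> 1" for s Z
    proof -
      define Z' where "Z' \<omega> = (if \<forall>u\<in>{0..s}. \<omega> u < z then Z \<omega> else 0)" for \<omega>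
      have [measurable]: "Measurable.pred (canon_filt s) (\<lambda>\<omega>. \<forall>u\<in>{0..s}. \<omega> u < z)"
        by (rule pred_path_below) (use s in auto)
      have Z'm: "Z' \<in> borel_measurable (canon_filt s)" unfolding Z'_def by measurable
      have Z'b: "\<bar>Z' \<omega>\<bar> \<le> 1" for \<omega> using Zb by (simp add: Z'_def)
      have "(\<integral>\<omega>. Z \<omega> * \<zeta> \<omega> \<partial>P) = (\<integral>\<omega>. (if \<forall>u\<in>{s..t}. \<omega> u < z then Z' \<omega> * (cyl_fn l \<omega> * (z - \<omega> t)) else 0) \<partial>P)"
      proof (rule Bochner_Integration.integral_cong[OF refl])
        fix \<omega> :: "real \<Rightarrow> real"
        have "(\<forall>u\<in>{0..t}. \<omega> u < z) \<longleftrightarrow> (\<forall>u\<in>{0..s}. \<omega> u < z) \<and> (\<forall>u\<in>{s..t}. \<omega> u < z)"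
          using s by force
        then show "Z \<omega> * \<zeta> \<omega> = (if \<forall>u\<in>{s..t}. \<omega> u < z then Z' \<omega> * (cyl_fn l \<omega> * (z - \<omega> t)) else 0)"
          by (simp add: \<zeta>_def Z'_def)
      qed
      also have "\<dots> = (\<integral>\<omega>. (if \<omega> s < z then Z' \<omega> * ((z - \<omega> s) * glue z l s \<omega> (z - \<omega> s)) else 0) \<partial>P)"
        unfolding t_def by (rule killed_glue[OF order_refl _ _ l(1) Z'm Z'b]) (use s t_def in auto)
      also have "\<dots> = (\<integral>\<omega>. Z \<omega> * U s \<omega> \<partial>P)"
        by (rule Bochner_Integration.integral_cong[OF refl]) (use s in \<open>auto simp: Z'_def U_def\<close>)
      finally show ?thesis .
    qed
    then show "(\<integral>\<omega>. Z \<omega> * \<zeta> \<omega> \<partial>P) = (\<integral>\<omega>. Z \<omega> * U s \<omega> \<partial>P)" "(\<integral>\<omega>. Z \<omega> * \<zeta> \<omega> \<partial>P) = (\<integral>\<omega>. Z \<omega> * U s \<omega> \<partial>P)"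
      if "0 \<le> s" "s \<le> t" "Z \<in> borel_measurable (canon_filt s)" "\<And>\<omega>. \<bar>Z \<omega>\<bar> \<le> 1" for s Z
      using that by auto
    have lim: "(\<lambda>n. U (u n) \<omega>) \<longlonglongrightarrow> V \<omega>"
      if w: "\<omega> \<in> path_space" and T: "0 < T" "T \<le> t" "\<omega> T = y" "\<And>v. 0 \<le> v \<Longrightarrow> v < T \<Longrightarrow> \<omega> v < y"
        and u: "\<And>n. T \<le> u n \<and> u n \<le> t" "u \<longlonglongrightarrow> T" for \<omega> u T
    proof -
      have hT: "real_of_ereal (hit_time y \<omega>) = T"
        using hit_time_eq_first[OF w _ T(3,4)] T(1) by simp
      have wu: "(\<lambda>n. \<omega> (u n)) \<longlonglongrightarrow> y"
        unfolding T(3)[symmetric]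
        by (rule path_tendsto[OF w _ u(2)]) (use u(1) T(1) in \<open>auto intro: order_trans[of 0 T]\<close>)
      \<comment> \<open>The path is at y < z at time T, so it stays below z a little longer and the
        survival indicator in \<open>U (u n)\<close> is eventually 1.\<close>
      have "continuous_on {0..} \<omega>" by (rule path_continuous_on[OF w])
      then obtain d where d: "0 < d" "\<And>x. 0 \<le> x \<Longrightarrow> dist x T < d \<Longrightarrow> dist (\<omega> x) (\<omega> T) < e"
        using T(1) e unfolding continuous_on_iff by (metis atLeast_iff less_imp_le)
      have lt: "\<omega> x < z" if "0 \<le> x" "x < T + d" for x
      proof (cases "x < T")
        case True then show ?thesis using T(4)[of x] that e by (simp add: z_def)
      next
        case False
        then have "dist (\<omega> x) (\<omega> T) < e" using d(2)[of x] that by (simp add: dist_real_def)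
        then show ?thesis using T(3) by (simp add: z_def dist_real_def abs_less_iff)
      qed
      have "\<forall>\<^sub>F n in sequentially. u n < T + d"
        by (rule order_tendstoD(2)[OF u(2)]) (use d in simp)
      then have ev: "\<forall>\<^sub>F n in sequentially. (z - \<omega> (u n)) * glue z l (u n) \<omega> (z - \<omega> (u n)) = U (u n) \<omega>"
        by eventually_elim (auto simp: U_def lt)
      have za: "(\<lambda>n. z - \<omega> (u n)) \<longlonglongrightarrow> e"
        using tendsto_diff[OF tendsto_const[of z] wu] by (simp add: z_def)
      have "(\<lambda>n. glue z l (u n) \<omega> (z - \<omega> (u n))) \<longlonglongrightarrow> glue z l T \<omega> e"
        by (rule glue_tendsto[OF l(1) _ u(2) tendsto_const za]) (use u(1) in auto)
      then have "(\<lambda>n. (z - \<omega> (u n)) * glue z l (u n) \<omega> (z - \<omega> (u n))) \<longlonglongrightarrow> V \<omega>"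
        unfolding V_def hT by (rule tendsto_mult[OF za])
      then show ?thesis using ev by (rule Lim_transform_eventually)
    qed
    then show "(\<lambda>n. U (u n) \<omega>) \<longlonglongrightarrow> V \<omega>" "(\<lambda>n. U (u n) \<omega>) \<longlonglongrightarrow> V \<omega>"
      if "\<omega> \<in> path_space" "0 < T" "T \<le> t" "\<omega> T = y" "\<And>v. 0 \<le> v \<Longrightarrow> v < T \<Longrightarrow> \<omega> v < y"
        "\<And>n. T \<le> u n \<and> u n \<le> t" "u \<longlonglongrightarrow> T" for \<omega> u T
      using that by blast+
  qed
  have eq: "(if \<forall>u\<in>{0..t}. \<omega> u < y then 0 else Y \<omega> * V \<omega>) = e * hit_weight y l e \<omega>" for \<omega>
    by (simp add: Y_def V_def hit_weight_def t_def z_def)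
  have m: "(\<lambda>\<omega>. e * hit_weight y l e \<omega>) \<in> borel_measurable P" using os unfolding eq by blast
  then have "(\<lambda>\<omega>. (1 / e) * (e * hit_weight y l e \<omega>)) \<in> borel_measurable P" by measurable
  then show "hit_weight y l e \<in> borel_measurable P" using e by simp
  have rs: "run_sup t \<in> borel_measurable P" by (rule measurable_P[OF measurable_run_sup[OF t]])
  note [measurable] = this
  have "(\<integral>\<omega>. (if y \<le> run_sup t \<omega> \<and> run_sup t \<omega> < y + e then cyl_fn l \<omega> * (y + e - \<omega> t) else 0) \<partial>P) =
    (\<integral>\<omega>. (if \<forall>u\<in>{0..t}. \<omega> u < y then 0 else Y \<omega> * \<zeta> \<omega>) \<partial>P)"
  proof (rule integral_cong_AE)
    show "AE \<omega> in P. (if y \<le> run_sup t \<omega> \<and> run_sup t \<omega> < y + e then cyl_fn l \<omega> * (y + e - \<omega> t) else 0) =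
      (if \<forall>u\<in>{0..t}. \<omega> u < y then 0 else Y \<omega> * \<zeta> \<omega>)"
      using AE_start AE_space
    proof eventually_elim
      fix \<omega> assume "\<omega> 0 = 0" "\<omega> \<in> space P"
      then show "(if y \<le> run_sup t \<omega> \<and> run_sup t \<omega> < y + e then cyl_fn l \<omega> * (y + e - \<omega> t) else 0) =
        (if \<forall>u\<in>{0..t}. \<omega> u < y then 0 else Y \<omega> * \<zeta> \<omega>)"
        using run_sup_less_iff[of \<omega> t, OF _ t, symmetric] y
        by (simp add: Y_def \<zeta>_def z_def not_less[symmetric])
    qed
    show "(\<lambda>\<omega>. if \<forall>u\<in>{0..t}. \<omega> u < y then 0 else Y \<omega> * \<zeta> \<omega>) \<in> borel_measurable P"
      using measurable_P[OF Ym] \<zeta>m t by measurable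
    show "(\<lambda>\<omega>. if y \<le> run_sup t \<omega> \<and> run_sup t \<omega> < y + e then cyl_fn l \<omega> * (y + e - \<omega> t) else 0) \<in> borel_measurable P"
      using t by measurable
  qed
  also have "\<dots> = (\<integral>\<omega>. e * hit_weight y l e \<omega> \<partial>P)" using os unfolding eq by blast
  finally show "(\<integral>\<omega>. (if y \<le> run_sup t \<omega> \<and> run_sup t \<omega> < y + e then cyl_fn l \<omega> * (y + e - \<omega> t) else 0) \<partial>P) =
      e * (\<integral>\<omega>. hit_weight y l e \<omega> \<partial>P)" by simp
qed

text \<open>\<open>level_crossing\<close> works with e > 0 only, so e = 0 is reached as a pointwise
  limit.\<close>

lemma measurable_hit_weight_0:
  assumes l: "cyl_from 0 l" "l \<noteq> []" and y: "0 < y"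
  shows "hit_weight y l 0 \<in> borel_measurable P"
proof (rule borel_measurable_LIMSEQ_real)
  show "(\<lambda>n. hit_weight y l (1 / real (Suc n)) \<omega>) \<longlonglongrightarrow> hit_weight y l 0 \<omega>" for \<omega>
    by (rule hit_weight_tendsto[OF l(1)]) (rule LIMSEQ_Suc[OF lim_1_over_n])
  show "hit_weight y l (1 / real (Suc n)) \<in> borel_measurable P" for n
    by (rule level_crossing(1)[OF l y]) simp
qed

lemma integral_hit_weight_tendsto:
  assumes l: "cyl_from 0 l" "l \<noteq> []" and y: "0 < y" and en: "\<And>n. 0 < en n" "en \<longlonglongrightarrow> 0"
  shows "(\<lambda>n. \<integral>\<omega>. hit_weight y l (en n) \<omega> \<partial>P) \<longlonglongrightarrow> (\<integral>\<omega>. hit_weight y l 0 \<omega> \<partial>P)"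
proof (rule integral_dominated_convergence[where w="\<lambda>_. 1"])
  show "AE \<omega> in P. (\<lambda>n. hit_weight y l (en n) \<omega>) \<longlonglongrightarrow> hit_weight y l 0 \<omega>"
    by (rule AE_I2, rule hit_weight_tendsto[OF l(1) en(2)])
  show "AE \<omega> in P. norm (hit_weight y l (en n) \<omega>) \<le> 1" for n
    using hit_weight_bounds[OF l(1)] by simp
qed (use measurable_hit_weight_0[OF l y] level_crossing(1)[OF l y en(1)] in auto)

end

section \<open>Brownian motion continued by a Bessel process\<close>

lemma stopped_path_before:
  assumes "0 \<le> t" "ereal t \<le> hit_time y \<omega>"
  shows "stopped_path y \<omega> t = \<omega> t"
  using assms by (simp add: stopped_path_def min_absorb1)

text \<open>Stopping changes the path only after T_y, when y has already been visited; so T_y can be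
  read from the stopped path alone.\<close>

lemma hit_time_stopped_path:
  assumes w: "\<omega> \<in> path_space"
  shows "hit_time y (stopped_path y \<omega>) = hit_time y \<omega>"
proof (rule antisym)
  show "hit_time y (stopped_path y \<omega>) \<le> hit_time y \<omega>"
  proof (cases "hit_time y \<omega> < \<infinity>")
    case True
    then obtain T where T: "0 \<le> T" "hit_time y \<omega> = ereal T" "\<omega> T = y" using hit_time_attained[OF w] by blast
    then have "stopped_path y \<omega> T = y" using stopped_path_before[of T y \<omega>] by simp
    then show ?thesis using hit_time_le[of T "stopped_path y \<omega>" y] T by simp
  next
    case False
    then show ?thesis by (simp add: not_less top_unique)
  qed
  show "hit_time y \<omega> \<le> hit_time y (stopped_path y \<omega>)"
    unfolding hit_time_def[of y "stopped_path y \<omega>"]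
  proof (rule INF_greatest)
    fix t assume t: "t \<in> {t. 0 \<le> t \<and> stopped_path y \<omega> t = y}"
    show "hit_time y \<omega> \<le> ereal t"
    proof (rule ccontr)
      assume *: "\<not> hit_time y \<omega> \<le> ereal t"
      then have "\<omega> t = y" using stopped_path_before[of t y \<omega>] t by simp
      then show False using hit_time_le[of t \<omega> y] t * by simp
    qed
  qed
qed

text \<open>Recovers a cylinder functional from the stopped path \<open>a\<close> and the
  continuation \<open>b\<close>, the two independent parts under Q^y. The hitting time is read from
  \<open>a\<close>. With \<open>max 0\<close> the evaluation time of \<open>b\<close> is nonnegative
  for all \<open>a\<close>, on which measurability over the whole product space relies.\<close>

definition split_fn :: "real \<Rightarrow> cyl \<Rightarrow> (real \<Rightarrow> real) \<Rightarrow> (real \<Rightarrow> real) \<Rightarrow> real" where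
  "split_fn y l a b = (\<Prod>p\<leftarrow>l. if ereal (fst p) \<le> hit_time y a then snd p (a (fst p))
     else snd p (y - b (max 0 (fst p - real_of_ereal (hit_time y a)))))"

lemma split_fn_simps [simp]:
  "split_fn y [] a b = 1"
  "split_fn y (p # l) a b = (if ereal (fst p) \<le> hit_time y a then snd p (a (fst p))
     else snd p (y - b (max 0 (fst p - real_of_ereal (hit_time y a))))) * split_fn y l a b"
  by (simp_all add: split_fn_def)

lemma split_fn_bounds: "cyl_from q l \<Longrightarrow> 0 \<le> split_fn y l a b \<and> split_fn y l a b \<le> 1"
proof (induction l arbitrary: q)
  case (Cons p l)
  then have t: "test_fn (snd p)" and cl: "cyl_from (fst p) l" by auto
  show ?case using Cons.IH[OF cl] test_fnD(2,3)[OF t] by (auto intro: mult_le_one)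
qed simp

lemma measurable_split_fn:
  "0 \<le> q \<Longrightarrow> cyl_from q l \<Longrightarrow> (\<lambda>(a, b). split_fn y l a b) \<in> borel_measurable (canon_inf \<Otimes>\<^sub>M canon_inf)"
proof (induction l arbitrary: q)
  case (Cons p l)
  then have t: "test_fn (snd p)" and cl: "cyl_from (fst p) l" and p: "0 \<le> fst p" by auto
  note [measurable] = measurable_hit_time test_fnD(4)[OF t]
  have [measurable]: "(\<lambda>x. split_fn y l (fst x) (snd x)) \<in> borel_measurable (canon_inf \<Otimes>\<^sub>M canon_inf)"
    using Cons.IH[OF p cl] by (simp add: case_prod_unfold)
  have [measurable]: "(\<lambda>x. fst x (fst p)) \<in> borel_measurable (canon_inf \<Otimes>\<^sub>M canon_inf)"
    by (rule measurable_compose[OF measurable_fst measurable_coord]) (use p in simp)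
  have [measurable]: "(\<lambda>x. snd x (max 0 (fst p - real_of_ereal (hit_time y (fst x))))) \<in> borel_measurable (canon_inf \<Otimes>\<^sub>M canon_inf)"
    by (rule measurable_path_eval) auto
  show ?case unfolding split_fn_simps case_prod_unfold by measurable
qed (simp add: case_prod_unfold)

lemma split_fn_stopped_post:
  assumes w: "\<omega> \<in> path_space"
  shows "0 \<le> q \<Longrightarrow> cyl_from q l \<Longrightarrow> split_fn y l (stopped_path y \<omega>) (post_path y \<omega>) = cyl_fn l \<omega>"
proof (induction l arbitrary: q)
  case (Cons p l)
  then have cl: "cyl_from (fst p) l" and p: "0 \<le> fst p" by auto
  have "(if ereal (fst p) \<le> hit_time y \<omega> then snd p (stopped_path y \<omega> (fst p))
     else snd p (y - post_path y \<omega> (max 0 (fst p - real_of_ereal (hit_time y \<omega>))))) = snd p (\<omega> (fst p))"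
  proof (cases "ereal (fst p) \<le> hit_time y \<omega>")
    case True
    then show ?thesis using stopped_path_before[OF p True] by simp
  next
    case False
    then have fin: "hit_time y \<omega> < \<infinity>" by auto
    then obtain T where T: "0 \<le> T" "hit_time y \<omega> = ereal T" using hit_time_attained[OF w] by blast
    then show ?thesis using False by (simp add: post_path_def max_def)
  qed
  then show ?case
    unfolding split_fn_simps cyl_fn_simps hit_time_stopped_path[OF w] Cons.IH[OF p cl] by simp
qed simp

context wiener_space
begin

definition bes_path :: "(real \<Rightarrow> real) \<times> (real \<Rightarrow> real) \<times> (real \<Rightarrow> real) \<Rightarrow> real \<Rightarrow> real" where
  "bes_path = (\<lambda>(\<alpha>, \<beta>, \<gamma>). \<lambda>t\<in>{0..}. sqrt ((\<alpha> t)\<^sup>2 + (\<beta> t)\<^sup>2 + (\<gamma> t)\<^sup>2))"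

lemma bes_path_apply: "0 \<le> t \<Longrightarrow> bes_path (\<alpha>, \<beta>, \<gamma>) t = sqrt ((\<alpha> t)\<^sup>2 + (\<beta> t)\<^sup>2 + (\<gamma> t)\<^sup>2)"
  by (simp add: bes_path_def)

lemma measurable_bes_path: "bes_path \<in> P3 \<rightarrow>\<^sub>M canon_inf"
proof (rule measurable_coord_algebraI)
  fix x assume "x \<in> space P3"
  then obtain \<alpha> \<beta> \<gamma> where x: "x = (\<alpha>, \<beta>, \<gamma>)" and sp: "\<alpha> \<in> path_space" "\<beta> \<in> path_space" "\<gamma> \<in> path_space"
    by (auto simp: space_pair_measure)
  have "continuous_on {0..} (\<lambda>t. sqrt ((\<alpha> t)\<^sup>2 + (\<beta> t)\<^sup>2 + (\<gamma> t)\<^sup>2))"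
    by (intro continuous_intros path_continuous_on sp)
  then have "continuous_on {0..} (bes_path x)"
    by (rule continuous_on_eq) (simp add: x bes_path_apply)
  then show "bes_path x \<in> path_space" by (auto simp: path_space_def x bes_path_def)
next
  fix s :: real assume s: "s \<in> {0..}"
  have "(\<lambda>x. bes_path x s) = (\<lambda>(\<alpha>, \<beta>, \<gamma>). sqrt ((0 + \<alpha> s)\<^sup>2 + (\<beta> s)\<^sup>2 + (\<gamma> s)\<^sup>2))"
    using s by (auto simp: bes_path_apply)
  also have "\<dots> \<in> borel_measurable P3"
    by (rule measurable_bes_integrand[of s "\<lambda>x. x"]) (use s in auto)
  finally show "(\<lambda>x. bes_path x s) \<in> borel_measurable P3" .
qed

lemma bessel3_law_eq: "bessel3_law P = distr P3 canon_inf bes_path"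
  by (simp add: bessel3_law_def bes_path_def)

lemma glue_all: "cyl_from q l \<Longrightarrow> last_time q l \<le> s \<Longrightarrow> glue z l s \<omega> a = cyl_fn l \<omega>"
proof (induction l arbitrary: q)
  case (Cons p l)
  then have cl: "cyl_from (fst p) l" and le: "last_time (fst p) l \<le> s" by auto
  then have "fst p \<le> s" using last_time_ge[OF cl] by simp
  then show ?case using Cons.IH[OF cl le] by simp
qed simp

lemma split_fn_after:
  assumes "hit_time y a = ereal T"
  shows "T < q \<Longrightarrow> cyl_from q l \<Longrightarrow>
    split_fn y l a (bes_path (\<alpha>, \<beta>, \<gamma>)) =
      cyl_fn l (\<lambda>t. y - sqrt ((\<alpha> (t - T))\<^sup>2 + (\<beta> (t - T))\<^sup>2 + (\<gamma> (t - T))\<^sup>2))"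
proof (induction l arbitrary: q)
  case (Cons p l)
  then have cl: "cyl_from (fst p) l" and p: "T < fst p" by auto
  then show ?case using Cons.IH[OF p cl] assms by (simp add: bes_path_apply max_def)
qed simp

text \<open>Factors at times up to T are constants of the integral. From the first factor beyond T
  on, only the Bessel path is involved, and its finite-dimensional laws give \<open>bes_ker\<close>
  at radius 0.\<close>

lemma integral_split_fn:
  assumes w: "\<omega> \<in> path_space" and T: "hit_time y \<omega> = ereal T" "0 \<le> T"
  shows "0 \<le> q \<Longrightarrow> cyl_from q l \<Longrightarrow>
    (\<integral>x. split_fn y l (stopped_path y \<omega>) (bes_path x) \<partial>P3) = glue y l T \<omega> 0"
proof (induction l arbitrary: q)
  case Nil
  then show ?case using PPP.P.prob_space by simp
next
  case (Cons p l)
  then have t: "test_fn (snd p)" and cl: "cyl_from (fst p) l" and p: "0 \<le> fst p" by auto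
  have hs: "hit_time y (stopped_path y \<omega>) = ereal T" using hit_time_stopped_path[OF w] T by simp
  show ?case
  proof (cases "fst p \<le> T")
    case True
    then have "stopped_path y \<omega> (fst p) = \<omega> (fst p)" using stopped_path_before[OF p] T by simp
    then show ?thesis using True Cons.IH[OF p cl] hs by simp
  next
    case False
    have "cyl_from (fst p) (p # l)" using t cl by simp
    from split_fn_after[OF hs _ this] False
    have "(\<integral>x. split_fn y (p # l) (stopped_path y \<omega>) (bes_path x) \<partial>P3) =
      (\<integral>(\<alpha>, \<beta>, \<gamma>). cyl_fn (p # l) (\<lambda>t. y - sqrt ((\<alpha> (t - T))\<^sup>2 + (\<beta> (t - T))\<^sup>2 + (\<gamma> (t - T))\<^sup>2)) \<partial>P3)"
      by (intro Bochner_Integration.integral_cong) (auto simp del: split_fn_simps cyl_fn_simps)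
    also have "\<dots> = bes_ker y (p # l) T 0"
      by (rule bes_fdd_start[OF T(2)]) (use t cl False in simp)
    finally show ?thesis using False by (simp del: split_fn_simps bes_ker.simps)
  qed
qed

lemma integral_split_fn_infinite:
  assumes w: "\<omega> \<in> path_space" and T: "hit_time y \<omega> = \<infinity>"
  shows "0 \<le> q \<Longrightarrow> cyl_from q l \<Longrightarrow> split_fn y l (stopped_path y \<omega>) b = cyl_fn l \<omega>"
proof (induction l arbitrary: q)
  case (Cons p l)
  then have cl: "cyl_from (fst p) l" and p: "0 \<le> fst p" by auto
  have "stopped_path y \<omega> (fst p) = \<omega> (fst p)" using stopped_path_before[OF p] T by simp
  then show ?case using Cons.IH[OF p cl] T hit_time_stopped_path[OF w] by simp
qed simp

text \<open>Independence under Q^y allows Fubini with the Bessel path inside and the stopped path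
  outside, and the law of the latter may be taken under \<open>P\<close>. The two terms collect the
  paths that have not reached y by the last time and those that have.\<close>

lemma Q_level_cyl:
  assumes Q: "is_Q_level P y Q" and y: "0 < y" and l: "cyl_from 0 l" "l \<noteq> []"
  shows "(\<integral>\<omega>. cyl_fn l \<omega> \<partial>Q) =
    (\<integral>\<omega>. (if run_sup (last_time 0 l) \<omega> < y then cyl_fn l \<omega> else 0) \<partial>P) + (\<integral>\<omega>. hit_weight y l 0 \<omega> \<partial>P)"
proof -
  let ?t = "last_time 0 l"
  have t: "0 \<le> ?t" by (rule last_time_ge[OF l(1)])
  interpret Q: prob_space Q using Q by (simp add: is_Q_level_def)
  have sQ[measurable_cong]: "sets Q = sets canon_inf" using Q by (simp add: is_Q_level_def)
  have spQ: "space Q = path_space" using sets_eq_imp_space_eq[OF sQ] by simp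
  have ind: "Q.indep_var canon_inf (stopped_path y) canon_inf (post_path y)"
    using Q by (simp add: is_Q_level_def)
  have rv1: "stopped_path y \<in> Q \<rightarrow>\<^sub>M canon_inf" and rv2: "post_path y \<in> Q \<rightarrow>\<^sub>M canon_inf"
    using Q.indep_var_rv1[OF ind] Q.indep_var_rv2[OF ind] .
  \<comment> \<open>Measurability depends on the sigma-algebra only, which \<open>Q\<close> and
    \<open>P\<close> share; so it can be taken from the independence statement.\<close>
  have rvP: "stopped_path y \<in> P \<rightarrow>\<^sub>M canon_inf"
    using rv1 unfolding measurable_cong_sets[OF sQ refl] measurable_cong_sets[OF sets_P refl] .
  have d1: "distr Q canon_inf (stopped_path y) = distr P canon_inf (stopped_path y)"
    and d2: "distr Q canon_inf (post_path y) = distr P3 canon_inf bes_path"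
    using Q by (simp_all add: is_Q_level_def bessel3_law_eq)
  let ?D1 = "distr P canon_inf (stopped_path y)" and ?D2 = "distr P3 canon_inf bes_path"
  have joint: "distr Q (canon_inf \<Otimes>\<^sub>M canon_inf) (\<lambda>\<omega>. (stopped_path y \<omega>, post_path y \<omega>)) = ?D1 \<Otimes>\<^sub>M ?D2"
    using ind unfolding Q.indep_var_distribution_eq d1 d2 by simp
  interpret D1: prob_space ?D1 by (rule prob_space_distr[OF rvP])
  interpret D2: prob_space ?D2 by (rule PPP.P.prob_space_distr[OF measurable_bes_path])
  interpret DD: pair_prob_space ?D1 ?D2 by unfold_locales
  note m = measurable_split_fn[OF order_refl l(1), of y]
  have mD: "(\<lambda>(a, b). split_fn y l a b) \<in> borel_measurable (?D1 \<Otimes>\<^sub>M ?D2)"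
    using m by (simp cong: measurable_cong_sets sets_pair_measure_cong)
  have mDin: "(\<lambda>a. \<integral>b. split_fn y l a b \<partial>?D2) \<in> borel_measurable canon_inf"
    by (rule D2.borel_measurable_lebesgue_integral) (use m in \<open>simp cong: measurable_cong_sets sets_pair_measure_cong\<close>)
  have pull_back: "(\<integral>b. split_fn y l (stopped_path y \<omega>) b \<partial>?D2) = (\<integral>x. split_fn y l (stopped_path y \<omega>) (bes_path x) \<partial>P3)"
    if "\<omega> \<in> space P" for \<omega>
  proof -
    have "stopped_path y \<omega> \<in> space canon_inf" by (rule measurable_space[OF rvP that])
    then have "split_fn y l (stopped_path y \<omega>) \<in> borel_measurable canon_inf"
      using measurable_Pair2[OF m] by simp
    from integral_distr[OF measurable_bes_path this] show ?thesis .
  qed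
  have "(\<integral>\<omega>. cyl_fn l \<omega> \<partial>Q) = (\<integral>\<omega>. (case (stopped_path y \<omega>, post_path y \<omega>) of (a, b) \<Rightarrow> split_fn y l a b) \<partial>Q)"
    by (rule Bochner_Integration.integral_cong[OF refl])
       (use split_fn_stopped_post[OF _ order_refl l(1)] spQ in auto)
  also have "\<dots> = (\<integral>x. (case x of (a, b) \<Rightarrow> split_fn y l a b) \<partial>(?D1 \<Otimes>\<^sub>M ?D2))"
    unfolding joint[symmetric] by (rule integral_distr[symmetric]) (use rv1 rv2 m in auto)
  also have "\<dots> = (\<integral>a. (\<integral>b. split_fn y l a b \<partial>?D2) \<partial>?D1)"
  proof (rule DD.integral_fst[symmetric])
    show "integrable (?D1 \<Otimes>\<^sub>M ?D2) (\<lambda>(a, b). split_fn y l a b)"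
      by (rule DD.P.integrable_const_bound[where B=1]) (use split_fn_bounds[OF l(1)] mD in auto)
  qed
  also have "\<dots> = (\<integral>\<omega>. (\<integral>b. split_fn y l (stopped_path y \<omega>) b \<partial>?D2) \<partial>P)"
    by (rule integral_distr[OF rvP mDin])
  also have "\<dots> = (\<integral>\<omega>. (\<integral>x. split_fn y l (stopped_path y \<omega>) (bes_path x) \<partial>P3) \<partial>P)"
    by (rule Bochner_Integration.integral_cong[OF refl]) (rule pull_back)
  also have "\<dots> = (\<integral>\<omega>. (if run_sup ?t \<omega> < y then cyl_fn l \<omega> else 0) + hit_weight y l 0 \<omega> \<partial>P)"
  proof (rule integral_cong_AE)
    have "(\<lambda>\<omega>. \<integral>b. split_fn y l (stopped_path y \<omega>) b \<partial>?D2) \<in> borel_measurable P"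
      by (rule measurable_compose[OF rvP mDin])
    also have "?this \<longleftrightarrow> (\<lambda>\<omega>. \<integral>x. split_fn y l (stopped_path y \<omega>) (bes_path x) \<partial>P3) \<in> borel_measurable P"
      by (rule measurable_cong) (rule pull_back)
    finally show "(\<lambda>\<omega>. \<integral>x. split_fn y l (stopped_path y \<omega>) (bes_path x) \<partial>P3) \<in> borel_measurable P" .
    have [measurable]: "run_sup ?t \<in> borel_measurable P" "cyl_fn l \<in> borel_measurable P"
      by (rule measurable_P[OF measurable_run_sup[OF t]], rule measurable_P[OF measurable_cyl_fn[OF order_refl l(1)]])
    show "(\<lambda>\<omega>. (if run_sup ?t \<omega> < y then cyl_fn l \<omega> else 0) + hit_weight y l 0 \<omega>) \<in> borel_measurable P"
      using measurable_hit_weight_0[OF l y] by measurable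
    show "AE \<omega> in P. (\<integral>x. split_fn y l (stopped_path y \<omega>) (bes_path x) \<partial>P3) =
      (if run_sup ?t \<omega> < y then cyl_fn l \<omega> else 0) + hit_weight y l 0 \<omega>"
      using AE_start AE_space
    proof eventually_elim
      fix \<omega> assume w0: "\<omega> 0 = 0" and "\<omega> \<in> space P"
      then have w: "\<omega> \<in> path_space" by simp
      note below = run_sup_less_iff[OF w t, of y]
      show "(\<integral>x. split_fn y l (stopped_path y \<omega>) (bes_path x) \<partial>P3) =
        (if run_sup ?t \<omega> < y then cyl_fn l \<omega> else 0) + hit_weight y l 0 \<omega>"
      proof (cases "hit_time y \<omega>" rule: ereal_cases)
        case (real T)
        have T0: "0 \<le> T" using hit_time_nonneg[of y \<omega>] real by simp
        have e: "(\<integral>x. split_fn y l (stopped_path y \<omega>) (bes_path x) \<partial>P3) = glue y l T \<omega> 0"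
          by (rule integral_split_fn[OF w real T0 order_refl l(1)])
        show ?thesis
        proof (cases "run_sup ?t \<omega> < y")
          case True
          \<comment> \<open>y is reached, but only after the last time: \<open>glue\<close> then
            reads every factor from the path.\<close>
          then have "\<not> hit_time y \<omega> \<le> ereal ?t"
            unfolding hit_time_le_iff[OF w] below by force
          then have "?t \<le> T" using real by simp
          then have "glue y l T \<omega> 0 = cyl_fn l \<omega>" by (rule glue_all[OF l(1)])
          then show ?thesis using True e below by (simp add: hit_weight_def)
        next
          case False
          then have "\<not> (\<forall>u\<in>{0..?t}. \<omega> u < y)" using below by blast
          then show ?thesis unfolding hit_weight_def if_not_P[OF False] e using w0 y real by simp
        qed
      next
        case PInf
        have b: "run_sup ?t \<omega> < y"
        proof (rule ccontr)
          assume "\<not> run_sup ?t \<omega> < y"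
          then obtain T where "0 < T" "T \<le> ?t" "\<omega> T = y"
            using first_passage[OF w order_refl, of y ?t] below w0 y by metis
          then show False using hit_time_le[of T \<omega> y] PInf by simp
        qed
        have "(\<integral>x. split_fn y l (stopped_path y \<omega>) (bes_path x) \<partial>P3) = cyl_fn l \<omega>"
          using integral_split_fn_infinite[OF w PInf order_refl l(1)] PPP.P.prob_space by simp
        then show ?thesis using b below by (simp add: hit_weight_def)
      next
        case MInf
        then show ?thesis using hit_time_nonneg[of y \<omega>] by simp
      qed
    qed
  qed
  also have "\<dots> = (\<integral>\<omega>. (if run_sup ?t \<omega> < y then cyl_fn l \<omega> else 0) \<partial>P) + (\<integral>\<omega>. hit_weight y l 0 \<omega> \<partial>P)"
  proof (rule Bochner_Integration.integral_add)
    have [measurable]: "run_sup ?t \<in> borel_measurable P" "cyl_fn l \<in> borel_measurable P"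
      by (rule measurable_P[OF measurable_run_sup[OF t]], rule measurable_P[OF measurable_cyl_fn[OF order_refl l(1)]])
    show "integrable P (\<lambda>\<omega>. if run_sup ?t \<omega> < y then cyl_fn l \<omega> else 0)"
      by (rule integrable_const_bound[where B=1]) (use cyl_fn_bounds[OF l(1)] in auto)
    show "integrable P (hit_weight y l 0)"
      by (rule integrable_const_bound[where B=1]) (use hit_weight_bounds[OF l(1)] measurable_hit_weight_0[OF l y] in auto)
  qed
  finally show ?thesis .
qed

end

section \<open>Joint law with the running supremum\<close>

context wiener_space
begin

lemma AE_run_sup_nonneg: "0 \<le> t \<Longrightarrow> AE \<omega> in P. 0 \<le> run_sup t \<omega>"
  using AE_start AE_space by eventually_elim (metis le_run_sup order_refl space_P)

text \<open>Excludes a contribution from S = 0, which intervals (a, b] with a \<ge> 0 do not see. By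
  reflection at y > 0, a bounded odd version of y - X has the same expectation on the paths with S <
  y as on all paths, and that is at most y; then y tends to 0.\<close>

lemma AE_run_sup_zero:
  assumes t: "0 \<le> t"
  shows "AE \<omega> in P. run_sup t \<omega> = 0 \<longrightarrow> \<omega> t = 0"
proof -
  have rs[measurable]: "run_sup t \<in> borel_measurable P" by (rule measurable_P[OF measurable_run_sup[OF t]])
  have tP[measurable]: "(\<lambda>\<omega>. \<omega> t) \<in> borel_measurable P" using t by simp
  \<comment> \<open>y - x cut off at -1 and 1: bounded and continuous, still odd about y, and
    changing by at most y when the level drops from y to 0.\<close>
  define H where "H y x = max (- 1) (min 1 (y - x))" for y x :: real
  have Hb: "\<bar>H y x\<bar> \<le> 1" for y x by (auto simp: H_def)
  have Hc: "continuous_on UNIV (H y)" for y unfolding H_def by (intro continuous_intros)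
  have Hm[measurable]: "H y \<in> borel_measurable borel" for y by (rule borel_measurable_continuous_onI[OF Hc])
  define K where "K \<omega> = (if run_sup t \<omega> = 0 then max 0 (H 0 (\<omega> t)) else 0)" for \<omega>
  have Km[measurable]: "K \<in> borel_measurable P" unfolding K_def by measurable
  have Ki: "integrable P K"
    by (rule integrable_const_bound[where B=1]) (use Hb in \<open>auto simp: K_def H_def\<close>)
  have "(\<integral>\<omega>. K \<omega> \<partial>P) \<le> y" if y: "0 < y" for y
  proof -
    have [measurable]: "Measurable.pred P (\<lambda>\<omega>. \<forall>u\<in>{0..t}. \<omega> u < y)"
      by (rule measurable_P[OF pred_path_below[OF order_refl t]])
    have "(\<integral>\<omega>. K \<omega> \<partial>P) \<le> (\<integral>\<omega>. (if \<forall>u\<in>{0..t}. \<omega> u < y then 1 * H y (\<omega> t) else 0) \<partial>P)"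
    proof (rule integral_mono_AE[OF Ki])
      show "integrable P (\<lambda>\<omega>. if \<forall>u\<in>{0..t}. \<omega> u < y then 1 * H y (\<omega> t) else 0)"
        by (rule integrable_const_bound[where B=1]) (use Hb in auto)
      show "AE \<omega> in P. K \<omega> \<le> (if \<forall>u\<in>{0..t}. \<omega> u < y then 1 * H y (\<omega> t) else 0)"
      proof (rule AE_I2)
        fix \<omega> assume "\<omega> \<in> space P"
        then have w: "\<omega> \<in> path_space" by simp
        show "K \<omega> \<le> (if \<forall>u\<in>{0..t}. \<omega> u < y then 1 * H y (\<omega> t) else 0)"
        proof (cases "\<forall>u\<in>{0..t}. \<omega> u < y")
          case True
          then have "\<omega> t < y" using t by simp
          then show ?thesis using True y by (auto simp: K_def H_def)
        next
          case False
          then have "run_sup t \<omega> \<noteq> 0" using run_sup_less_iff[OF w t, of y] y by auto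
          then show ?thesis unfolding if_not_P[OF False] by (simp add: K_def)
        qed
      qed
    qed
    also have "\<dots> = (\<integral>\<omega>. (if \<omega> 0 < y then 1 * (\<integral>w. H y (\<omega> 0 + w (t - 0)) \<partial>P) else 0) \<partial>P)"
    proof (rule reflection_principle[OF order_refl t _ _ Hc Hb])
      show "H y (2 * y - x) = - H y x" for x by (auto simp: H_def max_def min_def)
    qed auto
    also have "\<dots> = (\<integral>\<omega>. (\<integral>w. H y (w t) \<partial>P) \<partial>P)"
    proof (rule integral_cong_AE)
      show "AE \<omega> in P. (if \<omega> 0 < y then 1 * (\<integral>w. H y (\<omega> 0 + w (t - 0)) \<partial>P) else 0) = (\<integral>w. H y (w t) \<partial>P)"
        using AE_start by eventually_elim (use y in simp)
      have [measurable]: "(\<lambda>\<omega>. 1 * (\<integral>w. H y (\<omega> 0 + w (t - 0)) \<partial>P)) \<in> borel_measurable P"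
        unfolding mult_1 diff_zero
        by (rule measurable_compose[OF measurable_coord_P measurable_heat[OF t Hm]]) simp
      show "(\<lambda>\<omega>. if \<omega> 0 < y then 1 * (\<integral>w. H y (\<omega> 0 + w (t - 0)) \<partial>P) else 0) \<in> borel_measurable P"
        by measurable
    qed simp
    also have "\<dots> = (\<integral>w. H y (w t) \<partial>P)" using prob_space by simp
    also have "\<dots> \<le> (\<integral>w. H 0 (w t) + y \<partial>P)"
    proof (rule integral_mono)
      show "integrable P (\<lambda>w. H y (w t))" by (rule integrable_const_bound[where B=1]) (use Hb in auto)
      have "integrable P (\<lambda>w. H 0 (w t))" by (rule integrable_const_bound[where B=1]) (use Hb in auto)
      then show "integrable P (\<lambda>w. H 0 (w t) + y)" by simp
    qed (use y in \<open>auto simp: H_def\<close>)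
    also have "\<dots> = (\<integral>w. H 0 (w t) \<partial>P) + y"
    proof -
      have "integrable P (\<lambda>w. H 0 (w t))" by (rule integrable_const_bound[where B=1]) (use Hb in auto)
      then show ?thesis using prob_space by simp
    qed
    also have "(\<integral>w. H 0 (w t) \<partial>P) = 0"
      by (rule integral_odd_coord[OF t Hm]) (auto simp: H_def max_def min_def)
    finally show ?thesis by simp
  qed
  then have "(\<integral>\<omega>. K \<omega> \<partial>P) \<le> 0" by (rule dense_ge)
  moreover have "0 \<le> (\<integral>\<omega>. K \<omega> \<partial>P)" by (rule Bochner_Integration.integral_nonneg) (auto simp: K_def)
  ultimately have "(\<integral>\<omega>. K \<omega> \<partial>P) = 0" by simp
  moreover have "AE \<omega> in P. 0 \<le> K \<omega>" by (simp add: K_def)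
  ultimately have "AE \<omega> in P. K \<omega> = 0"
    using integral_nonneg_eq_0_iff_AE[OF Ki] by blast
  then show ?thesis using AE_space
  proof eventually_elim
    fix \<omega> assume K: "K \<omega> = 0" and "\<omega> \<in> space P"
    then have "\<omega> t \<le> run_sup t \<omega>" using le_run_sup[of \<omega> t t] t by simp
    then show "run_sup t \<omega> = 0 \<longrightarrow> \<omega> t = 0" using K by (auto simp: K_def H_def max_def min_def split: if_splits)
  qed
qed

lemma nn_integral_window:
  fixes s e c :: real
  assumes "0 < e"
  shows "(\<integral>\<^sup>+y. indicator {s - e<..s} y * ennreal (c / e) \<partial>lborel) = ennreal c"
proof -
  have "(\<integral>\<^sup>+y. indicator {s - e<..s} y * ennreal (c / e) \<partial>lborel) = ennreal (c / e) * ennreal e"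
    using assms by (subst nn_integral_multc) (auto simp: mult.commute)
  also have "\<dots> = ennreal c"
  proof (cases "0 \<le> c")
    case True
    then show ?thesis using assms by (simp add: ennreal_mult[symmetric])
  next
    case False
    then have "c / e \<le> 0" "c \<le> 0" using assms by (auto simp: divide_nonpos_pos)
    then show ?thesis by (simp add: ennreal_neg)
  qed
  finally show ?thesis .
qed

section \<open>Averaging over windows of levels\<close>

context
  fixes l :: cyl and t :: real
  assumes l: "cyl_from 0 l" "l \<noteq> []" and t_def: "t = last_time 0 l"
begin

lemma cyl_end_nonneg: "0 \<le> t" unfolding t_def by (rule last_time_ge[OF l(1)])

lemma measurable_run_sup_P [measurable]: "run_sup t \<in> borel_measurable P"
  by (rule measurable_P[OF measurable_run_sup[OF cyl_end_nonneg]])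

lemma measurable_cyl_P [measurable]: "cyl_fn l \<in> borel_measurable P"
  by (rule measurable_P[OF measurable_cyl_fn[OF order_refl l(1)]])

lemma measurable_end_P [measurable]: "(\<lambda>\<omega>. \<omega> t) \<in> borel_measurable P"
  using cyl_end_nonneg by simp

text \<open>The integrand of \<open>level_crossing\<close> divided by e, arranged for Tonelli. For
  fixed y the indicator says y \<le> S < y + e; for a fixed path it is an interval of levels of
  length e that ends at S.\<close>

definition window :: "real \<Rightarrow> real \<Rightarrow> (real \<Rightarrow> real) \<Rightarrow> ennreal" where
  "window e y \<omega> = ennreal (cyl_fn l \<omega>) *
    (indicator {run_sup t \<omega> - e<..run_sup t \<omega>} y * ennreal ((y + e - \<omega> t) / e))"

lemma measurable_window: "(\<lambda>(y, \<omega>). window e y \<omega>) \<in> borel_measurable (lborel \<Otimes>\<^sub>M P)"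
proof -
  have "(\<lambda>(y, \<omega>). ennreal (cyl_fn l \<omega>) *
    ((if run_sup t \<omega> - e < y \<and> y \<le> run_sup t \<omega> then 1 else 0) * ennreal ((y + e - \<omega> t) / e))) \<in> borel_measurable (lborel \<Otimes>\<^sub>M P)"
    unfolding case_prod_unfold by measurable
  also have "(\<lambda>(y, \<omega>). ennreal (cyl_fn l \<omega>) *
    ((if run_sup t \<omega> - e < y \<and> y \<le> run_sup t \<omega> then 1 else 0) * ennreal ((y + e - \<omega> t) / e))) = (\<lambda>(y, \<omega>). window e y \<omega>)"
    by (auto simp: window_def indicator_def fun_eq_iff)
  finally show ?thesis .
qed

lemma nn_integral_window_eq:
  assumes y: "0 < y" and e: "0 < e"
  shows "(\<integral>\<^sup>+\<omega>. window e y \<omega> \<partial>P) = ennreal (\<integral>\<omega>. hit_weight y l e \<omega> \<partial>P)"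
proof -
  let ?f = "\<lambda>\<omega>. if y \<le> run_sup t \<omega> \<and> run_sup t \<omega> < y + e then cyl_fn l \<omega> * (y + e - \<omega> t) else 0"
  obtain C where C: "\<And>\<omega>. \<bar>cyl_fn l \<omega> * (y + e - \<omega> t)\<bar> \<le> C"
    using cyl_weight_bounded[OF l] unfolding t_def by blast
  have C0: "0 \<le> C" using C[of undefined] by linarith
  have int: "integrable P (\<lambda>\<omega>. ?f \<omega> / e)"
  proof (rule integrable_divide, rule integrable_const_bound[where B=C])
    show "AE \<omega> in P. norm (?f \<omega>) \<le> C" using C C0 by auto
  qed measurable
  have nn: "0 \<le> ?f \<omega>" if "\<omega> \<in> path_space" for \<omega>
    using le_run_sup[OF that cyl_end_nonneg order_refl] cyl_fn_bounds[OF l(1)] by auto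
  have "(\<integral>\<^sup>+\<omega>. window e y \<omega> \<partial>P) = (\<integral>\<^sup>+\<omega>. ennreal (?f \<omega> / e) \<partial>P)"
  proof (rule nn_integral_cong)
    fix \<omega> assume "\<omega> \<in> space P"
    show "window e y \<omega> = ennreal (?f \<omega> / e)"
      unfolding window_def using cyl_fn_bounds[OF l(1), of \<omega>] e
      by (auto simp: indicator_def ennreal_mult'[symmetric])
  qed
  also have "\<dots> = ennreal (\<integral>\<omega>. ?f \<omega> / e \<partial>P)"
    by (rule nn_integral_eq_integral[OF int], rule AE_I2, rule divide_nonneg_pos[OF nn e]) simp
  also have "(\<integral>\<omega>. ?f \<omega> / e \<partial>P) = (\<integral>\<omega>. hit_weight y l e \<omega> \<partial>P)"
    using level_crossing(2)[OF l y e] e unfolding t_def by simp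
  finally show ?thesis .
qed

lemma integral_hit_weight_bounds:
  shows "0 \<le> (\<integral>\<omega>. hit_weight y l e \<omega> \<partial>P)" "(\<integral>\<omega>. hit_weight y l e \<omega> \<partial>P) \<le> 1"
proof -
  show "0 \<le> (\<integral>\<omega>. hit_weight y l e \<omega> \<partial>P)"
    by (rule Bochner_Integration.integral_nonneg) (use hit_weight_bounds[OF l(1)] in auto)
  show "(\<integral>\<omega>. hit_weight y l e \<omega> \<partial>P) \<le> 1"
  proof (cases "integrable P (hit_weight y l e)")
    case True
    then have "(\<integral>\<omega>. hit_weight y l e \<omega> \<partial>P) \<le> (\<integral>\<omega>. 1 \<partial>P)"
      by (intro integral_mono) (use hit_weight_bounds[OF l(1)] in auto)
    then show ?thesis using prob_space by simp
  qed (simp add: not_integrable_integral_eq)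
qed

text \<open>Density of the measure E [F (S - X); S in dy]; by \<open>Q_level_cyl\<close> it is also
  the part of the Q^y-expectation of F that comes from paths reaching y by time t.\<close>

definition run_sup_density :: "real \<Rightarrow> ennreal" where
  "run_sup_density y = indicator {0<..} y * ennreal (\<integral>\<omega>. hit_weight y l 0 \<omega> \<partial>P)"

lemma window_tendsto:
  assumes y: "0 < y"
  shows "(\<lambda>n. \<integral>\<^sup>+\<omega>. window (1 / real (Suc n)) y \<omega> \<partial>P) \<longlonglongrightarrow> ennreal (\<integral>\<omega>. hit_weight y l 0 \<omega> \<partial>P)"
proof -
  have "(\<lambda>n. \<integral>\<omega>. hit_weight y l (1 / real (Suc n)) \<omega> \<partial>P) \<longlonglongrightarrow> (\<integral>\<omega>. hit_weight y l 0 \<omega> \<partial>P)"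
    by (rule integral_hit_weight_tendsto[OF l y _ LIMSEQ_Suc[OF lim_1_over_n]]) simp
  from tendsto_ennrealI[OF this] show ?thesis
    by (subst nn_integral_window_eq[OF y]) simp_all
qed

text \<open>\<open>hit_weight\<close> is controlled as a function of the path for each level
  separately. The windows are jointly measurable in level and path, so their integrals are
  measurable in y, and so is the limit.\<close>

lemma measurable_run_sup_density [measurable]: "run_sup_density \<in> borel_measurable borel"
proof -
  have m: "(\<lambda>y. \<integral>\<^sup>+\<omega>. window (1 / real (Suc n)) y \<omega> \<partial>P) \<in> borel_measurable lborel" for n
    by (rule borel_measurable_nn_integral[OF measurable_window])
  have "run_sup_density \<in> borel_measurable lborel"
  proof (rule borel_measurable_LIMSEQ_order)
    show "(\<lambda>y. indicator {0<..} y * (\<integral>\<^sup>+\<omega>. window (1 / real (Suc n)) y \<omega> \<partial>P)) \<in> borel_measurable lborel" for n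
      using m by measurable
    show "(\<lambda>n. indicator {0<..} y * (\<integral>\<^sup>+\<omega>. window (1 / real (Suc n)) y \<omega> \<partial>P)) \<longlonglongrightarrow> run_sup_density y" for y
    proof (cases "0 < y")
      case True
      then show ?thesis using window_tendsto[OF True] by (simp add: run_sup_density_def)
    qed (simp add: run_sup_density_def)
  qed
  then show ?thesis by simp
qed

text \<open>Both sides are limits of the same double integral of the window. Integrated over paths
  first, it tends to the density for each y; integrated over levels first, it is an average over a
  short interval ending at S and tends to F (S - X) if S lies in (a, b], and to 0 otherwise.\<close>

lemma nn_integral_run_sup_Ioc:
  assumes a: "0 \<le> a"
  shows "(\<integral>\<^sup>+\<omega>. ennreal (cyl_fn l \<omega> * (run_sup t \<omega> - \<omega> t)) * indicator {a<..b} (run_sup t \<omega>) \<partial>P) =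
    (\<integral>\<^sup>+y. run_sup_density y * indicator {a<..b} y \<partial>lborel)"
proof -
  let ?e = "\<lambda>n. 1 / real (Suc n)"
  define I where "I n \<omega> = (\<integral>\<^sup>+y. window (?e n) y \<omega> * indicator {a<..b} y \<partial>lborel)" for n \<omega>
  interpret L: pair_sigma_finite lborel P by unfold_locales
  have wm: "(\<lambda>x. window e (fst x) (snd x)) \<in> borel_measurable (lborel \<Otimes>\<^sub>M P)" for e
    using measurable_window by (simp add: case_prod_unfold)
  note [measurable] = wm
  have m2: "(\<lambda>(y, \<omega>). window (?e n) y \<omega> * indicator {a<..b} y) \<in> borel_measurable (lborel \<Otimes>\<^sub>M P)" for n
    unfolding case_prod_unfold by measurable
  have fub: "(\<integral>\<^sup>+\<omega>. I n \<omega> \<partial>P) = (\<integral>\<^sup>+y. (\<integral>\<^sup>+\<omega>. window (?e n) y \<omega> \<partial>P) * indicator {a<..b} y \<partial>lborel)" for n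
  proof -
    have "(\<integral>\<^sup>+\<omega>. I n \<omega> \<partial>P) = (\<integral>\<^sup>+y. (\<integral>\<^sup>+\<omega>. window (?e n) y \<omega> * indicator {a<..b} y \<partial>P) \<partial>lborel)"
      unfolding I_def by (rule L.Fubini'[OF m2])
    also have "\<dots> = (\<integral>\<^sup>+y. (\<integral>\<^sup>+\<omega>. window (?e n) y \<omega> \<partial>P) * indicator {a<..b} y \<partial>lborel)"
    proof (intro nn_integral_cong nn_integral_multc)
      show "window (?e n) y \<in> borel_measurable P" for y
        using measurable_Pair2[OF measurable_window, of y] by simp
    qed
    finally show ?thesis .
  qed
  have Im: "I n \<in> borel_measurable P" for n
    unfolding I_def
    by (rule lborel.borel_measurable_nn_integral) (use m2[of n, THEN measurable_pair_swap] in \<open>simp add: case_prod_unfold\<close>)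
  have right: "(\<lambda>n. \<integral>\<^sup>+\<omega>. I n \<omega> \<partial>P) \<longlonglongrightarrow> (\<integral>\<^sup>+y. run_sup_density y * indicator {a<..b} y \<partial>lborel)"
    unfolding fub
  proof (rule nn_integral_dominated_convergence[where w="indicator {a<..b}"])
    show "(\<lambda>y. (\<integral>\<^sup>+\<omega>. window (?e n) y \<omega> \<partial>P) * indicator {a<..b} y) \<in> borel_measurable lborel" for n
      using borel_measurable_nn_integral[OF measurable_window[of "?e n"]] by measurable
    show "AE y in lborel. (\<integral>\<^sup>+\<omega>. window (?e n) y \<omega> \<partial>P) * indicator {a<..b} y \<le> indicator {a<..b} y" for n
    proof (rule AE_I2)
      fix y show "(\<integral>\<^sup>+\<omega>. window (?e n) y \<omega> \<partial>P) * indicator {a<..b} y \<le> indicator {a<..b} y"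
      proof (cases "y \<in> {a<..b}")
        case True
        then have y: "0 < y" using a by simp
        show ?thesis using nn_integral_window_eq[OF y, of "?e n"] integral_hit_weight_bounds(2)[of y] True by simp
      qed simp
    qed
    show "AE y in lborel. (\<lambda>n. (\<integral>\<^sup>+\<omega>. window (?e n) y \<omega> \<partial>P) * indicator {a<..b} y) \<longlonglongrightarrow> run_sup_density y * indicator {a<..b} y"
    proof (rule AE_I2)
      fix y show "(\<lambda>n. (\<integral>\<^sup>+\<omega>. window (?e n) y \<omega> \<partial>P) * indicator {a<..b} y) \<longlonglongrightarrow> run_sup_density y * indicator {a<..b} y"
      proof (cases "y \<in> {a<..b}")
        case True
        then have y: "0 < y" using a by simp
        show ?thesis using window_tendsto[OF y] True y by (simp add: run_sup_density_def)
      qed simp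
    qed
    show "(\<integral>\<^sup>+y. indicator {a<..b} y \<partial>lborel) < \<infinity>"
      by (cases "a \<le> b") auto
    show "(\<lambda>y. run_sup_density y * indicator {a<..b} y) \<in> borel_measurable lborel"
      using measurable_run_sup_density by (intro borel_measurable_times_ennreal borel_measurable_indicator) simp_all
    show "(indicator {a<..b} :: real \<Rightarrow> ennreal) \<in> borel_measurable lborel"
      by (rule borel_measurable_indicator) simp
  qed
  have left: "(\<lambda>n. \<integral>\<^sup>+\<omega>. I n \<omega> \<partial>P) \<longlonglongrightarrow>
    (\<integral>\<^sup>+\<omega>. ennreal (cyl_fn l \<omega> * (run_sup t \<omega> - \<omega> t)) * indicator {a<..b} (run_sup t \<omega>) \<partial>P)"
  \<comment> \<open>Only levels y \<le> b count and e is at most 1, so y + e - X is at most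
    \<bar>b\<bar> + 1 + \<bar>X\<bar>, which is integrable; the length e of the window cancels the
    division.\<close>
  proof (rule nn_integral_dominated_convergence[where w="\<lambda>\<omega>. ennreal (\<bar>b\<bar> + 1 + \<bar>\<omega> t\<bar>)"])
    have "integrable P (\<lambda>\<omega>. \<bar>b\<bar> + 1 + \<bar>\<omega> t\<bar>)" using integrable_coord[OF cyl_end_nonneg] by simp
    then show "(\<integral>\<^sup>+\<omega>. ennreal (\<bar>b\<bar> + 1 + \<bar>\<omega> t\<bar>) \<partial>P) < \<infinity>"
      by (subst nn_integral_eq_integral) auto
    show "AE \<omega> in P. I n \<omega> \<le> ennreal (\<bar>b\<bar> + 1 + \<bar>\<omega> t\<bar>)" for n
    proof (rule AE_I2)
      fix \<omega>
      have "I n \<omega> \<le> (\<integral>\<^sup>+y. indicator {run_sup t \<omega> - ?e n<..run_sup t \<omega>} y * ennreal ((\<bar>b\<bar> + 1 + \<bar>\<omega> t\<bar>) / ?e n) \<partial>lborel)"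
        unfolding I_def
      proof (rule nn_integral_mono)
        fix y
        show "window (?e n) y \<omega> * indicator {a<..b} y \<le>
          indicator {run_sup t \<omega> - ?e n<..run_sup t \<omega>} y * ennreal ((\<bar>b\<bar> + 1 + \<bar>\<omega> t\<bar>) / ?e n)"
        proof (cases "y \<in> {a<..b} \<and> y \<in> {run_sup t \<omega> - ?e n<..run_sup t \<omega>}")
          case True
          have e1: "?e n \<le> 1" by simp
          have "ennreal (cyl_fn l \<omega>) * ennreal ((y + ?e n - \<omega> t) / ?e n) \<le> 1 * ennreal ((\<bar>b\<bar> + 1 + \<bar>\<omega> t\<bar>) / ?e n)"
          proof (intro mult_mono ennreal_leI divide_right_mono)
            show "ennreal (cyl_fn l \<omega>) \<le> 1" using cyl_fn_bounds[OF l(1), of \<omega>] by simp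
            have "y \<le> b" using True by simp
            then show "y + ?e n - \<omega> t \<le> \<bar>b\<bar> + 1 + \<bar>\<omega> t\<bar>"
              using e1 abs_ge_self[of b] abs_ge_minus_self[of "\<omega> t"] by linarith
          qed auto
          then show ?thesis using True by (simp add: window_def)
        next
          case False
          then have z0: "window (?e n) y \<omega> * indicator {a<..b} y = 0" by (auto simp: window_def indicator_def)
          show ?thesis unfolding z0 by (rule zero_le)
        qed
      qed
      also have "\<dots> = ennreal (\<bar>b\<bar> + 1 + \<bar>\<omega> t\<bar>)" by (rule nn_integral_window) simp
      finally show "I n \<omega> \<le> ennreal (\<bar>b\<bar> + 1 + \<bar>\<omega> t\<bar>)" .
    qed
    show "AE \<omega> in P. (\<lambda>n. I n \<omega>) \<longlonglongrightarrow>
      ennreal (cyl_fn l \<omega> * (run_sup t \<omega> - \<omega> t)) * indicator {a<..b} (run_sup t \<omega>)"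
    proof (rule AE_I2)
      fix \<omega> assume "\<omega> \<in> space P"
      then have w: "\<omega> \<in> path_space" by simp
      let ?S = "run_sup t \<omega>"
      have e0: "(\<lambda>n. ?e n) \<longlonglongrightarrow> 0" by (rule LIMSEQ_Suc[OF lim_1_over_n])
      have small: "\<forall>\<^sub>F n in sequentially. ?e n < d" if "0 < d" for d
        by (rule order_tendstoD(2)[OF e0 that])
      \<comment> \<open>The window lies to the left of S and includes it. Therefore intervals open
        on the left and closed on the right give the correct limit also at S = a and S = b.\<close>
      consider "?S \<le> a" | "a < ?S" "?S \<le> b" | "b < ?S" by linarith
      then show "(\<lambda>n. I n \<omega>) \<longlonglongrightarrow> ennreal (cyl_fn l \<omega> * (?S - \<omega> t)) * indicator {a<..b} ?S"
      proof cases
        case 1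
        then have z0: "window (?e n) y \<omega> * indicator {a<..b} y = 0" for n y
          by (auto simp: window_def indicator_def)
        have "I n \<omega> = 0" for n unfolding I_def z0 by simp
        then show ?thesis using 1 by simp
      next
        case 3
        have pos: "0 < ?S - b" using 3 by simp
        have "\<forall>\<^sub>F n in sequentially. 0 = I n \<omega>"
          using small[OF pos]
        proof eventually_elim
          fix n assume "?e n < ?S - b"
          then have z0: "window (?e n) y \<omega> * indicator {a<..b} y = 0" for y
            by (auto simp: window_def indicator_def)
          show "0 = I n \<omega>" unfolding I_def z0 by simp
        qed
        then have "(\<lambda>n. I n \<omega>) \<longlonglongrightarrow> 0" by (rule Lim_transform_eventually[OF tendsto_const])
        then show ?thesis using 3 by simp
      next
        case 2
        let ?F = "cyl_fn l \<omega>"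
        have F: "0 \<le> ?F" using cyl_fn_bounds[OF l(1), of \<omega>] by simp
        have SX: "0 \<le> ?S - \<omega> t" using le_run_sup[OF w cyl_end_nonneg order_refl] by simp
        have pos: "0 < ?S - a" using 2 by simp
        \<comment> \<open>For y in the window, y + e - X lies between S - X and S - X + e.\<close>
        have bounds: "\<forall>\<^sub>F n in sequentially. ennreal ?F * ennreal (?S - \<omega> t) \<le> I n \<omega> \<and>
          I n \<omega> \<le> ennreal ?F * ennreal (?S - \<omega> t + ?e n)"
          using small[OF pos]
        proof eventually_elim
          fix n assume e: "?e n < ?S - a"
          have e0: "0 < ?e n" by simp
          let ?W = "indicator {?S - ?e n<..?S} :: real \<Rightarrow> ennreal"
          have I: "I n \<omega> = ennreal ?F * (\<integral>\<^sup>+y. ?W y * ennreal ((y + ?e n - \<omega> t) / ?e n) \<partial>lborel)"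
          proof -
            have "window (?e n) y \<omega> * indicator {a<..b} y = ennreal ?F * (?W y * ennreal ((y + ?e n - \<omega> t) / ?e n))" for y
              unfolding window_def using e 2 by (auto simp: indicator_def)
            then show ?thesis unfolding I_def by (simp add: nn_integral_cmult)
          qed
          have "ennreal (?S - \<omega> t) = (\<integral>\<^sup>+y. ?W y * ennreal ((?S - \<omega> t) / ?e n) \<partial>lborel)"
            by (rule nn_integral_window[OF e0, symmetric])
          also have "\<dots> \<le> (\<integral>\<^sup>+y. ?W y * ennreal ((y + ?e n - \<omega> t) / ?e n) \<partial>lborel)"
            by (intro nn_integral_mono) (auto simp: indicator_def intro!: ennreal_leI divide_right_mono)
          finally have lo: "ennreal (?S - \<omega> t) \<le> (\<integral>\<^sup>+y. ?W y * ennreal ((y + ?e n - \<omega> t) / ?e n) \<partial>lborel)" .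
          have "(\<integral>\<^sup>+y. ?W y * ennreal ((y + ?e n - \<omega> t) / ?e n) \<partial>lborel) \<le>
            (\<integral>\<^sup>+y. ?W y * ennreal ((?S - \<omega> t + ?e n) / ?e n) \<partial>lborel)"
            by (intro nn_integral_mono) (auto simp: indicator_def intro!: ennreal_leI divide_right_mono)
          also have "\<dots> = ennreal (?S - \<omega> t + ?e n)" by (rule nn_integral_window[OF e0])
          finally have up: "(\<integral>\<^sup>+y. ?W y * ennreal ((y + ?e n - \<omega> t) / ?e n) \<partial>lborel) \<le> ennreal (?S - \<omega> t + ?e n)" .
          show "ennreal ?F * ennreal (?S - \<omega> t) \<le> I n \<omega> \<and> I n \<omega> \<le> ennreal ?F * ennreal (?S - \<omega> t + ?e n)"
            unfolding I using lo up by (intro conjI mult_left_mono) auto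
        qed
        have "(\<lambda>n. ?F * (?S - \<omega> t + ?e n)) \<longlonglongrightarrow> ?F * (?S - \<omega> t + 0)"
          by (intro tendsto_intros e0)
        note lim' = tendsto_ennrealI[OF this]
        have "ennreal ?F * ennreal (?S - \<omega> t + ?e n) = ennreal (?F * (?S - \<omega> t + ?e n))" for n
          by (rule ennreal_mult[symmetric]) (use F SX in simp_all)
        moreover have "ennreal ?F * ennreal (?S - \<omega> t) = ennreal (?F * (?S - \<omega> t + 0))"
          using F SX by (simp add: ennreal_mult)
        ultimately have lim: "(\<lambda>n. ennreal ?F * ennreal (?S - \<omega> t + ?e n)) \<longlonglongrightarrow> ennreal ?F * ennreal (?S - \<omega> t)"
          using lim' by (simp only:)
        have "(\<lambda>n. I n \<omega>) \<longlonglongrightarrow> ennreal ?F * ennreal (?S - \<omega> t)"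
          by (rule tendsto_sandwich[OF _ _ tendsto_const lim]) (use bounds in \<open>auto elim: eventually_mono\<close>)
        then show ?thesis using 2 F SX by (simp add: ennreal_mult)
      qed
    qed
  qed (use Im in measurable)
  show ?thesis by (rule LIMSEQ_unique[OF left right])
qed

lemma distr_run_sup:
  "distr (density P (\<lambda>\<omega>. ennreal (cyl_fn l \<omega> * (run_sup t \<omega> - \<omega> t)) * indicator {0<..} (run_sup t \<omega>))) borel (run_sup t) =
    density lborel run_sup_density" (is "?M = ?N")
proof (rule measure_eqI_generator_eq[where E="range (\<lambda>(a, b). {a<..b})" and \<Omega>=UNIV and A="\<lambda>i. {- real i<..real i}"])
  \<comment> \<open>The restriction to S > 0 allows the interval to be cut at 0, as the formula for
    (a, b] asks for a \<ge> 0.\<close>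
  have eq: "emeasure ?M {a<..b} = (\<integral>\<^sup>+y. run_sup_density y * indicator {max a 0<..b} y \<partial>lborel)" for a b
  proof -
    have s: "run_sup t -` {a<..b} \<inter> space P \<in> sets P"
      by (rule measurable_sets[OF measurable_run_sup_P]) simp
    have "emeasure ?M {a<..b} = emeasure (density P (\<lambda>\<omega>. ennreal (cyl_fn l \<omega> * (run_sup t \<omega> - \<omega> t)) *
        indicator {0<..} (run_sup t \<omega>))) (run_sup t -` {a<..b} \<inter> space P)"
      by (subst emeasure_distr) simp_all
    also have "\<dots> = (\<integral>\<^sup>+\<omega>. ennreal (cyl_fn l \<omega> * (run_sup t \<omega> - \<omega> t)) * indicator {0<..} (run_sup t \<omega>) *
        indicator (run_sup t -` {a<..b} \<inter> space P) \<omega> \<partial>P)"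
      by (rule emeasure_density[OF _ s]) measurable
    also have "\<dots> = (\<integral>\<^sup>+\<omega>. ennreal (cyl_fn l \<omega> * (run_sup t \<omega> - \<omega> t)) * indicator {max a 0<..b} (run_sup t \<omega>) \<partial>P)"
      by (rule nn_integral_cong) (auto simp: indicator_def)
    finally show ?thesis by (simp add: nn_integral_run_sup_Ioc)
  qed
  show "emeasure ?M X = emeasure ?N X" if "X \<in> range (\<lambda>(a, b). {a<..b})" for X
  proof -
    obtain a b where X: "X = {a<..b}" using \<open>X \<in> range (\<lambda>(a, b). {a<..b})\<close> by auto
    have "emeasure ?N {a<..b} = (\<integral>\<^sup>+y. run_sup_density y * indicator {a<..b} y \<partial>lborel)"
      by (simp add: emeasure_density)
    also have "\<dots> = (\<integral>\<^sup>+y. run_sup_density y * indicator {max a 0<..b} y \<partial>lborel)"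
      by (rule nn_integral_cong) (auto simp: indicator_def run_sup_density_def)
    finally show ?thesis unfolding X eq by simp
  qed
  show "emeasure ?M {- real i<..real i} \<noteq> \<infinity>" for i
  proof -
    have "emeasure ?M {- real i<..real i} \<le> (\<integral>\<^sup>+y. indicator {- real i<..real i} y \<partial>lborel)"
      unfolding eq
    proof (rule nn_integral_mono)
      fix y show "run_sup_density y * indicator {max (- real i) 0<..real i} y \<le> indicator {- real i<..real i} y"
        using integral_hit_weight_bounds(2)[of y 0] by (auto simp: indicator_def run_sup_density_def)
    qed
    also have "\<dots> < \<infinity>" by simp
    finally show ?thesis by simp
  qed
  have Ioc: "{a<..b} \<in> range (\<lambda>(a, b). {a<..b})" for a b :: real
    by (rule range_eqI[of _ _ "(a, b)"]) simp
  show "Int_stable (range (\<lambda>(a, b). {a<..b::real}))"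
    by (rule Int_stableI) (auto intro!: Ioc)
  show "sets ?M = sigma_sets UNIV (range (\<lambda>(a, b). {a<..b}))" "sets ?N = sigma_sets UNIV (range (\<lambda>(a, b). {a<..b}))"
    by (simp_all add: borel_sigma_sets_Ioc)
  show "(\<Union>i. {- real i<..real i}) = (UNIV :: real set)"
  proof (intro equalityI subsetI UNIV_I)
    fix x :: real
    obtain n where "\<bar>x\<bar> < real n" using reals_Archimedean2 by blast
    then show "x \<in> (\<Union>i. {- real i<..real i})" by (intro UN_I[of n]) auto
  qed
qed auto

text \<open>On S = 0 the factor S - X vanishes almost surely, so restricting to S > 0, as
  \<open>distr_run_sup\<close> does, loses nothing.\<close>

lemma nn_integral_run_sup:
  assumes [measurable]: "\<psi> \<in> borel_measurable borel"
  shows "(\<integral>\<^sup>+\<omega>. ennreal (cyl_fn l \<omega> * (run_sup t \<omega> - \<omega> t)) * \<psi> (run_sup t \<omega>) \<partial>P) =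
    (\<integral>\<^sup>+y. run_sup_density y * \<psi> y \<partial>lborel)"
proof -
  have "(\<integral>\<^sup>+\<omega>. ennreal (cyl_fn l \<omega> * (run_sup t \<omega> - \<omega> t)) * \<psi> (run_sup t \<omega>) \<partial>P) =
    (\<integral>\<^sup>+\<omega>. ennreal (cyl_fn l \<omega> * (run_sup t \<omega> - \<omega> t)) * indicator {0<..} (run_sup t \<omega>) * \<psi> (run_sup t \<omega>) \<partial>P)"
  proof (rule nn_integral_cong_AE)
    show "AE \<omega> in P. ennreal (cyl_fn l \<omega> * (run_sup t \<omega> - \<omega> t)) * \<psi> (run_sup t \<omega>) =
      ennreal (cyl_fn l \<omega> * (run_sup t \<omega> - \<omega> t)) * indicator {0<..} (run_sup t \<omega>) * \<psi> (run_sup t \<omega>)"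
      using AE_run_sup_nonneg[OF cyl_end_nonneg] AE_run_sup_zero[OF cyl_end_nonneg]
      by eventually_elim (auto simp: indicator_def order_le_less)
  qed
  also have "\<dots> = (\<integral>\<^sup>+y. \<psi> y \<partial>distr (density P (\<lambda>\<omega>. ennreal (cyl_fn l \<omega> * (run_sup t \<omega> - \<omega> t)) * indicator {0<..} (run_sup t \<omega>))) borel (run_sup t))"
    by (simp add: nn_integral_distr nn_integral_density)
  also have "\<dots> = (\<integral>\<^sup>+y. run_sup_density y * \<psi> y \<partial>lborel)"
    unfolding distr_run_sup by (simp add: nn_integral_density)
  finally show ?thesis .
qed

end

end

section \<open>Mixture over the levels\<close>

text \<open>Continuous approximations of the indicator of a compact set. The slope
  \<open>Suc m\<close> is at least 1, so the support stays within distance 1 of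
  \<open>C\<close>.\<close>

definition bump :: "real set \<Rightarrow> nat \<Rightarrow> real \<Rightarrow> real" where
  "bump C m x = max 0 (1 - real (Suc m) * infdist x C)"

lemma test_fn_bump:
  assumes "compact C" "C \<noteq> {}"
  shows "test_fn (bump C m)"
proof -
  obtain B where B: "\<And>x. x \<in> C \<Longrightarrow> \<bar>x\<bar> \<le> B"
    using compact_imp_bounded[OF assms(1)] by (auto simp: bounded_iff)
  have "bump C m x = 0" if "B + 1 < \<bar>x\<bar>" for x
  proof -
    obtain c where c: "c \<in> C" "infdist x C = dist x c"
      using infdist_attains_inf[OF compact_imp_closed[OF assms(1)] assms(2)] by blast
    have "1 \<le> infdist x C" using B[OF c(1)] that unfolding c(2) dist_real_def by linarith
    then have "1 * 1 \<le> real (Suc m) * infdist x C" by (intro mult_mono) auto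
    then show ?thesis by (simp add: bump_def)
  qed
  moreover have "continuous_on UNIV (bump C m)"
    unfolding bump_def[abs_def] by (intro continuous_intros)
  moreover have "0 \<le> real (Suc m) * infdist x C" for x by (simp add: infdist_nonneg)
  then have "0 \<le> bump C m x \<and> bump C m x \<le> 1" for x unfolding bump_def by simp
  ultimately show ?thesis unfolding test_fn_def by blast
qed

lemma bump_tendsto:
  assumes "compact C" "C \<noteq> {}"
  shows "(\<lambda>m. bump C m x) \<longlonglongrightarrow> indicator C x"
proof (cases "x \<in> C")
  case True
  then show ?thesis by (simp add: bump_def)
next
  case False
  have d: "0 < infdist x C"
    using infdist_pos_not_in_closed[OF compact_imp_closed[OF assms(1)] assms(2) False] .
  obtain n where n: "1 / infdist x C < real n" using reals_Archimedean2 by blast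
  have "\<forall>\<^sub>F m in sequentially. 0 = bump C m x"
    using eventually_ge_at_top[of n]
  proof eventually_elim
    fix m assume "n \<le> m"
    then have "1 / infdist x C \<le> real (Suc m)" using n by linarith
    then have "1 \<le> real (Suc m) * infdist x C" using d by (simp only: divide_le_eq if_True)
    then show "0 = bump C m x" by (simp add: bump_def)
  qed
  then show ?thesis using False by (simp add: Lim_transform_eventually[OF tendsto_const])
qed

definition box_cyl :: "real set \<Rightarrow> (real \<Rightarrow> real set) \<Rightarrow> nat \<Rightarrow> cyl" where
  "box_cyl I C m = map (\<lambda>u. (u, bump (C u) m)) (sorted_list_of_set I)"

lemma cyl_from_map:
  "sorted us \<Longrightarrow> (\<forall>u\<in>set us. q \<le> u \<and> test_fn (g u)) \<Longrightarrow> cyl_from q (map (\<lambda>u. (u, g u)) us)"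
  by (induction us arbitrary: q) auto

lemma last_time_map:
  "last_time q (map (\<lambda>u. (u, g u)) us) = last_time q (map (\<lambda>u. (u, h u)) us)"
  by (induction us arbitrary: q) auto

lemma last_time_ge_mem:
  "sorted us \<Longrightarrow> u \<in> set us \<Longrightarrow> u \<le> last_time q (map (\<lambda>u. (u, g u)) us)"
proof (induction us arbitrary: q u)
  case (Cons a us)
  show ?case
  proof (cases "us = []")
    case False
    then obtain b where b: "b \<in> set us" by (cases us) auto
    then show ?thesis using Cons.IH[of b a] Cons.IH[of u a] Cons.prems by (auto intro: order_trans)
  qed (use Cons.prems in auto)
qed simp

lemma cyl_fn_box:
  "finite I \<Longrightarrow> cyl_fn (box_cyl I C m) \<omega> = (\<Prod>u\<in>I. bump (C u) m (\<omega> u))"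
  unfolding box_cyl_def cyl_fn_def map_map comp_def fst_conv snd_conv
  by (subst prod.distinct_set_conv_list[symmetric]) simp_all

lemma cyl_fn_box_tendsto:
  assumes "finite I" "\<And>u. u \<in> I \<Longrightarrow> compact (C u) \<and> C u \<noteq> {}" "\<omega> \<in> path_space"
  shows "(\<lambda>m. cyl_fn (box_cyl I C m) \<omega>) \<longlonglongrightarrow> indicator {\<omega> \<in> path_space. \<forall>u\<in>I. \<omega> u \<in> C u} \<omega>"
proof -
  have "(\<lambda>m. \<Prod>u\<in>I. bump (C u) m (\<omega> u)) \<longlonglongrightarrow> (\<Prod>u\<in>I. indicator (C u) (\<omega> u))"
    by (intro tendsto_prod bump_tendsto) (use assms in auto)
  also have "(\<Prod>u\<in>I. indicator (C u) (\<omega> u)) = (indicator {\<omega> \<in> path_space. \<forall>u\<in>I. \<omega> u \<in> C u} \<omega> :: real)"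
    using assms(1,3) by (auto simp: indicator_def prod_zero_iff)
  finally show ?thesis unfolding cyl_fn_box[OF assms(1)] .
qed

text \<open>Compact sides are what the bumps approximate; at least one time is required so that the
  associated cylinder list is not empty.\<close>

definition compact_boxes :: "(real \<Rightarrow> real) set set" where
  "compact_boxes = {{\<omega> \<in> path_space. \<forall>u\<in>I. \<omega> u \<in> C u} | I C.
     finite I \<and> I \<subseteq> {0..} \<and> I \<noteq> {} \<and> (\<forall>u. compact (C u))}"

lemma Int_stable_compact_boxes: "Int_stable compact_boxes"
proof (rule Int_stableI)
  fix A B assume "A \<in> compact_boxes" "B \<in> compact_boxes"
  then obtain I C J D where A: "A = {\<omega> \<in> path_space. \<forall>u\<in>I. \<omega> u \<in> C u}" and B: "B = {\<omega> \<in> path_space. \<forall>u\<in>J. \<omega> u \<in> D u}"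
    and *: "finite I" "I \<subseteq> {0..}" "I \<noteq> {}" "\<forall>u. compact (C u)" "finite J" "J \<subseteq> {0..}" "\<forall>u. compact (D u)"
    unfolding compact_boxes_def by blast
  let ?E = "\<lambda>u. if u \<in> I \<and> u \<in> J then C u \<inter> D u else if u \<in> I then C u else D u"
  have "A \<inter> B = {\<omega> \<in> path_space. \<forall>u\<in>I \<union> J. \<omega> u \<in> ?E u}" unfolding A B by auto
  moreover have "finite (I \<union> J)" "I \<union> J \<subseteq> {0..}" "I \<union> J \<noteq> {}" using * by auto
  moreover have "\<forall>u. compact (?E u)" using * by (simp add: compact_Int)
  ultimately show "A \<inter> B \<in> compact_boxes" unfolding compact_boxes_def mem_Collect_eq
    by (intro exI[of _ "I \<union> J"] exI[of _ ?E]) simp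
qed

lemma compact_boxes_subset: "compact_boxes \<subseteq> Pow path_space"
  unfolding compact_boxes_def by auto

lemma sets_canon_inf_compact_boxes: "sets canon_inf = sigma_sets path_space compact_boxes"
proof
  let ?M = "sigma path_space compact_boxes"
  have sM: "sets ?M = sigma_sets path_space compact_boxes" and spM: "space ?M = path_space"
    using compact_boxes_subset by (simp_all add: sets_measure_of space_measure_of)
  have m: "(\<lambda>\<omega>. \<omega> s) \<in> borel_measurable ?M" if s: "0 \<le> s" for s
  proof (rule borel_measurableI_le)
    fix a
    \<comment> \<open>Half-lines are not compact, but countable unions of compact intervals.\<close>
    have "{\<omega> \<in> path_space. \<forall>u\<in>{s}. \<omega> u \<in> {- real n..a}} \<in> compact_boxes" for n
      unfolding compact_boxes_def mem_Collect_eq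
      by (intro exI[of _ "{s}"] exI[of _ "\<lambda>_. {- real n..a}"]) (use s in simp)
    then have "(\<Union>n. {\<omega> \<in> path_space. \<forall>u\<in>{s}. \<omega> u \<in> {- real n..a}}) \<in> sets ?M"
      unfolding sM by (intro sigma_sets.Union sigma_sets.Basic)
    also have "(\<Union>n. {\<omega> \<in> path_space. \<forall>u\<in>{s}. \<omega> u \<in> {- real n..a}}) = {\<omega> \<in> space ?M. \<omega> s \<le> a}"
    proof (intro equalityI subsetI)
      fix \<omega> assume *: "\<omega> \<in> {\<omega> \<in> space ?M. \<omega> s \<le> a}"
      obtain n where "- \<omega> s < real n" using reals_Archimedean2 by blast
      then show "\<omega> \<in> (\<Union>n. {\<omega> \<in> path_space. \<forall>u\<in>{s}. \<omega> u \<in> {- real n..a}})"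
        using * spM by (intro UN_I[of n]) auto
    qed (use spM in auto)
    finally show "{\<omega> \<in> space ?M. \<omega> s \<le> a} \<in> sets ?M" .
  qed
  show "sets canon_inf \<subseteq> sigma_sets path_space compact_boxes"
    unfolding sets_coord_algebra
  proof (rule sigma_sets_mono, rule subsetI)
    fix A assume "A \<in> {(\<lambda>\<omega>. \<omega> s) -` B \<inter> path_space | s B. s \<in> {0..} \<and> B \<in> sets borel}"
    then obtain s B where "A = (\<lambda>\<omega>. \<omega> s) -` B \<inter> path_space" "0 \<le> s" "B \<in> sets borel" by auto
    then show "A \<in> sigma_sets path_space compact_boxes"
      using measurable_sets[OF m[of s], of B] spM sM by simp
  qed
  show "sigma_sets path_space compact_boxes \<subseteq> sets canon_inf"
    unfolding sets_coord_algebra_boxes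
  proof (rule sigma_sets_mono')
    show "compact_boxes \<subseteq> {{\<omega> \<in> path_space. \<forall>u\<in>J. \<omega> u \<in> B u} | J B. finite J \<and> J \<subseteq> {0..} \<and> (\<forall>u. B u \<in> sets borel)}"
      unfolding compact_boxes_def using borel_compact by blast
  qed
qed

section \<open>The mixture identity: from cylinder functionals to all events\<close>

locale level_mixture = wiener_space P for P +
  fixes \<phi> :: "real \<Rightarrow> real" and Q :: "(real \<Rightarrow> real) measure" and Qy :: "real \<Rightarrow> (real \<Rightarrow> real) measure"
  assumes phi_borel [measurable]: "\<phi> \<in> borel_measurable borel"
    and phi_nonneg: "\<And>u. 0 \<le> u \<Longrightarrow> 0 \<le> \<phi> u"
    and phi_int: "set_integrable lborel {0..} \<phi>"
    and phi_total: "(LINT u:{0..}|lborel. \<phi> u) = 1"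
    and Q_phi: "is_Q_phi P \<phi> Q"
    and Q_level: "\<And>y. 0 < y \<Longrightarrow> is_Q_level P y (Qy y)"
begin

declare measurable_coord_P [measurable del] measurable_end_P [measurable del]

text \<open>\<open>Qy y\<close> is specified only for y > 0 and the sign of \<open>\<phi>\<close>
  only on the half-line u \<ge> 0. Cutting off at 0 yields a density on the whole line and makes the
  unspecified values harmless.\<close>

definition dens :: "real \<Rightarrow> real" where "dens y = indicator {0<..} y * \<phi> y"

lemma dens_nonneg [simp]: "0 \<le> dens y"
  using phi_nonneg[of y] by (simp add: dens_def indicator_def)

lemma dens_borel [measurable]: "dens \<in> borel_measurable borel"
  unfolding dens_def[abs_def] by measurable

lemma dens_integrable: "integrable lborel dens"
proof -
  have "set_integrable lborel {0<..} \<phi>"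
    by (rule set_integrable_subset[OF phi_int]) auto
  then show ?thesis by (simp add: set_integrable_def dens_def[abs_def])
qed

text \<open>1 - \<Phi>(s) is the \<phi>-mass of the levels above s, those that a path with running
  supremum s has not reached.\<close>

lemma primitive_fn_tail:
  assumes s: "0 \<le> s"
  shows "0 \<le> 1 - primitive_fn \<phi> s"
    and "(\<integral>\<^sup>+y. ennreal (dens y) * indicator {s<..} y \<partial>lborel) = ennreal (1 - primitive_fn \<phi> s)"
proof -
  have i1: "set_integrable lborel {0..s} \<phi>" and i2: "set_integrable lborel {s<..} \<phi>"
    by (rule set_integrable_subset[OF phi_int]; use s in auto)+
  have "{0..} = {0..s} \<union> {s<..}" using s by auto
  moreover have "{0..s} \<inter> {s<..} = {}" by auto
  ultimately have "1 = primitive_fn \<phi> s + (LINT u:{s<..}|lborel. \<phi> u)"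
    using set_integral_Un[OF _ i1 i2] phi_total by (simp only: primitive_fn_def)
  then have e: "1 - primitive_fn \<phi> s = (LINT u:{s<..}|lborel. \<phi> u)" by simp
  show "0 \<le> 1 - primitive_fn \<phi> s"
    unfolding e set_lebesgue_integral_def
    by (rule Bochner_Integration.integral_nonneg) (use phi_nonneg s in \<open>auto simp: indicator_def\<close>)
  have "(\<integral>\<^sup>+y. ennreal (dens y) * indicator {s<..} y \<partial>lborel) = (\<integral>\<^sup>+y. ennreal (indicator {s<..} y *\<^sub>R \<phi> y) \<partial>lborel)"
    by (rule nn_integral_cong) (use s in \<open>auto simp: dens_def indicator_def\<close>)
  also have "\<dots> = ennreal (LINT u:{s<..}|lborel. \<phi> u)"
    unfolding set_lebesgue_integral_def
    by (rule nn_integral_eq_integral)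
       (use i2 phi_nonneg s in \<open>auto simp: set_integrable_def indicator_def\<close>)
  finally show "(\<integral>\<^sup>+y. ennreal (dens y) * indicator {s<..} y \<partial>lborel) = ennreal (1 - primitive_fn \<phi> s)"
    unfolding e .
qed

lemma dens_total: "(\<integral>y. dens y \<partial>lborel) = 1"
proof -
  have "{0..0} = {0::real}" by auto
  then have "primitive_fn \<phi> 0 = (LINT u:{0}|lborel. \<phi> u)" by (simp add: primitive_fn_def)
  also have "\<dots> = 0"
  proof -
    have "AE u in lborel. indicator {0} u *\<^sub>R \<phi> u = 0"
      using AE_lborel_singleton[of 0] by eventually_elim (simp add: indicator_def)
    then show ?thesis unfolding set_lebesgue_integral_def by (rule integral_eq_zero_AE)
  qed
  finally have p: "primitive_fn \<phi> 0 = 0" .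
  have "ennreal (\<integral>y. dens y \<partial>lborel) = (\<integral>\<^sup>+y. ennreal (dens y) \<partial>lborel)"
    by (rule nn_integral_eq_integral[OF dens_integrable, symmetric]) simp
  also have "\<dots> = (\<integral>\<^sup>+y. ennreal (dens y) * indicator {0<..} y \<partial>lborel)"
    by (rule nn_integral_cong) (simp add: dens_def indicator_def)
  also have "\<dots> = ennreal 1" using primitive_fn_tail(2)[of 0] p by simp
  finally show ?thesis by (simp add: Bochner_Integration.integral_nonneg)
qed

definition weight :: "real \<Rightarrow> (real \<Rightarrow> real) \<Rightarrow> real" where
  "weight t \<omega> = (run_sup t \<omega> - \<omega> t) * \<phi> (run_sup t \<omega>) + 1 - primitive_fn \<phi> (run_sup t \<omega>)"

lemma measurable_primitive [measurable]: "primitive_fn \<phi> \<in> borel_measurable borel"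
proof -
  have "primitive_fn \<phi> = (\<lambda>s. \<integral>u. (if 0 \<le> u \<and> u \<le> s then 1 else 0) * \<phi> u \<partial>lborel)"
    unfolding primitive_fn_def[abs_def] set_lebesgue_integral_def
    by (intro ext Bochner_Integration.integral_cong) (auto simp: indicator_def)
  also have "\<dots> \<in> borel_measurable borel"
    by (rule lborel.borel_measurable_lebesgue_integral) measurable
  finally show ?thesis .
qed

lemma weight_measurable: "0 \<le> t \<Longrightarrow> weight t \<in> borel_measurable P"
proof -
  assume t: "0 \<le> t"
  have [measurable]: "run_sup t \<in> borel_measurable P" "(\<lambda>\<omega>. \<omega> t) \<in> borel_measurable P"
    using measurable_P[OF measurable_run_sup[OF t]] measurable_coord_P[OF t] by auto
  show ?thesis unfolding weight_def[abs_def] by measurable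
qed

lemma weight_nonneg: "0 \<le> t \<Longrightarrow> AE \<omega> in P. 0 \<le> weight t \<omega>"
proof -
  assume t: "0 \<le> t"
  show ?thesis
    using AE_run_sup_nonneg[OF t] AE_space
  proof eventually_elim
    fix \<omega> assume s: "0 \<le> run_sup t \<omega>" and w: "\<omega> \<in> space P"
    have "0 \<le> (run_sup t \<omega> - \<omega> t) * \<phi> (run_sup t \<omega>)"
      using le_run_sup[of \<omega> t t] w t phi_nonneg[OF s] by (intro mult_nonneg_nonneg) auto
    then show "0 \<le> weight t \<omega>" using primitive_fn_tail(1)[OF s] by (simp add: weight_def)
  qed
qed

lemma Q_prob: "prob_space Q" and sets_Q: "sets Q = sets canon_inf" and space_Q: "space Q = path_space"
proof -
  show "prob_space Q" using Q_phi by (simp add: is_Q_phi_def)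
  show s: "sets Q = sets canon_inf" using Q_phi by (simp add: is_Q_phi_def)
  show "space Q = path_space" using sets_eq_imp_space_eq[OF s] by simp
qed

lemma Q_formula:
  "0 \<le> t \<Longrightarrow> \<Gamma> \<in> sets (canon_filt t) \<Longrightarrow> measure Q \<Gamma> = (\<integral>\<omega>. indicator \<Gamma> \<omega> * weight t \<omega> \<partial>P)"
  using Q_phi unfolding is_Q_phi_def weight_def by blast

text \<open>Otherwise the Bochner integral of the weight would be 0 by convention, whereas
  \<open>Q\<close> has total mass 1.\<close>

lemma weight_integrable: "0 \<le> t \<Longrightarrow> integrable P (weight t)"
proof (rule ccontr)
  assume t: "0 \<le> t" and n: "\<not> integrable P (weight t)"
  have "path_space \<in> sets (canon_filt t)" using sets.top[of "canon_filt t"] by simp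
  then have "measure Q path_space = (\<integral>\<omega>. indicator path_space \<omega> * weight t \<omega> \<partial>P)"
    by (rule Q_formula[OF t])
  also have "\<dots> = (\<integral>\<omega>. weight t \<omega> \<partial>P)"
    by (rule Bochner_Integration.integral_cong) auto
  also have "\<dots> = 0" by (rule not_integrable_integral_eq[OF n])
  finally show False using prob_space.prob_space[OF Q_prob] space_Q by simp
qed

lemma Qy_prob: "0 < y \<Longrightarrow> prob_space (Qy y)"
  and sets_Qy: "0 < y \<Longrightarrow> sets (Qy y) = sets canon_inf"
  using Q_level by (auto simp: is_Q_level_def)

lemma space_Qy: "0 < y \<Longrightarrow> space (Qy y) = path_space"
  using sets_eq_imp_space_eq[OF sets_Qy] by simp

text \<open>Paths with S < y contribute 1 - \<Phi>(S) by Tonelli, those that have reached y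
  contribute (S - X) \<phi>(S) by the density in the level. With nonnegative integrals both
  computations precede any question of integrability.\<close>

lemma mixture_cyl:
  assumes l: "cyl_from 0 l" "l \<noteq> []"
  defines "t \<equiv> last_time 0 l"
  shows "(\<lambda>y. indicator {0<..} y * ennreal (\<integral>\<omega>. cyl_fn l \<omega> \<partial>Qy y)) \<in> borel_measurable lborel"
    and "(\<integral>\<^sup>+\<omega>. ennreal (cyl_fn l \<omega> * weight t \<omega>) \<partial>P) =
      (\<integral>\<^sup>+y. ennreal (dens y) * ennreal (\<integral>\<omega>. cyl_fn l \<omega> \<partial>Qy y) \<partial>lborel)"
proof -
  have t: "0 \<le> t" unfolding t_def by (rule last_time_ge[OF l(1)])
  have rs[measurable]: "run_sup t \<in> borel_measurable P" by (rule measurable_P[OF measurable_run_sup[OF t]])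
  have Fm[measurable]: "cyl_fn l \<in> borel_measurable P" by (rule measurable_P[OF measurable_cyl_fn[OF order_refl l(1)]])
  have tP: "(\<lambda>\<omega>. \<omega> t) \<in> borel_measurable P" by (rule measurable_coord_P[OF t])
  have F: "0 \<le> cyl_fn l \<omega>" "cyl_fn l \<omega> \<le> 1" for \<omega> using cyl_fn_bounds[OF l(1)] by auto
  have md[measurable]: "run_sup_density l \<in> borel_measurable borel"
    by (rule measurable_run_sup_density[OF l refl])
  interpret L: pair_sigma_finite lborel P by unfold_locales
  define B where "B y = (\<integral>\<^sup>+\<omega>. ennreal (cyl_fn l \<omega>) * (if run_sup t \<omega> < y then 1 else 0) \<partial>P)" for y
  have m2: "(\<lambda>(y, \<omega>). ennreal (dens y) * (ennreal (cyl_fn l \<omega>) * (if run_sup t \<omega> < y then 1 else 0))) \<in> borel_measurable (lborel \<Otimes>\<^sub>M P)"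
    unfolding case_prod_unfold by measurable
  have mB: "B \<in> borel_measurable lborel"
    unfolding B_def[abs_def] by (rule borel_measurable_nn_integral) measurable
  have Beq: "ennreal (\<integral>\<omega>. (if run_sup t \<omega> < y then cyl_fn l \<omega> else 0) \<partial>P) = B y" for y
  proof -
    have "integrable P (\<lambda>\<omega>. if run_sup t \<omega> < y then cyl_fn l \<omega> else 0)"
      by (rule integrable_const_bound[where B=1]) (use F in auto)
    then have "ennreal (\<integral>\<omega>. (if run_sup t \<omega> < y then cyl_fn l \<omega> else 0) \<partial>P) =
      (\<integral>\<^sup>+\<omega>. ennreal (if run_sup t \<omega> < y then cyl_fn l \<omega> else 0) \<partial>P)"
      by (rule nn_integral_eq_integral[symmetric]) (use F in auto)
    also have "\<dots> = B y" unfolding B_def by (rule nn_integral_cong) auto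
    finally show ?thesis .
  qed
  have Qeq: "ennreal (\<integral>\<omega>. cyl_fn l \<omega> \<partial>Qy y) = B y + run_sup_density l y" if y: "0 < y" for y
  proof -
    have "ennreal (\<integral>\<omega>. cyl_fn l \<omega> \<partial>Qy y) =
      ennreal (\<integral>\<omega>. (if run_sup t \<omega> < y then cyl_fn l \<omega> else 0) \<partial>P) + ennreal (\<integral>\<omega>. hit_weight y l 0 \<omega> \<partial>P)"
      unfolding Q_level_cyl[OF Q_level[OF y] y l] t_def
      by (intro ennreal_plus Bochner_Integration.integral_nonneg) (use F hit_weight_bounds[OF l(1)] in auto)
    then show ?thesis using y by (simp add: Beq run_sup_density_def[OF l refl])
  qed
  \<comment> \<open>Measurability in the level, which is not among the assumptions on
    \<open>Qy\<close>, is inherited from the two explicit terms.\<close>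
  have "(\<lambda>y. indicator {0<..} y * (B y + run_sup_density l y)) \<in> borel_measurable lborel"
    by (intro borel_measurable_times_ennreal borel_measurable_add mB borel_measurable_indicator)
       (use md in simp_all)
  also have "(\<lambda>y. indicator {0<..} y * (B y + run_sup_density l y)) =
    (\<lambda>y. indicator {0<..} y * ennreal (\<integral>\<omega>. cyl_fn l \<omega> \<partial>Qy y))"
    using Qeq by (auto simp: indicator_def fun_eq_iff)
  finally show "(\<lambda>y. indicator {0<..} y * ennreal (\<integral>\<omega>. cyl_fn l \<omega> \<partial>Qy y)) \<in> borel_measurable lborel" .
  have "(\<integral>\<^sup>+y. ennreal (dens y) * ennreal (\<integral>\<omega>. cyl_fn l \<omega> \<partial>Qy y) \<partial>lborel) =
    (\<integral>\<^sup>+y. ennreal (dens y) * B y + run_sup_density l y * ennreal (dens y) \<partial>lborel)"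
    by (rule nn_integral_cong) (use Qeq in \<open>auto simp: dens_def indicator_def distrib_left mult.commute\<close>)
  also have "\<dots> = (\<integral>\<^sup>+y. ennreal (dens y) * B y \<partial>lborel) + (\<integral>\<^sup>+y. run_sup_density l y * ennreal (dens y) \<partial>lborel)"
  proof (rule nn_integral_add)
    have d: "(\<lambda>y. ennreal (dens y)) \<in> borel_measurable lborel"
      using measurable_compose[OF dens_borel measurable_ennreal] by simp
    show "(\<lambda>y. ennreal (dens y) * B y) \<in> borel_measurable lborel"
      by (rule borel_measurable_times_ennreal[OF d mB])
    show "(\<lambda>y. run_sup_density l y * ennreal (dens y)) \<in> borel_measurable lborel"
      by (rule borel_measurable_times_ennreal[OF _ d]) (use md in simp)
  qed
  also have "(\<integral>\<^sup>+y. ennreal (dens y) * B y \<partial>lborel) =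
    (\<integral>\<^sup>+\<omega>. ennreal (cyl_fn l \<omega>) * (\<integral>\<^sup>+y. ennreal (dens y) * indicator {run_sup t \<omega><..} y \<partial>lborel) \<partial>P)"
  proof -
    have "(\<integral>\<^sup>+y. ennreal (dens y) * B y \<partial>lborel) =
      (\<integral>\<^sup>+y. (\<integral>\<^sup>+\<omega>. ennreal (dens y) * (ennreal (cyl_fn l \<omega>) * (if run_sup t \<omega> < y then 1 else 0)) \<partial>P) \<partial>lborel)"
      unfolding B_def by (intro nn_integral_cong nn_integral_cmult[symmetric]) measurable
    also have "\<dots> = (\<integral>\<^sup>+\<omega>. (\<integral>\<^sup>+y. ennreal (dens y) * (ennreal (cyl_fn l \<omega>) * (if run_sup t \<omega> < y then 1 else 0)) \<partial>lborel) \<partial>P)"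
      by (rule L.Fubini'[OF m2, symmetric])
    also have "\<dots> = (\<integral>\<^sup>+\<omega>. (\<integral>\<^sup>+y. ennreal (cyl_fn l \<omega>) * (ennreal (dens y) * indicator {run_sup t \<omega><..} y) \<partial>lborel) \<partial>P)"
      by (intro nn_integral_cong) (auto simp: indicator_def mult.commute)
    also have "\<dots> = (\<integral>\<^sup>+\<omega>. ennreal (cyl_fn l \<omega>) * (\<integral>\<^sup>+y. ennreal (dens y) * indicator {run_sup t \<omega><..} y \<partial>lborel) \<partial>P)"
      by (intro nn_integral_cong nn_integral_cmult) measurable
    finally show ?thesis .
  qed
  also have "\<dots> = (\<integral>\<^sup>+\<omega>. ennreal (cyl_fn l \<omega> * (1 - primitive_fn \<phi> (run_sup t \<omega>))) \<partial>P)"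
  proof (rule nn_integral_cong_AE)
    show "AE \<omega> in P. ennreal (cyl_fn l \<omega>) * (\<integral>\<^sup>+y. ennreal (dens y) * indicator {run_sup t \<omega><..} y \<partial>lborel) =
      ennreal (cyl_fn l \<omega> * (1 - primitive_fn \<phi> (run_sup t \<omega>)))"
      using AE_run_sup_nonneg[OF t] by eventually_elim (use primitive_fn_tail F in \<open>simp add: ennreal_mult\<close>)
  qed
  also have "(\<integral>\<^sup>+y. run_sup_density l y * ennreal (dens y) \<partial>lborel) =
    (\<integral>\<^sup>+\<omega>. ennreal (cyl_fn l \<omega> * (run_sup t \<omega> - \<omega> t)) * ennreal (dens (run_sup t \<omega>)) \<partial>P)"
    unfolding t_def by (rule nn_integral_run_sup[OF l refl, symmetric]) measurable
  also have "\<dots> = (\<integral>\<^sup>+\<omega>. ennreal (cyl_fn l \<omega> * (run_sup t \<omega> - \<omega> t) * \<phi> (run_sup t \<omega>)) \<partial>P)"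
  proof (rule nn_integral_cong_AE)
    show "AE \<omega> in P. ennreal (cyl_fn l \<omega> * (run_sup t \<omega> - \<omega> t)) * ennreal (dens (run_sup t \<omega>)) =
      ennreal (cyl_fn l \<omega> * (run_sup t \<omega> - \<omega> t) * \<phi> (run_sup t \<omega>))"
      using AE_run_sup_nonneg[OF t] AE_run_sup_zero[OF t]
    proof eventually_elim
      fix \<omega> assume s: "0 \<le> run_sup t \<omega>" "run_sup t \<omega> = 0 \<longrightarrow> \<omega> t = 0"
      show "ennreal (cyl_fn l \<omega> * (run_sup t \<omega> - \<omega> t)) * ennreal (dens (run_sup t \<omega>)) =
        ennreal (cyl_fn l \<omega> * (run_sup t \<omega> - \<omega> t) * \<phi> (run_sup t \<omega>))"
      \<comment> \<open>At 0 the function \<open>dens\<close> is 0 while \<phi> may be positive;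
        both sides vanish because X is 0 there almost surely.\<close>
      proof (cases "run_sup t \<omega> = 0")
        case False
        then have "dens (run_sup t \<omega>) = \<phi> (run_sup t \<omega>)" using s by (simp add: dens_def indicator_def)
        then show ?thesis using phi_nonneg[OF s(1)] by (simp add: ennreal_mult'')
      qed (use s in simp)
    qed
  qed
  finally have e: "(\<integral>\<^sup>+y. ennreal (dens y) * ennreal (\<integral>\<omega>. cyl_fn l \<omega> \<partial>Qy y) \<partial>lborel) =
    (\<integral>\<^sup>+\<omega>. ennreal (cyl_fn l \<omega> * (1 - primitive_fn \<phi> (run_sup t \<omega>))) \<partial>P) +
    (\<integral>\<^sup>+\<omega>. ennreal (cyl_fn l \<omega> * (run_sup t \<omega> - \<omega> t) * \<phi> (run_sup t \<omega>)) \<partial>P)" .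
  also have "\<dots> = (\<integral>\<^sup>+\<omega>. ennreal (cyl_fn l \<omega> * (1 - primitive_fn \<phi> (run_sup t \<omega>))) +
      ennreal (cyl_fn l \<omega> * (run_sup t \<omega> - \<omega> t) * \<phi> (run_sup t \<omega>)) \<partial>P)"
  proof -
    note tP[measurable]
    show ?thesis by (rule nn_integral_add[symmetric]) measurable
  qed
  also have "\<dots> = (\<integral>\<^sup>+\<omega>. ennreal (cyl_fn l \<omega> * weight t \<omega>) \<partial>P)"
  proof (rule nn_integral_cong_AE)
    show "AE \<omega> in P. ennreal (cyl_fn l \<omega> * (1 - primitive_fn \<phi> (run_sup t \<omega>))) +
      ennreal (cyl_fn l \<omega> * (run_sup t \<omega> - \<omega> t) * \<phi> (run_sup t \<omega>)) = ennreal (cyl_fn l \<omega> * weight t \<omega>)"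
      using AE_run_sup_nonneg[OF t] AE_space
    proof eventually_elim
      fix \<omega> assume s: "0 \<le> run_sup t \<omega>" and w: "\<omega> \<in> space P"
      have "0 \<le> cyl_fn l \<omega> * (run_sup t \<omega> - \<omega> t) * \<phi> (run_sup t \<omega>)"
        using le_run_sup[of \<omega> t t] w t phi_nonneg[OF s] F[of \<omega>] by (intro mult_nonneg_nonneg) auto
      moreover have "0 \<le> cyl_fn l \<omega> * (1 - primitive_fn \<phi> (run_sup t \<omega>))"
        by (intro mult_nonneg_nonneg F primitive_fn_tail(1)[OF s])
      ultimately show "ennreal (cyl_fn l \<omega> * (1 - primitive_fn \<phi> (run_sup t \<omega>))) +
        ennreal (cyl_fn l \<omega> * (run_sup t \<omega> - \<omega> t) * \<phi> (run_sup t \<omega>)) = ennreal (cyl_fn l \<omega> * weight t \<omega>)"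
        by (simp add: ennreal_plus[symmetric] weight_def algebra_simps del: ennreal_plus)
    qed
  qed
  finally show "(\<integral>\<^sup>+\<omega>. ennreal (cyl_fn l \<omega> * weight t \<omega>) \<partial>P) =
      (\<integral>\<^sup>+y. ennreal (dens y) * ennreal (\<integral>\<omega>. cyl_fn l \<omega> \<partial>Qy y) \<partial>lborel)" by simp
qed


lemma mixture_integrable:
  assumes "(\<lambda>y. indicator {0<..} y * measure (Qy y) \<Gamma>) \<in> borel_measurable lborel"
  shows "integrable lborel (\<lambda>y. dens y * measure (Qy y) \<Gamma>)"
proof (rule Bochner_Integration.integrable_bound[OF dens_integrable])
  have "(\<lambda>y. \<phi> y * (indicator {0<..} y * measure (Qy y) \<Gamma>)) \<in> borel_measurable lborel"
    by (rule borel_measurable_times[OF _ assms]) measurable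
  then show "(\<lambda>y. dens y * measure (Qy y) \<Gamma>) \<in> borel_measurable lborel"
    by (simp add: dens_def ac_simps)
  have "dens y * measure (Qy y) \<Gamma> \<le> dens y" for y
  proof (cases "0 < y")
    case True
    interpret Qy: prob_space "Qy y" by (rule Qy_prob[OF True])
    show ?thesis using mult_left_mono[OF Qy.prob_le_1 dens_nonneg] by simp
  qed (simp add: dens_def)
  then show "AE y in lborel. norm (dens y * measure (Qy y) \<Gamma>) \<le> norm (dens y)"
    by (simp add: abs_mult)
qed

text \<open>The bumps turn the cylinder identity into one for boxes. The dominating functions are
  the weight on the side of \<open>P\<close> and \<open>dens\<close> on the side of the
  levels.\<close>

lemma mixture_box:
  assumes "\<Gamma> \<in> compact_boxes"
  shows "(\<lambda>y. indicator {0<..} y * measure (Qy y) \<Gamma>) \<in> borel_measurable lborel \<and>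
    measure Q \<Gamma> = (\<integral>y. dens y * measure (Qy y) \<Gamma> \<partial>lborel)"
proof -
  obtain I C where \<Gamma>: "\<Gamma> = {\<omega> \<in> path_space. \<forall>u\<in>I. \<omega> u \<in> C u}" and I: "finite I" "I \<subseteq> {0..}" "I \<noteq> {}"
    and C: "\<And>u. compact (C u)"
    using assms unfolding compact_boxes_def by blast
  show ?thesis
  proof (cases "\<exists>u\<in>I. C u = {}")
    \<comment> \<open>The distance to the empty set is 0 by convention, so bumps would not
      approximate its indicator; but then the box itself is empty.\<close>
    case True
    then have "\<Gamma> = {}" unfolding \<Gamma> by auto
    then show ?thesis by simp
  next
    case False
    then have CI: "\<And>u. u \<in> I \<Longrightarrow> compact (C u) \<and> C u \<noteq> {}" using C by auto
    let ?l = "\<lambda>m. box_cyl I C m"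
    have l: "cyl_from 0 (?l m)" "?l m \<noteq> []" for m
    proof -
      show "cyl_from 0 (?l m)" unfolding box_cyl_def
        by (rule cyl_from_map) (use I CI test_fn_bump in \<open>auto simp: set_sorted_list_of_set\<close>)
      show "?l m \<noteq> []" unfolding box_cyl_def using I by (simp add: sorted_list_of_set_eq_Nil_iff)
    qed
    define t where "t = last_time 0 (?l 0)"
    \<comment> \<open>The time does not depend on the bumps, so a single \<open>weight t\<close>
      serves for all m.\<close>
    have tm: "last_time 0 (?l m) = t" for m unfolding t_def box_cyl_def by (rule last_time_map)
    have t: "0 \<le> t" unfolding t_def by (rule last_time_ge[OF l(1)])
    have It: "I \<subseteq> {0..t}"
    proof
      fix u assume u: "u \<in> I"
      then have "u \<le> t" unfolding t_def box_cyl_def by (intro last_time_ge_mem) (use I in auto)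
      then show "u \<in> {0..t}" using u I by auto
    qed
    have \<Gamma>t: "\<Gamma> \<in> sets (canon_filt t)"
      unfolding sets_coord_algebra_boxes \<Gamma>
    proof (rule sigma_sets.Basic)
      show "{\<omega> \<in> path_space. \<forall>u\<in>I. \<omega> u \<in> C u} \<in>
        {{\<omega> \<in> path_space. \<forall>u\<in>J. \<omega> u \<in> B u} | J B. finite J \<and> J \<subseteq> {0..t} \<and> (\<forall>u. B u \<in> sets borel)}"
        using I It C borel_compact by blast
    qed
    have \<Gamma>inf: "\<Gamma> \<in> sets canon_inf"
      using \<Gamma>t sets_coord_algebra_mono[of "{0..t}" "{0..}"] by auto
    have \<Gamma>P[measurable]: "\<Gamma> \<in> sets P" using \<Gamma>inf by (simp add: sets_P)
    have F: "0 \<le> cyl_fn (?l m) \<omega>" "cyl_fn (?l m) \<omega> \<le> 1" for m \<omega>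
      using cyl_fn_bounds[OF l(1)] by auto
    have lim: "(\<lambda>m. cyl_fn (?l m) \<omega>) \<longlonglongrightarrow> indicator \<Gamma> \<omega>" if "\<omega> \<in> path_space" for \<omega>
      unfolding \<Gamma> by (rule cyl_fn_box_tendsto[OF I(1) CI that])
    have Finf: "cyl_fn (?l m) \<in> borel_measurable canon_inf" for m
      by (rule measurable_canon_inf[OF measurable_cyl_fn[OF order_refl l(1)]])
    have FP[measurable]: "cyl_fn (?l m) \<in> borel_measurable P" for m
      by (rule measurable_P[OF measurable_cyl_fn[OF order_refl l(1)]])
    note [measurable] = weight_measurable[OF t]
    have limQ: "(\<lambda>m. \<integral>\<omega>. cyl_fn (?l m) \<omega> \<partial>Qy y) \<longlonglongrightarrow> measure (Qy y) \<Gamma>" if y: "0 < y" for y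
    proof -
      interpret Qy: prob_space "Qy y" by (rule Qy_prob[OF y])
      have m: "cyl_fn (?l m) \<in> borel_measurable (Qy y)" for m
        using Finf unfolding measurable_cong_sets[OF sets_Qy[OF y] refl] .
      have \<Gamma>y: "\<Gamma> \<in> sets (Qy y)" using \<Gamma>inf sets_Qy[OF y] by simp
      have "(\<lambda>m. \<integral>\<omega>. cyl_fn (?l m) \<omega> \<partial>Qy y) \<longlonglongrightarrow> (\<integral>\<omega>. indicator \<Gamma> \<omega> \<partial>Qy y)"
      proof (rule integral_dominated_convergence[where w="\<lambda>_. 1"])
        show "AE \<omega> in Qy y. (\<lambda>m. cyl_fn (?l m) \<omega>) \<longlonglongrightarrow> indicator \<Gamma> \<omega>"
          by (rule AE_I2, rule lim) (use space_Qy[OF y] in simp)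
        show "AE \<omega> in Qy y. norm (cyl_fn (?l m) \<omega>) \<le> 1" for m using F by simp
        show "indicator \<Gamma> \<in> borel_measurable (Qy y)" using \<Gamma>y by (rule borel_measurable_indicator)
      qed (use m in auto)
      then show ?thesis using \<Gamma>y by simp
    qed
    have F_le: "(\<integral>\<omega>. cyl_fn (?l m) \<omega> \<partial>Qy y) \<le> 1" if y: "0 < y" for m y
    proof -
      interpret Qy: prob_space "Qy y" by (rule Qy_prob[OF y])
      have "integrable (Qy y) (cyl_fn (?l m))"
        by (rule Qy.integrable_const_bound[where B=1])
           (use F Finf in \<open>auto simp: measurable_cong_sets[OF sets_Qy[OF y] refl]\<close>)
      then have "(\<integral>\<omega>. cyl_fn (?l m) \<omega> \<partial>Qy y) \<le> (\<integral>\<omega>. 1 \<partial>Qy y)"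
        by (intro integral_mono) (use F in auto)
      then show ?thesis using Qy.prob_space by simp
    qed
    have meas1: "(\<lambda>y. indicator {0<..} y * ennreal (measure (Qy y) \<Gamma>)) \<in> borel_measurable lborel"
    proof (rule borel_measurable_LIMSEQ_order)
      show "(\<lambda>y. indicator {0<..} y * ennreal (\<integral>\<omega>. cyl_fn (?l m) \<omega> \<partial>Qy y)) \<in> borel_measurable lborel" for m
        by (rule mixture_cyl(1)[OF l])
      show "(\<lambda>m. indicator {0<..} y * ennreal (\<integral>\<omega>. cyl_fn (?l m) \<omega> \<partial>Qy y)) \<longlonglongrightarrow>
        indicator {0<..} y * ennreal (measure (Qy y) \<Gamma>)" for y
        using tendsto_ennrealI[OF limQ[of y]] by (cases "0 < y") auto
    qed
    have "(\<lambda>y. enn2real (indicator {0<..} y * ennreal (measure (Qy y) \<Gamma>))) \<in> borel_measurable lborel"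
      using meas1 by measurable
    also have "(\<lambda>y. enn2real (indicator {0<..} y * ennreal (measure (Qy y) \<Gamma>))) =
      (\<lambda>y. indicator {0<..} y * measure (Qy y) \<Gamma>)"
      by (auto simp: indicator_def)
    finally have meas: "(\<lambda>y. indicator {0<..} y * measure (Qy y) \<Gamma>) \<in> borel_measurable lborel" .
    have wi: "integrable P (weight t)" by (rule weight_integrable[OF t])
    have left: "(\<lambda>m. \<integral>\<^sup>+\<omega>. ennreal (cyl_fn (?l m) \<omega> * weight t \<omega>) \<partial>P) \<longlonglongrightarrow>
      (\<integral>\<^sup>+\<omega>. ennreal (indicator \<Gamma> \<omega> * weight t \<omega>) \<partial>P)"
    proof (rule nn_integral_dominated_convergence[where w="\<lambda>\<omega>. ennreal (weight t \<omega>)"])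
      show "(\<integral>\<^sup>+\<omega>. ennreal (weight t \<omega>) \<partial>P) < \<infinity>"
        using nn_integral_eq_integral[OF wi weight_nonneg[OF t]] by simp
      show "AE \<omega> in P. ennreal (cyl_fn (?l m) \<omega> * weight t \<omega>) \<le> ennreal (weight t \<omega>)" for m
        using weight_nonneg[OF t] by eventually_elim (use F in \<open>auto intro!: ennreal_leI mult_left_le_one_le\<close>)
      show "AE \<omega> in P. (\<lambda>m. ennreal (cyl_fn (?l m) \<omega> * weight t \<omega>)) \<longlonglongrightarrow> ennreal (indicator \<Gamma> \<omega> * weight t \<omega>)"
        by (rule AE_I2, intro tendsto_ennrealI tendsto_mult_right lim) simp
    qed measurable
    have right: "(\<lambda>m. \<integral>\<^sup>+y. ennreal (dens y) * ennreal (\<integral>\<omega>. cyl_fn (?l m) \<omega> \<partial>Qy y) \<partial>lborel) \<longlonglongrightarrow>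
      (\<integral>\<^sup>+y. ennreal (dens y) * ennreal (measure (Qy y) \<Gamma>) \<partial>lborel)"
    proof (rule nn_integral_dominated_convergence[where w="\<lambda>y. ennreal (dens y)"])
      \<comment> \<open>\<open>dens\<close> vanishes for y \<le> 0; the indicator is made explicit
        because measurability in y is known only on the positive levels.\<close>
      have deq: "(\<lambda>y. ennreal (dens y) * f y) = (\<lambda>y. ennreal (dens y) * (indicator {0<..} y * f y))" for f
        by (auto simp: dens_def indicator_def)
      show "(\<lambda>y. ennreal (dens y) * ennreal (\<integral>\<omega>. cyl_fn (?l m) \<omega> \<partial>Qy y)) \<in> borel_measurable lborel" for m
        by (subst deq, rule borel_measurable_times_ennreal[OF _ mixture_cyl(1)[OF l]]) measurable
      show "(\<lambda>y. ennreal (dens y) * ennreal (measure (Qy y) \<Gamma>)) \<in> borel_measurable lborel"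
        by (subst deq, rule borel_measurable_times_ennreal[OF _ meas1]) measurable
      show "(\<integral>\<^sup>+y. ennreal (dens y) \<partial>lborel) < \<infinity>"
        by (subst nn_integral_eq_integral[OF dens_integrable]) auto
      show "AE y in lborel. ennreal (dens y) * ennreal (\<integral>\<omega>. cyl_fn (?l m) \<omega> \<partial>Qy y) \<le> ennreal (dens y)" for m
      proof (rule AE_I2)
        fix y show "ennreal (dens y) * ennreal (\<integral>\<omega>. cyl_fn (?l m) \<omega> \<partial>Qy y) \<le> ennreal (dens y)"
        proof (cases "0 < y")
          case True
          have "ennreal (dens y) * ennreal (\<integral>\<omega>. cyl_fn (?l m) \<omega> \<partial>Qy y) \<le> ennreal (dens y) * 1"
            by (rule mult_left_mono) (use F_le[OF True] in auto)
          then show ?thesis by simp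
        qed (simp add: dens_def)
      qed
      show "AE y in lborel. (\<lambda>m. ennreal (dens y) * ennreal (\<integral>\<omega>. cyl_fn (?l m) \<omega> \<partial>Qy y)) \<longlonglongrightarrow>
        ennreal (dens y) * ennreal (measure (Qy y) \<Gamma>)"
      proof (rule AE_I2)
        fix y show "(\<lambda>m. ennreal (dens y) * ennreal (\<integral>\<omega>. cyl_fn (?l m) \<omega> \<partial>Qy y)) \<longlonglongrightarrow>
          ennreal (dens y) * ennreal (measure (Qy y) \<Gamma>)"
        proof (cases "0 < y")
          case True
          show ?thesis by (intro ennreal_tendsto_cmult tendsto_ennrealI limQ[OF True]) simp
        qed (simp add: dens_def)
      qed
    qed measurable
    have nn: "(\<integral>\<^sup>+\<omega>. ennreal (indicator \<Gamma> \<omega> * weight t \<omega>) \<partial>P) = (\<integral>\<^sup>+y. ennreal (dens y) * ennreal (measure (Qy y) \<Gamma>) \<partial>lborel)"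
      using LIMSEQ_unique[OF left] right mixture_cyl(2)[OF l] unfolding tm by simp
    have "ennreal (measure Q \<Gamma>) = (\<integral>\<^sup>+\<omega>. ennreal (indicator \<Gamma> \<omega> * weight t \<omega>) \<partial>P)"
      unfolding Q_formula[OF t \<Gamma>t]
    proof (rule nn_integral_eq_integral[symmetric])
      show "integrable P (\<lambda>\<omega>. indicator \<Gamma> \<omega> * weight t \<omega>)"
        using integrable_real_mult_indicator[OF \<Gamma>P wi] by (simp add: mult.commute)
      show "AE \<omega> in P. 0 \<le> indicator \<Gamma> \<omega> * weight t \<omega>"
        using weight_nonneg[OF t] by eventually_elim simp
    qed
    also have "\<dots> = (\<integral>\<^sup>+y. ennreal (dens y * measure (Qy y) \<Gamma>) \<partial>lborel)"
      unfolding nn by (simp add: ennreal_mult)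
    also have "\<dots> = ennreal (\<integral>y. dens y * measure (Qy y) \<Gamma> \<partial>lborel)"
      by (rule nn_integral_eq_integral[OF mixture_integrable[OF meas]]) (auto intro: \<Gamma>inf)
    finally have "measure Q \<Gamma> = (\<integral>y. dens y * measure (Qy y) \<Gamma> \<partial>lborel)"
      by (subst (asm) ennreal_inj) (auto intro!: Bochner_Integration.integral_nonneg)
    then show ?thesis using meas by blast
  qed
qed

text \<open>Dynkin's argument from the compact boxes. Measurability in the level goes through the
  induction together with the formula, since complements and unions call for integrable
  terms.\<close>

lemma Q_eq_mixture:
  assumes "\<Gamma> \<in> sets canon_inf"
  shows "(\<lambda>y. indicator {0<..} y * measure (Qy y) \<Gamma>) \<in> borel_measurable lborel \<and>
    measure Q \<Gamma> = (\<integral>y. dens y * measure (Qy y) \<Gamma> \<partial>lborel)"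
proof -
  interpret Q: prob_space Q by (rule Q_prob)
  have ev: "A \<in> sets canon_inf" if "A \<in> sigma_sets path_space compact_boxes" for A
    using that unfolding sets_canon_inf_compact_boxes .
  have "\<Gamma> \<in> sigma_sets path_space compact_boxes"
    using assms unfolding sets_canon_inf_compact_boxes .
  from compact_boxes_subset this show ?thesis
  proof (induction rule: sigma_sets_induct_disjoint[OF Int_stable_compact_boxes, consumes 2, case_names basic empty compl union])
    case (basic A)
    then show ?case by (rule mixture_box)
  next
    case empty
    show ?case by simp
  next
    case (compl A)
    have A: "A \<in> sets canon_inf" by (rule ev[OF compl(1)])
    have c: "indicator {0<..} y * measure (Qy y) (path_space - A) = indicator {0<..} y - indicator {0<..} y * measure (Qy y) A" for y
    proof (cases "0 < y")
      case True
      interpret Qy: prob_space "Qy y" by (rule Qy_prob[OF True])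
      show ?thesis using Qy.prob_compl[of A] A True by (simp add: sets_Qy space_Qy)
    qed simp
    have d: "dens y * measure (Qy y) (path_space - A) = dens y - dens y * measure (Qy y) A" for y
    proof (cases "0 < y")
      case True
      then have "measure (Qy y) (path_space - A) = 1 - measure (Qy y) A" using c[of y] by simp
      then show ?thesis by (simp add: right_diff_distrib)
    qed (simp add: dens_def)
    have "measure Q (path_space - A) = 1 - measure Q A"
      using Q.prob_compl[of A] A by (simp add: sets_Q space_Q)
    moreover have "(\<integral>y. dens y * measure (Qy y) (path_space - A) \<partial>lborel) = 1 - (\<integral>y. dens y * measure (Qy y) A \<partial>lborel)"
      unfolding d using Bochner_Integration.integral_diff[OF dens_integrable mixture_integrable] compl(2) dens_total by simp
    moreover have "(\<lambda>y. indicator {0<..} y - indicator {0<..} y * measure (Qy y) A) \<in> borel_measurable lborel"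
      by (intro borel_measurable_diff borel_measurable_indicator) (use compl(2) in auto)
    ultimately show ?case using compl(2) unfolding c by simp
  next
    case (union A)
    have A: "A i \<in> sets canon_inf" for i using ev union(2) by auto
    have s: "(\<lambda>i. measure (Qy y) (A i)) sums measure (Qy y) (\<Union>i. A i)" if y: "0 < y" for y
    proof -
      interpret Qy: prob_space "Qy y" by (rule Qy_prob[OF y])
      show ?thesis by (rule Qy.finite_measure_UNION) (use A union(1) sets_Qy[OF y] in auto)
    qed
    have sQ: "(\<lambda>i. measure Q (A i)) sums measure Q (\<Union>i. A i)"
      by (rule Q.finite_measure_UNION) (use A union(1) sets_Q in auto)
    \<comment> \<open>For y \<le> 0 nothing is known about \<open>Qy y\<close>; a factor vanishing
      there makes the series trivial. It is used with the indicator and with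
      \<open>dens\<close>.\<close>
    have s0: "(\<lambda>i. f y * measure (Qy y) (A i)) sums (f y * measure (Qy y) (\<Union>i. A i))"
      if "\<And>y. y \<le> 0 \<Longrightarrow> f y = 0" for f y
      using s[of y] that[of y] by (cases "0 < y") (auto intro: sums_mult)
    have m: "(\<lambda>y. indicator {0<..} y * measure (Qy y) (\<Union>i. A i)) \<in> borel_measurable lborel"
    proof (rule borel_measurable_LIMSEQ_real)
      show "(\<lambda>n. \<Sum>i<n. indicator {0<..} y * measure (Qy y) (A i)) \<longlonglongrightarrow> indicator {0<..} y * measure (Qy y) (\<Union>i. A i)" for y
        using s0[of "indicator {0<..}" y] unfolding sums_def by simp
      show "(\<lambda>y. \<Sum>i<n. indicator {0<..} y * measure (Qy y) (A i)) \<in> borel_measurable lborel" for n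
        using union(3) by (intro borel_measurable_sum) blast
    qed
    have sd: "(\<lambda>i. dens y * measure (Qy y) (A i)) sums (dens y * measure (Qy y) (\<Union>i. A i))" for y
      by (rule s0) (simp add: dens_def)
    have int: "integrable lborel (\<lambda>y. dens y * measure (Qy y) (A i))" for i
      using union(3) by (intro mixture_integrable) blast
    \<comment> \<open>The terms are nonnegative and their integrals are the numbers
      \<open>measure Q (A i)\<close>, which are summable; this permits exchanging sum and
      integral.\<close>
    have "(\<lambda>i. \<integral>y. dens y * measure (Qy y) (A i) \<partial>lborel) sums (\<integral>y. (\<Sum>i. dens y * measure (Qy y) (A i)) \<partial>lborel)"
    proof (rule sums_integral[OF int])
      show "AE y in lborel. summable (\<lambda>i. norm (dens y * measure (Qy y) (A i)))"
        using sums_summable[OF sd] by simp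
      have "summable (\<lambda>i. measure Q (A i))" using sQ by (rule sums_summable)
      then show "summable (\<lambda>i. \<integral>y. norm (dens y * measure (Qy y) (A i)) \<partial>lborel)"
        using union(3) by simp
    qed
    moreover have "(\<Sum>i. dens y * measure (Qy y) (A i)) = dens y * measure (Qy y) (\<Union>i. A i)" for y
      using sums_unique[OF sd] by simp
    ultimately have "(\<lambda>i. measure Q (A i)) sums (\<integral>y. dens y * measure (Qy y) (\<Union>i. A i) \<partial>lborel)"
      using union(3) by simp
    then have "measure Q (\<Union>i. A i) = (\<integral>y. dens y * measure (Qy y) (\<Union>i. A i) \<partial>lborel)"
      by (rule sums_unique2[OF sQ])
    then show ?case using m by blast
  qed
qed

end

theorem proposition5p1:
  fixes \<phi> :: "real \<Rightarrow> real"
    and P0 Q\<phi> :: "(real \<Rightarrow> real) measure"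
    and Qy :: "real \<Rightarrow> (real \<Rightarrow> real) measure"
  assumes "wiener_measure P0"
    and "\<phi> \<in> borel_measurable borel"
    and "\<And>u. 0 \<le> u \<Longrightarrow> 0 \<le> \<phi> u"
    and "set_integrable lborel {0..} \<phi>"
    and "(LINT u:{0..}|lborel. \<phi> u) = 1"
    and "is_Q_phi P0 \<phi> Q\<phi>"
    and "\<And>y. 0 < y \<Longrightarrow> is_Q_level P0 y (Qy y)"
  shows "\<forall>\<Gamma>\<in>sets canon_inf.
    set_integrable lborel {0<..} (\<lambda>y. measure (Qy y) \<Gamma> * \<phi> y) \<and>
    measure Q\<phi> \<Gamma> = (LINT y:{0<..}|lborel. measure (Qy y) \<Gamma> * \<phi> y)"
proof
  fix \<Gamma> assume \<Gamma>: "\<Gamma> \<in> sets canon_inf"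
  interpret level_mixture P0 \<phi> Q\<phi> Qy
    by unfold_locales (use assms in auto)
  have e: "indicator {0<..} y *\<^sub>R (measure (Qy y) \<Gamma> * \<phi> y) = dens y * measure (Qy y) \<Gamma>" for y
    by (simp add: dens_def)
  have "integrable lborel (\<lambda>y. dens y * measure (Qy y) \<Gamma>)"
    using Q_eq_mixture[OF \<Gamma>] by (intro mixture_integrable) blast
  then show "set_integrable lborel {0<..} (\<lambda>y. measure (Qy y) \<Gamma> * \<phi> y) \<and>
    measure Q\<phi> \<Gamma> = (LINT y:{0<..}|lborel. measure (Qy y) \<Gamma> * \<phi> y)"
    unfolding set_integrable_def set_lebesgue_integral_def e using Q_eq_mixture[OF \<Gamma>] by blast
qed

end
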